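(* Let $\kappa=\frac12$. Then $\alpha_{OU}$ is the unique quasi-stationary distribution for $X$ absorbed at $(-1,1)^c$, i.e. the unique probability measure $\alpha$ on $(-1,1)$ such that $\mathbb{P}_{\alpha,s}(X_t\in\cdot\mid\tau_X>t)=\alpha$ for all $0\le s\le t$. Moreover there exist constants $C_{OU},\gamma_{OU}>0$ such that for every probability measure $\mu$ on $(-1,1)$ and all $0\le s\le t$, $$\big\|\mathbb{P}_{\mu,s}(X_t\in\cdot\mid\tau_X>t)-\alpha_{OU}\big\|_{TV}\le C_{OU}\left(\frac{s+1}{t+1}\right)^{\gamma_{OU}}.$$ In particular, for every such $\mu$ and $s\ge0$, $\mathbb{P}_{\mu,s}(X_t\in\cdot\mid\tau_X>t)$ converges weakly to $\alpha_{OU}$ as $t\to\infty$.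
   Context: For $s\ge 0$ and $x\in\mathbb{R}$, let $\mathbb{P}_{x,s}$ be a probability measure under which $(X_t)_{t\ge s}$ is given by $X_t=\frac{x(s+1)^{1/2}+W_{t-s}}{(t+1)^{1/2}}$, with $W$ a standard Brownian motion started at $0$ (so $X_t=B_t/\sqrt{t+1}$ with $B_s=x\sqrt{s+1}$). Let $\tau_X:=\inf\{t\ge s:|X_t|=1\}$ and $\mathbb{P}_{\mu,s}:=\int\mathbb{P}_{x,s}\mu(dx)$. Let $Z$ be the Ornstein–Uhlenbeck process with generator $Lf(x)=\frac12 f''(x)-\frac12 xf'(x)$ (i.e. $dZ_t=-\frac12 Z_t\,dt+dW_t$), and $\tau_Z:=\inf\{t\ge0:|Z_t|=1\}$. $\alpha_{OU}$ denotes the unique quasi-stationary distribution of $Z$ absorbed at $(-1,1)^c$, i.e. the unique probability measure $\alpha$ on $(-1,1)$ with $\mathbb{P}^Z_\alpha(Z_t\in\cdot\mid\tau_Z>t)=\alpha$ for all $t\ge0$; explicitly $\alpha_{OU}(dx)=K(1-x^2)e^{-x^2/2}dx$ on $(-1,1)$ with $K$ a normalizing constant. Total variation distance: $\|\mu-\nu\|_{TV}:=\sup_{\|f\|_\infty\le1}|\int f\,d\mu-\int f\,d\nu|$. *)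

theory Defs
  imports "HOL-Probability.Probability"
begin

definition std_BM :: "'a measure \<Rightarrow> (real \<Rightarrow> 'a \<Rightarrow> real) \<Rightarrow> bool" where
  "std_BM M W \<longleftrightarrow> prob_space M
     \<and> (\<forall>t\<ge>0. W t \<in> borel_measurable M)
     \<and> (\<forall>\<omega>\<in>space M. W 0 \<omega> = 0 \<and> continuous_on {0..} (\<lambda>t. W t \<omega>))
     \<and> (\<forall>a b. 0 \<le> a \<and> a < b \<longrightarrow>
          distributed M lborel (\<lambda>\<omega>. W b \<omega> - W a \<omega>) (\<lambda>x. ennreal (normal_density 0 (sqrt (b - a)) x)))
     \<and> (\<forall>(n::nat) (t::nat \<Rightarrow> real). 0 \<le> t 0 \<and> (\<forall>i<n. t i < t (Suc i)) \<longrightarrow>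
          prob_space.indep_vars M (\<lambda>_. borel) (\<lambda>i \<omega>. W (t (Suc i)) \<omega> - W (t i) \<omega>) {..<n})"

definition Xproc :: "(real \<Rightarrow> 'a \<Rightarrow> real) \<Rightarrow> real \<Rightarrow> real \<Rightarrow> real \<Rightarrow> 'a \<Rightarrow> real" where
  "Xproc W x s t \<omega> = (x * sqrt (s + 1) + W (t - s) \<omega>) / sqrt (t + 1)"

definition tauX :: "(real \<Rightarrow> 'a \<Rightarrow> real) \<Rightarrow> real \<Rightarrow> real \<Rightarrow> 'a \<Rightarrow> ereal" where
  "tauX W x s \<omega> = Inf (ereal ` {t. s \<le> t \<and> \<bar>Xproc W x s t \<omega>\<bar> = 1})"

text \<open>P_{mu,s}: initial point x ~ mu independent of W, realised as the product space mu x M.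
  The survival event {tau_X > t} in it:\<close>
definition surv_event :: "real measure \<Rightarrow> 'a measure \<Rightarrow> (real \<Rightarrow> 'a \<Rightarrow> real) \<Rightarrow> real \<Rightarrow> real \<Rightarrow> (real \<times> 'a) set" where
  "surv_event \<mu> M W s t = {p \<in> space (\<mu> \<Otimes>\<^sub>M M). tauX W (fst p) s (snd p) > ereal t}"

definition cond_law :: "'a measure \<Rightarrow> (real \<Rightarrow> 'a \<Rightarrow> real) \<Rightarrow> real measure \<Rightarrow> real \<Rightarrow> real \<Rightarrow> real measure" where
  "cond_law M W \<mu> s t =
     distr (density (\<mu> \<Otimes>\<^sub>M M)
              (\<lambda>p. ennreal (indicator (surv_event \<mu> M W s t) p / measure (\<mu> \<Otimes>\<^sub>M M) (surv_event \<mu> M W s t))))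
           borel (\<lambda>p. Xproc W (fst p) s t (snd p))"

definition prob_on_interval :: "real measure \<Rightarrow> bool" where
  "prob_on_interval \<mu> \<longleftrightarrow> prob_space \<mu> \<and> sets \<mu> = sets borel \<and> emeasure \<mu> {-1<..<1} = 1"

definition is_qsd_X :: "'a measure \<Rightarrow> (real \<Rightarrow> 'a \<Rightarrow> real) \<Rightarrow> real measure \<Rightarrow> bool" where
  "is_qsd_X M W \<alpha> \<longleftrightarrow> prob_on_interval \<alpha> \<and> (\<forall>s t. 0 \<le> s \<and> s \<le> t \<longrightarrow> cond_law M W \<alpha> s t = \<alpha>)"

definition K_OU :: real where
  "K_OU = 1 / integral\<^sup>L lborel (\<lambda>x. indicator {-1<..<1} x * ((1 - x\<^sup>2) * exp (- (x\<^sup>2) / 2)))"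

definition alpha_OU :: "real measure" where
  "alpha_OU = density lborel (\<lambda>x. ennreal (indicator {-1<..<1} x * (K_OU * (1 - x\<^sup>2) * exp (- (x\<^sup>2) / 2))))"

definition tv_dist :: "real measure \<Rightarrow> real measure \<Rightarrow> real" where
  "tv_dist \<mu> \<nu> = Sup {\<bar>integral\<^sup>L \<mu> f - integral\<^sup>L \<nu> f\<bar> | f. f \<in> borel_measurable borel \<and> (\<forall>x. \<bar>f x\<bar> \<le> 1)}"

definition weak_conv_at_top :: "(real \<Rightarrow> real measure) \<Rightarrow> real measure \<Rightarrow> bool" where
  "weak_conv_at_top \<nu> \<alpha> \<longleftrightarrow> (\<forall>f::real \<Rightarrow> real. continuous_on UNIV f \<and> bounded (range f) \<longrightarrow>
      ((\<lambda>t. integral\<^sup>L (\<nu> t) f) \<longlongrightarrow> integral\<^sup>L \<alpha> f) at_top)"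

end

theory Submission
  imports Defs
begin

text \<open>
In logarithmic time \<open>t + 1 = (s + 1) exp r\<close> the process is an Ornstein--Uhlenbeck process killed
outside \<open>(-1,1)\<close>. Its killed semigroup \<open>P\<^sub>r\<close> is reversible with respect to \<open>exp (-x\<^sup>2/2) dx\<close> and has the
explicit eigenfunction \<open>h x = 1 - x\<^sup>2\<close>, \<open>P\<^sub>r h = exp (-r) h\<close>; these two facts give the quasi-stationarity of
\<open>h exp (-x\<^sup>2/2) dx\<close>. For the rate, a caloric polynomial of degree four yields \<open>P\<^sub>r 1 \<le> 2 h\<close>, so that from
any starting point the process reaches a compact core with probability at least a multiple of \<open>h\<close>, and the
method of images bounds the killed transition density on the core from below. Hence \<open>P\<^sub>r f \<ge> c h \<integral>f\<close>
(integral over a small interval), i.e. the transform \<open>exp r P\<^sub>r (h f) / h\<close> satisfies Doeblin's condition and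
contracts oscillations geometrically; dividing by \<open>P\<^sub>r 1\<close> gives the total variation bound.

The semigroup is handled through discrete skeletons: \<open>P\<^sub>r f\<close> is the limit of compositions of Gaussian operators
restricted to \<open>(-1,1)\<close> on dyadic grids of \<open>[0,r]\<close>. All barrier arguments are inductions over a grid, in which the
overshoot of the last step either has a sign or contributes an error that vanishes with the mesh.
\<close>

subsection \<open>The Ornstein--Uhlenbeck transition operator restricted to a set\<close>

text \<open>With \<open>r = ln ((t + 1) / (s + 1))\<close> an exponential rate in log time is a
  power of \<open>(s + 1) / (t + 1)\<close>, and \<open>s\<close> drops out of the transition law.
  The first obstacle is uniformity in the initial law: near the endpoints the survival probability
  itself vanishes, so every estimate, from above and from below, is made relative to h, and h
  cancels when the conditional law is formed. The second is that a grid sees more survivors than the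
  continuous path does. Skeletons need nothing beyond independent Gaussian increments, no Markov
  property at exit times, but the two notions of survival must be reconciled; h does this too. The
  third is that dyadic grids compose well only under doubling of the time. A long time is therefore
  written as \<open>2^j * r\<close> with \<open>r\<close> in \<open>{ln 2..2 * ln 2}\<close>, and a
  Doeblin step of length \<open>r\<close> is split into two halves from
  \<open>{ln 2 / 2..ln 2}\<close>. The lower end of that window makes the caloric quartic large
  enough at the terminal time; the upper end keeps the reflected Gaussians small on the
  core.\<close>

abbreviation ou_sd :: "real \<Rightarrow> real" where "ou_sd d \<equiv> sqrt (1 - exp (- d))"

text \<open>The drift \<open>- x / 2\<close> contracts the mean by \<open>exp (- d / 2)\<close>; the
  stationary law is standard normal, hence the variance \<open>1 - exp (- d)\<close>. Killing tests
  the arrival point alone, so the start \<open>x\<close> may lie outside \<open>D\<close>.\<close>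

definition ouK :: "real set \<Rightarrow> real \<Rightarrow> (real \<Rightarrow> real) \<Rightarrow> real \<Rightarrow> real" where
  "ouK D d f x = (\<integral>y. normal_density (exp (- d / 2) * x) (ou_sd d) y * (indicator D y * f y) \<partial>lborel)"

text \<open>Measurability is global but boundedness is asked on \<open>D\<close> alone, since
  \<open>ouK\<close> masks the function off \<open>D\<close>; polynomials such as
  \<open>ground\<close> then qualify without truncation.\<close>

definition bdd_meas :: "real set \<Rightarrow> (real \<Rightarrow> real) \<Rightarrow> bool" where
  "bdd_meas D f \<longleftrightarrow> f \<in> borel_measurable borel \<and> (\<exists>B. \<forall>x\<in>D. \<bar>f x\<bar> \<le> B)"

lemma bdd_meas_measurable[measurable_dest]: "bdd_meas D f \<Longrightarrow> f \<in> borel_measurable borel"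
  by (simp add: bdd_meas_def)

lemma bdd_measE:
  assumes "bdd_meas D f" obtains B where "B \<ge> 0" "\<And>x. x \<in> D \<Longrightarrow> \<bar>f x\<bar> \<le> B"
  using assms unfolding bdd_meas_def by (metis abs_ge_zero abs_of_nonneg linorder_linear order_trans)

lemma bdd_measI: "f \<in> borel_measurable borel \<Longrightarrow> (\<And>x. x \<in> D \<Longrightarrow> \<bar>f x\<bar> \<le> B) \<Longrightarrow> bdd_meas D f"
  by (auto simp: bdd_meas_def)

lemma bdd_meas_subset: "bdd_meas D f \<Longrightarrow> E \<subseteq> D \<Longrightarrow> bdd_meas E f"
  by (auto simp: bdd_meas_def)

lemma bdd_meas_const: "bdd_meas D (\<lambda>_. c)"
  by (auto simp: bdd_meas_def)

lemma ou_sd_pos: "d > 0 \<Longrightarrow> ou_sd d > 0"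
  by simp

lemma integrable_nd_bm:
  assumes "bdd_meas D f" "D \<in> sets borel" "\<sigma> > 0"
  shows "integrable lborel (\<lambda>y. normal_density m \<sigma> y * (indicator D y * f y))"
proof -
  obtain B where B: "B \<ge> 0" "\<And>x. x \<in> D \<Longrightarrow> \<bar>f x\<bar> \<le> B" using assms(1) by (rule bdd_measE) blast
  note [measurable] = bdd_meas_measurable[OF assms(1)] assms(2)
  show ?thesis
  proof (rule Bochner_Integration.integrable_bound)
    show "integrable lborel (\<lambda>y. normal_density m \<sigma> y * B)"
      using assms(3) by (simp add: integrable_normal_density)
    show "AE y in lborel. norm (normal_density m \<sigma> y * (indicator D y * f y)) \<le> norm (normal_density m \<sigma> y * B)"
      using B by (auto simp: abs_mult indicator_def intro!: mult_left_mono split: if_splits)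
  qed measurable
qed

lemma ouK_measurable[measurable]:
  assumes [measurable]: "f \<in> borel_measurable borel" "D \<in> sets borel"
  shows "ouK D d f \<in> borel_measurable borel"
  unfolding ouK_def normal_density_def by measurable

lemma ouK_mono:
  assumes "bdd_meas D f" "bdd_meas D g" "D \<in> sets borel" "d > 0" "\<And>y. y \<in> D \<Longrightarrow> f y \<le> g y"
  shows "ouK D d f x \<le> ouK D d g x"
  unfolding ouK_def
proof (rule integral_mono)
  fix y
  have "indicator D y * f y \<le> indicator D y * g y" using assms(5) by (auto simp: indicator_def)
  then show "normal_density (exp (- d / 2) * x) (ou_sd d) y * (indicator D y * f y)
      \<le> normal_density (exp (- d / 2) * x) (ou_sd d) y * (indicator D y * g y)"
    by (rule mult_left_mono) simp
qed (use assms in \<open>auto intro!: integrable_nd_bm\<close>)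

lemma ouK_bound:
  assumes "f \<in> borel_measurable borel" "D \<in> sets borel" "d > 0" "B \<ge> 0" "\<And>y. y \<in> D \<Longrightarrow> \<bar>f y\<bar> \<le> B"
  shows "\<bar>ouK D d f x\<bar> \<le> B"
proof -
  have bm: "bdd_meas D f" using assms by (auto intro: bdd_measI)
  have "\<bar>ouK D d f x\<bar> \<le> (\<integral>y. \<bar>normal_density (exp (- d / 2) * x) (ou_sd d) y * (indicator D y * f y)\<bar> \<partial>lborel)"
    unfolding ouK_def by (rule integral_abs_bound)
  also have "\<dots> \<le> (\<integral>y. normal_density (exp (- d / 2) * x) (ou_sd d) y * B \<partial>lborel)"
    using integrable_nd_bm[OF bm assms(2) ou_sd_pos[OF assms(3)]] assms(3,4,5)
    by (intro integral_mono integrable_abs integrable_mult_left integrable_normal_density)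
       (auto simp: abs_mult indicator_def intro!: mult_left_mono split: if_splits)
  also have "\<dots> = B" using assms(3) by (simp add: integral_normal_density)
  finally show ?thesis .
qed

lemma bdd_meas_ouK:
  assumes "bdd_meas D f" "D \<in> sets borel" "d > 0" shows "bdd_meas E (ouK D d f)"
proof -
  obtain B where "B \<ge> 0" "\<And>x. x \<in> D \<Longrightarrow> \<bar>f x\<bar> \<le> B" using assms(1) by (rule bdd_measE) blast
  then show ?thesis using assms bdd_meas_measurable[OF assms(1)]
    by (auto intro!: bdd_measI[where B=B] ouK_bound)
qed

lemma bdd_meas_ouK_funpow:
  assumes "bdd_meas D f" "D \<in> sets borel" "d > 0" shows "bdd_meas D ((ouK D d ^^ n) f)"
  using assms by (induction n) (auto intro: bdd_meas_ouK)

lemma ouK_funpow_mono: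
  assumes "bdd_meas D f" "bdd_meas D g" "D \<in> sets borel" "d > 0" "\<And>y. y \<in> D \<Longrightarrow> f y \<le> g y" "x \<in> D"
  shows "(ouK D d ^^ n) f x \<le> (ouK D d ^^ n) g x"
  using assms(6)
proof (induction n arbitrary: x)
  case 0 then show ?case using assms by simp
next
  case (Suc n)
  then show ?case using assms by (auto intro!: ouK_mono bdd_meas_ouK_funpow)
qed

lemma ouK_scale: "ouK D d (\<lambda>y. c * f y) = (\<lambda>x. c * ouK D d f x)"
  unfolding ouK_def
  by (subst Bochner_Integration.integral_mult_right_zero[symmetric]) (simp add: algebra_simps)

lemma ouK_funpow_scale: "(ouK D d ^^ n) (\<lambda>y. c * f y) = (\<lambda>x. c * (ouK D d ^^ n) f x)"
  by (induction n) (simp_all add: ouK_scale)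

lemma ouK_funpow_bound:
  assumes "f \<in> borel_measurable borel" "D \<in> sets borel" "d > 0" "B \<ge> 0" "\<And>y. y \<in> D \<Longrightarrow> \<bar>f y\<bar> \<le> B" "x \<in> D"
  shows "\<bar>(ouK D d ^^ n) f x\<bar> \<le> B"
  using assms(6)
proof (induction n arbitrary: x)
  case 0 then show ?case using assms by simp
next
  case (Suc n)
  have "bdd_meas D f" using assms by (auto intro: bdd_measI)
  then have "(ouK D d ^^ n) f \<in> borel_measurable borel"
    using bdd_meas_ouK_funpow bdd_meas_measurable assms by blast
  then show ?case using assms Suc by (auto intro!: ouK_bound)
qed

text \<open>Comparison principles for killing on a grid: \<open>U m\<close> is space-time harmonic for the free operator, \<open>m\<close> counting the remaining steps. For the upper bound \<open>U\<close> may be negative where a step overshoots the boundary; the fourth moment of a step makes the total error of order \<open>n d\<^sup>2\<close>.\<close>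

lemma kill_lower:
  assumes d: "d > 0" and D[measurable]: "D \<in> sets borel" and bm: "bdd_meas D (U 0)" and c: "c \<ge> 0"
    and out: "\<And>m y. m < n \<Longrightarrow> y \<notin> D \<Longrightarrow> U m y \<le> c"
    and cal: "\<And>m x. m < n \<Longrightarrow> has_bochner_integral lborel
          (\<lambda>y. normal_density (exp (- d / 2) * x) (ou_sd d) y * U m y) (U (Suc m) x)"
  shows "(ouK D d ^^ n) (U 0) x \<ge> U n x - c"
proof -
  have "k \<le> n \<Longrightarrow> (ouK D d ^^ k) (U 0) x \<ge> U k x - c" for k x
  proof (induction k arbitrary: x)
    case 0 show ?case using c by simp
  next
    case (Suc k)
    then have kn: "k < n" by simp
    let ?V = "(ouK D d ^^ k) (U 0)" let ?n = "normal_density (exp (- d / 2) * x) (ou_sd d)"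
    have V: "bdd_meas D ?V" by (rule bdd_meas_ouK_funpow[OF bm D d])
    have i: "integrable lborel ?n" "integrable lborel (\<lambda>y. ?n y * U k y)"
      using d cal[OF kn, of x] by (auto simp: has_bochner_integral_iff integrable_normal_density)
    have "U (Suc k) x - c = (\<integral>y. ?n y * U k y - ?n y * c \<partial>lborel)"
      using i d cal[OF kn, of x] by (simp add: has_bochner_integral_iff integral_normal_density)
    also have "\<dots> \<le> (\<integral>y. ?n y * (indicator D y * ?V y) \<partial>lborel)"
    proof (rule integral_mono)
      fix y
      have "U k y - c \<le> indicator D y * ?V y"
        using out[OF kn, of y] Suc.IH[of y] kn by (auto simp: indicator_def)
      then have "?n y * (U k y - c) \<le> ?n y * (indicator D y * ?V y)"
        by (intro mult_left_mono) auto
      then show "?n y * U k y - ?n y * c \<le> ?n y * (indicator D y * ?V y)" by (simp add: algebra_simps)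
    qed (use i V d in \<open>auto intro!: integrable_nd_bm\<close>)
    finally show ?case by (simp add: ouK_def[of D d ?V x])
  qed
  then show ?thesis by simp
qed

text \<open>Expansion about \<open>m\<close>: the odd central moments vanish, the even ones are
  \<open>\<sigma>^2\<close> and \<open>3 * \<sigma>^4\<close>. Even quartics cover both polynomial
  barriers, \<open>ground\<close> and \<open>caloric\<close>.\<close>

lemma has_moments:
  assumes "\<sigma> > 0"
  shows "has_bochner_integral lborel (\<lambda>y. normal_density m \<sigma> y * (a0 + a2 * y^2 + a4 * y^4))
     (a0 + a2 * (m^2 + \<sigma>^2) + a4 * (m^4 + 6 * m^2 * \<sigma>^2 + 3 * \<sigma>^4))"
proof -
  have e: "has_bochner_integral lborel (\<lambda>y. normal_density m \<sigma> y * (y - m)^(2*k))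
          (fact (2 * k) / ((2 / \<sigma>\<^sup>2)^k * fact k))" for k
    using normal_moment_even[OF assms] by simp
  have o: "has_bochner_integral lborel (\<lambda>y. normal_density m \<sigma> y * (y - m)^(2*k+1)) 0" for k
    using normal_moment_odd[OF assms] by simp
  have 4: "has_bochner_integral lborel (\<lambda>y. normal_density m \<sigma> y * (y - m)^4) (3 * \<sigma>^4)"
    using e[of 2] assms by (simp add: fact_numeral power2_eq_square power4_eq_xxxx mult.assoc)
  have 2: "has_bochner_integral lborel (\<lambda>y. normal_density m \<sigma> y * (y - m)^2) (\<sigma>^2)"
    using e[of 1] assms by (simp add: fact_numeral power2_eq_square)
  have 0: "has_bochner_integral lborel (\<lambda>y. normal_density m \<sigma> y) 1"
    using e[of 0] assms by simp
  have 1: "has_bochner_integral lborel (\<lambda>y. normal_density m \<sigma> y * (y - m)) 0"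
    using o[of 0] assms by simp
  have 3: "has_bochner_integral lborel (\<lambda>y. normal_density m \<sigma> y * (y - m)^3) 0"
    using o[of 1] assms by (simp add: eval_nat_numeral)
  have "has_bochner_integral lborel (\<lambda>y.
      (a0 + a2*m^2 + a4*m^4) * normal_density m \<sigma> y
      + ((2*a2*m + 4*a4*m^3) * (normal_density m \<sigma> y * (y - m))
      + ((a2 + 6*a4*m^2) * (normal_density m \<sigma> y * (y - m)^2)
      + ((4*a4*m) * (normal_density m \<sigma> y * (y - m)^3)
      + a4 * (normal_density m \<sigma> y * (y - m)^4)))))
      ((a0 + a2*m^2 + a4*m^4) * 1 + ((2*a2*m + 4*a4*m^3) * 0 + ((a2 + 6*a4*m^2) * \<sigma>^2
      + ((4*a4*m) * 0 + a4 * (3*\<sigma>^4)))))"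
    using 0 1 2 3 4
    by (intro has_bochner_integral_add has_bochner_integral_mult_right) auto
  moreover have "(a0 + a2*m^2 + a4*m^4) * normal_density m \<sigma> y
      + ((2*a2*m + 4*a4*m^3) * (normal_density m \<sigma> y * (y - m))
      + ((a2 + 6*a4*m^2) * (normal_density m \<sigma> y * (y - m)^2)
      + ((4*a4*m) * (normal_density m \<sigma> y * (y - m)^3)
      + a4 * (normal_density m \<sigma> y * (y - m)^4)))) = normal_density m \<sigma> y * (a0 + a2 * y^2 + a4 * y^4)" for y
    by algebra
  ultimately show ?thesis
    by (simp add: algebra_simps)
qed

lemma fourth_moment:
  assumes "\<sigma> > 0"
  shows "has_bochner_integral lborel (\<lambda>y. normal_density m \<sigma> y * (y - m)^4) (3 * \<sigma>^4)"
  using normal_moment_even[OF assms, of m 2] assms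
  by (simp add: fact_numeral power2_eq_square power4_eq_xxxx mult.assoc)

lemma kill_upper:
  assumes d: "d > 0" and bm: "bdd_meas {-1<..<1} (U 0)" and e: "\<epsilon> \<ge> 0" and C: "C \<ge> 0"
    and out: "\<And>m y. m < n \<Longrightarrow> \<bar>y\<bar> \<ge> 1 \<Longrightarrow> U m y \<ge> - \<epsilon> - C * (\<bar>y\<bar> - 1)^4"
    and cal: "\<And>m x. m < n \<Longrightarrow> has_bochner_integral lborel
          (\<lambda>y. normal_density (exp (- d / 2) * x) (ou_sd d) y * U m y) (U (Suc m) x)"
    and x: "\<bar>x\<bar> < 1"
  shows "(ouK {-1<..<1} d ^^ n) (U 0) x \<le> U n x + \<epsilon> + n * (3 * C * d^2)"
proof -
  let ?D = "{-1<..<1::real}"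
  have D[measurable]: "?D \<in> sets borel" by simp
  have "k \<le> n \<Longrightarrow> \<bar>x\<bar> < 1 \<Longrightarrow> (ouK ?D d ^^ k) (U 0) x \<le> U k x + \<epsilon> + k * (3 * C * d^2)" for k x
  proof (induction k arbitrary: x)
    case 0 show ?case using e by simp
  next
    case (Suc k)
    let ?V = "(ouK ?D d ^^ k) (U 0)" let ?m = "exp (- d / 2) * x" let ?n = "normal_density ?m (ou_sd d)"
    have kn: "k < n" using Suc.prems by simp
    have V: "bdd_meas ?D ?V" by (rule bdd_meas_ouK_funpow[OF bm D d])
    have i: "integrable lborel ?n" "integrable lborel (\<lambda>y. ?n y * U k y)"
      using d cal[OF kn, of x] by (auto simp: has_bochner_integral_iff integrable_normal_density)
    have i4: "has_bochner_integral lborel (\<lambda>y. ?n y * (y - ?m)^4) (3 * (ou_sd d)^4)"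
      by (rule fourth_moment) (use d in auto)
    \<comment> \<open>The mean of the step stays inside the interval, so an overshoot is at most the
      deviation from the mean, and fourth moments of overshoots become central moments.\<close>
    have m1: "\<bar>?m\<bar> \<le> 1"
    proof -
      have "exp (- d / 2) * \<bar>x\<bar> \<le> 1 * 1" using d Suc.prems by (intro mult_mono) auto
      then show ?thesis by (simp add: abs_mult)
    qed
    \<comment> \<open>The variance is at most \<open>d\<close>, so one step costs at most
      \<open>3 * C * d^2\<close>.\<close>
    have s4: "(ou_sd d)^4 \<le> d^2"
    proof -
      have "(ou_sd d)^4 = (1 - exp (- d))^2" using d by (simp add: power4_eq_xxxx power2_eq_square)
      also have "\<dots> \<le> d^2" using d exp_ge_add_one_self[of "-d"] by (intro power_mono) auto
      finally show ?thesis .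
    qed
    have "ouK ?D d ?V x \<le> (\<integral>y. ?n y * U k y + (\<epsilon> + k * (3 * C * d^2)) * ?n y + C * (?n y * (y - ?m)^4) \<partial>lborel)"
      unfolding ouK_def[of ?D d ?V x]
    proof (rule integral_mono)
      show "integrable lborel (\<lambda>y. ?n y * (indicator ?D y * ?V y))"
        by (rule integrable_nd_bm[OF V D]) (use d in auto)
      show "integrable lborel (\<lambda>y. ?n y * U k y + (\<epsilon> + k * (3 * C * d^2)) * ?n y + C * (?n y * (y - ?m)^4))"
        using i i4 by (auto simp: has_bochner_integral_iff)
    next
      fix y
      have "indicator ?D y * ?V y \<le> U k y + (\<epsilon> + k * (3 * C * d^2)) + C * (y - ?m)^4"
      proof (cases "\<bar>y\<bar> < 1")
        case True
        then show ?thesis using Suc.IH[of y] kn C by (auto simp: indicator_def intro!: order_trans[OF Suc.IH])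
      next
        case False
        have "(\<bar>y\<bar> - 1)^4 \<le> (\<bar>y - ?m\<bar>)^4" using False m1 by (intro power_mono) auto
        then have "C * (\<bar>y\<bar> - 1)^4 \<le> C * (y - ?m)^4" using C
          by (intro mult_left_mono) (auto simp: power_even_abs)
        moreover have "U k y \<ge> - \<epsilon> - C * (\<bar>y\<bar> - 1)^4" using out[OF kn, of y] False by simp
        moreover have "k * (3 * C * d^2) \<ge> 0" using C by simp
        ultimately have "0 \<le> U k y + (\<epsilon> + k * (3 * C * d^2)) + C * (y - ?m)^4" by linarith
        moreover have "indicator ?D y = (0::real)" using False by (auto simp: indicator_def)
        ultimately show ?thesis by simp
      qed
      then have "?n y * (indicator ?D y * ?V y) \<le> ?n y * (U k y + (\<epsilon> + k * (3 * C * d^2)) + C * (y - ?m)^4)"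
        by (intro mult_left_mono) auto
      then show "?n y * (indicator ?D y * ?V y) \<le> ?n y * U k y + (\<epsilon> + k * (3 * C * d^2)) * ?n y + C * (?n y * (y - ?m)^4)"
        by (simp add: algebra_simps)
    qed
    also have "\<dots> = U (Suc k) x + (\<epsilon> + k * (3 * C * d^2)) + C * (3 * (ou_sd d)^4)"
      using i i4 cal[OF kn, of x] d by (simp add: has_bochner_integral_iff integral_normal_density)
    also have "\<dots> \<le> U (Suc k) x + \<epsilon> + Suc k * (3 * C * d^2)"
      using mult_left_mono[OF s4, of "3*C"] C by (simp add: algebra_simps)
    finally show ?case by simp
  qed
  from this[of n x] x show ?thesis by simp
qed

text \<open>A linear overshoot would cost about \<open>sqrt d\<close> per step, which is too much
  over \<open>r / d\<close> steps; the fourth power costs \<open>d^2\<close>. The small constant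
  \<open>\<epsilon>\<close> absorbs the linear behaviour next to the boundary, and farther out every
  power up to the fourth is dominated by the fourth.\<close>

lemma quartic_overshoot:
  assumes "\<epsilon> > (0::real)"
  shows "\<exists>C\<ge>0. \<forall>y::real. \<bar>y\<bar> \<ge> 1 \<longrightarrow> 4 * ((y^2 - 1) + (y^2 - 1)^2) \<le> \<epsilon> + C * (\<bar>y\<bar> - 1)^4"
proof -
  \<comment> \<open>48 is the sum 8 + 20 + 16 + 4 of the coefficients of the overshoot polynomial in
    \<open>z\<close>. Up to \<open>m\<close> each power is at most \<open>z\<close>; beyond
    \<open>m\<close> each is at most \<open>z^4 / m^3\<close>.\<close>
  define m where "m = min 1 (\<epsilon> / 48)"
  have m: "m > 0" "m \<le> 1" "48 * m \<le> \<epsilon>" using assms by (auto simp: m_def min_def)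
  show ?thesis
  proof (intro exI[of _ "48 / m^3"] conjI allI impI)
    fix y :: real assume y: "\<bar>y\<bar> \<ge> 1"
    define z where "z = \<bar>y\<bar> - 1"
    have z: "z \<ge> 0" using y z_def by simp
    have yz: "y^2 = (z+1)^2" by (simp add: z_def)
    have eq: "4 * ((y^2 - 1) + (y^2 - 1)^2) = 8*z + 20*z^2 + 16*z^3 + 4*z^4"
      unfolding yz by algebra
    show "4 * ((y^2 - 1) + (y^2 - 1)^2) \<le> \<epsilon> + 48 / m^3 * (\<bar>y\<bar> - 1)^4"
    proof (cases "z \<le> m")
      case True
      have "z^k \<le> z" if "k \<ge> 1" for k using power_decreasing[OF that, of z] z True m by simp
      then have "z^2 \<le> z" "z^3 \<le> z" "z^4 \<le> z" by auto
      then have "8*z + 20*z^2 + 16*z^3 + 4*z^4 \<le> 48 * z" by linarith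
      also have "\<dots> \<le> \<epsilon>" using True m by simp
      also have "\<dots> \<le> \<epsilon> + 48 / m^3 * (\<bar>y\<bar> - 1)^4" using m by simp
      finally show ?thesis unfolding eq .
    next
      case False
      then have zm: "1 \<le> z / m" using m by (simp add: field_simps)
      have zle: "z \<le> z / m" using m z by (simp add: field_simps mult_left_le_one_le)
      have b1: "z^4 / m^3 = z * (z/m)^3" using m by (simp add: field_simps eval_nat_numeral)
      have "z * (z/m)^0 \<le> z * (z/m)^3" using zm z by (intro mult_left_mono power_increasing) auto
      moreover have "z * (z^k) \<le> z * (z/m)^3" if "k \<le> 3" for k
      proof -
        have "z^k \<le> (z/m)^k" using zle z by (intro power_mono) auto
        also have "\<dots> \<le> (z/m)^3" using zm that by (intro power_increasing) auto
        finally show ?thesis using z by (intro mult_left_mono) auto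
      qed
      note this[of 1] this[of 2] this[of 3]
      ultimately have "8*z + 20*z^2 + 16*z^3 + 4*z^4 \<le> 48 * (z^4/m^3)"
        unfolding b1 by (simp add: eval_nat_numeral)
      also have "\<dots> \<le> \<epsilon> + 48 / m^3 * (\<bar>y\<bar> - 1)^4" using assms by (simp add: z_def)
      finally show ?thesis unfolding eq .
    qed
  qed (use m in auto)
qed

subsection \<open>The ground state, a caloric quartic and reversibility\<close>

text \<open>For Brownian motion B the process \<open>(t + 1) - B_t^2 = (t + 1) * ground X_t\<close>
  is a martingale; this is why \<open>ground\<close> decays at rate exactly 1 in log time.\<close>

definition ground :: "real \<Rightarrow> real" where "ground x = 1 - x\<^sup>2"

lemma ground_measurable[measurable]: "ground \<in> borel_measurable borel"
  unfolding ground_def by measurable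

lemma ground_pos: "\<bar>x\<bar> < 1 \<Longrightarrow> ground x > 0"
  by (simp add: ground_def abs_square_less_1)

lemma ground_le_1: "ground x \<le> 1"
  by (simp add: ground_def)

lemma bdd_meas_ground: "bdd_meas {-1<..<1} ground"
proof (rule bdd_measI)
  fix x :: real assume "x \<in> {-1<..<1}"
  then have "\<bar>x\<bar> < 1" by auto
  then show "\<bar>ground x\<bar> \<le> 1" using ground_pos[of x] ground_le_1[of x] by simp
qed simp

lemma ou_sd_sq: "d > 0 \<Longrightarrow> (ou_sd d)\<^sup>2 = 1 - exp (- d)"
  by simp

lemma ou_sd_4: "d > 0 \<Longrightarrow> (ou_sd d)^4 = (1 - exp (- d))\<^sup>2"
  by (simp add: power4_eq_xxxx power2_eq_square)

lemma exp_half_sq: "(exp (- d / 2) * x)\<^sup>2 = exp (- d) * (x::real)\<^sup>2"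
  by (simp add: power_mult_distrib exp_double[symmetric])

lemma exp_half_4: "(exp (- d / 2) * x)^4 = (exp (- d))\<^sup>2 * (x::real)^4"
proof -
  have "(exp (- d / 2) * x)^4 = ((exp (- d / 2) * x)\<^sup>2)\<^sup>2" by simp
  then show ?thesis unfolding exp_half_sq by (simp add: power_mult_distrib)
qed

lemma ou_moments:
  assumes "d > 0"
  shows "has_bochner_integral lborel
     (\<lambda>y. normal_density (exp (- d / 2) * x) (ou_sd d) y * (a0 + a2 * y^2 + a4 * y^4))
     (a0 + a2 * (exp (- d) * x\<^sup>2 + (1 - exp (- d)))
       + a4 * ((exp (- d))\<^sup>2 * x^4 + 6 * (exp (- d) * x\<^sup>2) * (1 - exp (- d)) + 3 * (1 - exp (- d))\<^sup>2))"
  using has_moments[OF ou_sd_pos[OF assms], of "exp (- d / 2) * x" a0 a2 a4]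
  unfolding exp_half_sq exp_half_4 ou_sd_sq[OF assms] ou_sd_4[OF assms] .

lemma ground_cal:
  assumes "d > 0"
  shows "has_bochner_integral lborel
     (\<lambda>y. normal_density (exp (- d / 2) * x) (ou_sd d) y * (exp (- (real m * d)) * ground y))
     (exp (- (real (Suc m) * d)) * ground x)"
proof -
  let ?E = "exp (- (real m * d))"
  have 1: "?E + (- ?E) * y^2 + 0 * y^4 = ?E * ground y" for y by (simp add: ground_def algebra_simps)
  have 2: "exp (- (real (Suc m) * d)) = ?E * exp (- d)"
    by (simp add: exp_add[symmetric] algebra_simps)
  have 3: "?E + (- ?E) * (exp (- d) * x\<^sup>2 + (1 - exp (- d))) + 0 * z = exp (- (real (Suc m) * d)) * ground x" for z
    unfolding 2 ground_def by algebra
  show ?thesis using ou_moments[OF assms, of x ?E "-?E" 0] unfolding 1 3 .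
qed

text \<open>Off \<open>{-a<..<a}\<close> the barrier is at most \<open>1 - a\<^sup>2\<close>, which
  is the whole loss. The interval is shrunk because dyadic observation in \<open>{-a<..<a}\<close>
  with \<open>a < 1\<close> keeps the entire path away from the endpoints 1 and -1.\<close>

lemma ground_kill_lower:
  assumes "d > 0" "0 < a" "a \<le> 1"
  shows "(ouK {-a<..<a} d ^^ n) ground x \<ge> exp (- (real n * d)) * ground x - (1 - a\<^sup>2)"
proof -
  have a2: "a\<^sup>2 \<le> 1" using assms by (simp add: power_le_one)
  have "(ouK {-a<..<a} d ^^ n) ((\<lambda>m y. exp (- (real m * d)) * ground y) 0) x
     \<ge> (\<lambda>m y. exp (- (real m * d)) * ground y) n x - (1 - a\<^sup>2)"
  proof (rule kill_lower)
    show "bdd_meas {- a<..<a} (\<lambda>y. exp (- (real 0 * d)) * ground y)"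
      using bdd_meas_subset[OF bdd_meas_ground, of "{-a<..<a}"] assms by (simp add: subset_iff)
    fix m y assume "y \<notin> {- a<..<a}"
    then have "\<bar>y\<bar> \<ge> \<bar>a\<bar>" using assms by auto
    then have "ground y \<le> 1 - a\<^sup>2" by (simp add: ground_def abs_le_square_iff)
    then have "exp (- (real m * d)) * ground y \<le> exp (- (real m * d)) * (1 - a\<^sup>2)" by simp
    also have "\<dots> \<le> 1 - a\<^sup>2" using a2 assms by (intro mult_left_le_one_le) auto
    finally show "exp (- (real m * d)) * ground y \<le> 1 - a\<^sup>2" .
  qed (use assms a2 ground_cal in auto)
  then show ?thesis by simp
qed

text \<open>The bound is weakened to the form it shares with \<open>caloric_overshoot\<close>, so
  that \<open>quartic_overshoot\<close> serves both barriers.\<close>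

lemma ground_overshoot:
  fixes y :: real
  assumes "\<bar>y\<bar> \<ge> 1" "0 \<le> c" "c \<le> 1"
  shows "c * ground y \<ge> - (4 * ((y^2 - 1) + (y^2 - 1)^2))"
proof -
  define w where "w = y^2 - 1"
  have w: "w \<ge> 0" unfolding w_def using assms(1) by (simp add: abs_square_less_1 linorder_not_less[symmetric])
  have "c * w \<le> w" using assms w by (intro mult_left_le_one_le) auto
  moreover have "c * ground y = - (c * w)" by (simp add: ground_def w_def algebra_simps)
  ultimately have "c * ground y \<ge> - w" by simp
  moreover have "- (4 * (w + w^2)) \<le> - w" 
  proof -
    have "0 \<le> 3 * w + 4 * w^2" using w by simp
    then show ?thesis by argo
  qed
  ultimately show ?thesis unfolding w_def[symmetric] by (rule order_trans[rotated])
qed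

text \<open>The constant \<open>C\<close> depends on \<open>\<epsilon>\<close> alone. With
  \<open>n * d\<close> fixed the last term is of order \<open>d\<close>, so it disappears under
  refinement before \<open>\<epsilon>\<close> is sent to 0.\<close>

lemma ground_kill_upper:
  assumes "\<epsilon> > 0"
  shows "\<exists>C\<ge>0. \<forall>d n x. d > 0 \<longrightarrow> \<bar>x\<bar> < 1 \<longrightarrow>
     (ouK {-1<..<1} d ^^ n) ground x \<le> exp (- (real n * d)) * ground x + \<epsilon> + n * (3 * C * d^2)"
proof -
  obtain C where C: "C \<ge> 0" "\<And>y::real. \<bar>y\<bar> \<ge> 1 \<Longrightarrow> 4 * ((y^2 - 1) + (y^2 - 1)^2) \<le> \<epsilon> + C * (\<bar>y\<bar> - 1)^4"
    using quartic_overshoot[OF assms] by blast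
  have "(ouK {-1<..<1} d ^^ n) ground x \<le> exp (- (real n * d)) * ground x + \<epsilon> + n * (3 * C * d^2)"
    if d: "d > 0" and x: "\<bar>x\<bar> < 1" for d n x
  proof -
    have "(ouK {-1<..<1} d ^^ n) ((\<lambda>m y. exp (- (real m * d)) * ground y) 0) x
       \<le> (\<lambda>m y. exp (- (real m * d)) * ground y) n x + \<epsilon> + n * (3 * C * d^2)"
    proof (rule kill_upper[OF d])
      show "bdd_meas {-1<..<1} (\<lambda>y. exp (- (real 0 * d)) * ground y)" using bdd_meas_ground by simp
      show "- \<epsilon> - C * (\<bar>y\<bar> - 1)^4 \<le> exp (- (real m * d)) * ground y" if "\<bar>y\<bar> \<ge> 1" for m y
        using ground_overshoot[OF that, of "exp (- (real m * d))"] C(2)[OF that] d by auto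
    qed (use assms C x ground_cal[OF d] in auto)
    then show ?thesis by simp
  qed
  then show ?thesis using C(1) by blast
qed

text \<open>This is the polynomial \<open>- (b\<^sup>4 - 6 v b\<^sup>2 + 3 v\<^sup>2) - 2 + 8 (v - b\<^sup>2)\<close> at \<open>b = sqrt v * y\<close>, where \<open>v = t + 1\<close>: it solves the backward heat equation, is nonnegative on the parabola \<open>b\<^sup>2 = v\<close> for \<open>v \<ge> 1\<close>, and vanishes at \<open>v = 1, \<bar>b\<bar> = 1\<close>.\<close>

definition caloric :: "real \<Rightarrow> real \<Rightarrow> real" where
  "caloric v y = (8* v - 3* v^2 - 2) + (6* v^2 - 8* v) * y^2 + (- (v^2)) * y^4"

lemma caloric_cal:
  assumes "d > 0"
  shows "has_bochner_integral lborel
     (\<lambda>y. normal_density (exp (- d / 2) * x) (ou_sd d) y * caloric (v * exp (- (real m * d))) y)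
     (caloric (v * exp (- (real (Suc m) * d))) x)"
proof -
  define w where "w = v * exp (- (real m * d))"
  have 2: "v * exp (- (real (Suc m) * d)) = w * exp (- d)"
    unfolding w_def by (simp add: exp_add[symmetric] algebra_simps)
  define E where "E = exp (- d)"
  have 3: "(8*w - 3*w^2 - 2) + (6*w^2 - 8*w) * (E * x\<^sup>2 + (1 - E))
       + (- (w^2)) * (E\<^sup>2 * x^4 + 6 * (E * x\<^sup>2) * (1 - E) + 3 * (1 - E)\<^sup>2) = caloric (w * E) x"
    unfolding caloric_def by algebra
  show ?thesis
    unfolding 2 w_def[symmetric] E_def[symmetric] 3[symmetric]
    unfolding E_def caloric_def by (rule ou_moments[OF assms])
qed

lemma caloric_1: "\<bar>x\<bar> \<le> 1 \<Longrightarrow> caloric 1 x \<le> 4 * ground x"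
proof -
  assume "\<bar>x\<bar> \<le> 1"
  then have "0 \<le> (1 - x^2)^2" by simp
  moreover have "4 * ground x - caloric 1 x = (1 - x^2)^2" 
    by (simp add: caloric_def ground_def power2_eq_square power4_eq_xxxx algebra_simps)
  ultimately show ?thesis by linarith
qed

lemma caloric_overshoot:
  fixes y :: real
  assumes "\<bar>y\<bar> \<ge> 1" "1 \<le> v" "v \<le> 2"
  shows "caloric v y \<ge> - (4 * ((y^2 - 1) + (y^2 - 1)^2))"
proof -
  define w where "w = y^2 - 1"
  have w: "w \<ge> 0" unfolding w_def using assms(1) by (simp add: abs_square_less_1 linorder_not_less[symmetric])
  have y: "y^2 = w + 1" "y^4 = (w+1)^2" by (simp_all add: w_def)
  have eq: "caloric v y = 2*(v^2 - 1) - (v^2*w^2) - 4*(v * (2-v))*w" unfolding caloric_def y by algebra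
  have "v^2 \<le> 2^2" using assms by (intro power_mono) auto
  then have "v^2*w^2 \<le> 4*w^2" by (intro mult_right_mono) auto
  moreover have "v * (2-v) \<le> 1" using zero_le_power2[of "v-1"] by (simp add: power2_eq_square algebra_simps)
  then have "v * (2-v)*w \<le> 1*w" using w by (intro mult_right_mono) auto
  moreover have "v^2 \<ge> 1" using assms by simp
  ultimately show ?thesis unfolding eq w_def[symmetric] by (simp add: algebra_simps)
qed

text \<open>At the endpoints the value is \<open>2 * (v^2 - 1)\<close>, hence the condition
  \<open>2 \<le> v^2\<close>, that is \<open>r \<ge> ln 2 / 2\<close> for \<open>v = exp r\<close>.
  In the variable \<open>w\<close> the rest is a sum of terms that are nonnegative for
  \<open>v\<close> between 1 and 2.\<close>

lemma caloric_ge_2: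
  fixes y :: real
  assumes "\<bar>y\<bar> \<le> 1" "2 \<le> v^2" "1 \<le> v" "v \<le> 2"
  shows "caloric v y \<ge> 2"
proof -
  define w where "w = 1 - y^2"
  have w: "0 \<le> w" "w \<le> 1" unfolding w_def using assms(1) by (auto simp: abs_square_le_1)
  have y: "y^2 = 1 - w" "y^4 = (1-w)^2" by (simp_all add: w_def)
  have eq: "caloric v y - 2 = (2*(v^2 - 2))*(1-w) + (8* v - 3* v^2 - 4)*w + v^2*(w*(1-w))" unfolding caloric_def y by algebra
  have "(v - 2) * (3* v - 2) \<le> 0" using assms by (intro mult_nonpos_nonneg) auto
  then have "8* v - 3* v^2 - 4 \<ge> 0" by (simp add: algebra_simps power2_eq_square)
  then have "(2*(v^2 - 2))*(1-w) \<ge> 0" "(8* v - 3* v^2 - 4)*w \<ge> 0" "v^2*(w*(1-w)) \<ge> 0" using w assms by auto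
  then show ?thesis using eq by linarith
qed

text \<open>The barrier runs from \<open>caloric (exp r)\<close>, at least 2 on the interval at the
  terminal time, back to \<open>caloric 1\<close>, at most \<open>4 * ground\<close> at the start.
  Halving gives survival probability at most \<open>2 * ground\<close> up to the error.\<close>

lemma one_kill_upper:
  assumes "\<epsilon> > 0"
  shows "\<exists>C\<ge>0. \<forall>r n x. r \<in> {ln 2 / 2..ln 2} \<longrightarrow> \<bar>x\<bar> < 1 \<longrightarrow> n > 0 \<longrightarrow>
     2 * (ouK {-1<..<1} (r / real n) ^^ n) (\<lambda>_. 1) x \<le> 4 * ground x + \<epsilon> + n * (3 * C * (r / real n)^2)"
proof -
  obtain C where C: "C \<ge> 0" "\<And>y::real. \<bar>y\<bar> \<ge> 1 \<Longrightarrow> 4 * ((y^2 - 1) + (y^2 - 1)^2) \<le> \<epsilon> + C * (\<bar>y\<bar> - 1)^4"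
    using quartic_overshoot[OF assms] by blast
  have "2 * (ouK {-1<..<1} (r / real n) ^^ n) (\<lambda>_. 1) x \<le> 4 * ground x + \<epsilon> + n * (3 * C * (r / real n)^2)"
    if r: "r \<in> {ln 2 / 2..ln 2}" and x: "\<bar>x\<bar> < 1" and n: "n > 0" for r n x
  proof -
    define d where "d = r / real n"
    have "ln 2 > (0::real)" by simp
    with r have r0: "r > 0" unfolding atLeastAtMost_iff by linarith
    have d: "d > 0" using r0 n by (simp add: d_def)
    have nd: "real n * d = r" using n by (simp add: d_def)
    define v where "v = exp r"
    have v: "2 \<le> v^2" "1 \<le> v" "v \<le> 2"
    proof -
      have "exp (ln 2) \<le> exp (2 * r)" using r by (subst exp_le_cancel_iff) auto
      then show "2 \<le> v^2" by (simp add: v_def exp_double)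
      show "1 \<le> v" using r0 by (simp add: v_def)
      have "exp r \<le> exp (ln 2)" using r by (subst exp_le_cancel_iff) auto
      then show "v \<le> 2" by (simp add: v_def)
    qed
    let ?U = "\<lambda>m y. caloric (v * exp (- (real m * d))) y"
    have bmU: "bdd_meas {-1<..<1} (?U 0)"
    proof (rule bdd_measI)
      show "?U 0 \<in> borel_measurable borel" unfolding caloric_def by measurable
      fix y :: real assume "y \<in> {-1<..<1}"
      then have y: "\<bar>y\<bar> \<le> 1" by auto
      then have y2: "y^2 \<le> 1" by (simp add: abs_square_le_1)
      then have y4: "(y^2)^2 \<le> 1" by (rule power_le_one[OF zero_le_power2])
      have "\<bar>a + b * y^2 + c * y^4\<bar> \<le> \<bar>a\<bar> + \<bar>b\<bar> * 1 + \<bar>c\<bar> * 1" for a b c :: real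
      proof -
        have "\<bar>b * y^2\<bar> \<le> \<bar>b\<bar> * 1" using y2 unfolding abs_mult by (intro mult_left_mono) auto
        moreover have "\<bar>c * (y^2)^2\<bar> \<le> \<bar>c\<bar> * 1" using y4 unfolding abs_mult by (intro mult_left_mono) auto
        ultimately show ?thesis by simp
      qed
      then have "\<bar>caloric v y\<bar> \<le> \<bar>8* v - 3* v^2 - 2\<bar> + \<bar>6* v^2 - 8* v\<bar> * 1 + \<bar>- (v^2)\<bar> * 1"
        unfolding caloric_def .
      then show "\<bar>?U 0 y\<bar> \<le> \<bar>8* v - 3* v^2 - 2\<bar> + \<bar>6* v^2 - 8* v\<bar> * 1 + \<bar>- (v^2)\<bar> * 1" by simp
    qed
    have "2 * (ouK {-1<..<1} d ^^ n) (\<lambda>_. 1) x = (ouK {-1<..<1} d ^^ n) (\<lambda>_. 2 * 1) x"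
      unfolding ouK_funpow_scale ..
    also have "\<dots> \<le> (ouK {-1<..<1} d ^^ n) (?U 0) x"
      by (rule ouK_funpow_mono) (use v bmU d x caloric_ge_2 in \<open>auto intro!: bdd_meas_const\<close>)
    also have "\<dots> \<le> ?U n x + \<epsilon> + n * (3 * C * d^2)"
    proof (rule kill_upper[where U = ?U, OF d bmU])
      show "- \<epsilon> - C * (\<bar>y\<bar> - 1)^4 \<le> ?U m y" if m: "m < n" and y: "\<bar>y\<bar> \<ge> 1" for m y
      proof -
        have "real m * d \<le> real n * d" using m d by (intro mult_right_mono) auto
        then have "0 \<le> r - real m * d" unfolding nd by simp
        moreover have eq: "v * exp (- (real m * d)) = exp (r - real m * d)"
          by (simp add: v_def exp_diff exp_minus field_simps)
        moreover have "exp (r - real m * d) \<le> v" using d by (simp add: v_def)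
        ultimately have "1 \<le> v * exp (- (real m * d))" "v * exp (- (real m * d)) \<le> 2"
          using v(3) unfolding eq by auto
        from caloric_overshoot[OF y this] C(2)[OF y] show ?thesis by linarith
      qed
    qed (use assms C x caloric_cal[OF d] in auto)
    also have "?U n x = caloric 1 x" using nd by (simp add: v_def exp_minus)
    also have "caloric 1 x \<le> 4 * ground x" using caloric_1 x by simp
    finally show ?thesis by (simp add: d_def)
  qed
  then show ?thesis using C(1) by blast
qed

section \<open>Reversibility with respect to the Gaussian weight\<close>

definition ou_weight :: "real \<Rightarrow> real" where "ou_weight x = exp (- x\<^sup>2 / 2)"

lemma ou_weight_measurable[measurable]: "ou_weight \<in> borel_measurable borel"
  unfolding ou_weight_def by measurable

lemma ou_weight_pos: "ou_weight x > 0" "ou_weight x \<le> 1"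
  by (auto simp: ou_weight_def)

text \<open>Detailed balance: up to a constant both sides are the Mehler kernel, whose exponent
  contains the symmetric form \<open>x^2 + y^2 - 2*b*x*y\<close>.\<close>

lemma ou_weight_nd_sym:
  assumes "d > 0"
  shows "ou_weight x * normal_density (exp (- d / 2) * x) (ou_sd d) y = ou_weight y * normal_density (exp (- d / 2) * y) (ou_sd d) x"
proof -
  define b where "b = exp (- d / 2)"
  have b2: "b^2 = exp (- d)" by (simp add: b_def exp_double[symmetric])
  have pos: "1 - b^2 > 0" using assms b2 by simp
  have *: "ou_weight x * exp (- (y - b * x)\<^sup>2 / (2 * (1 - b^2))) = exp (- (x^2 + y^2 - 2*b*x*y) / (2 * (1 - b^2)))" for x y
  proof -
    have "- x\<^sup>2 / 2 + - (y - b * x)\<^sup>2 / (2 * (1 - b^2)) = - (x^2 + y^2 - 2*b*x*y) / (2 * (1 - b^2))"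
      using pos by (simp add: field_simps) algebra
    then show ?thesis unfolding ou_weight_def exp_add[symmetric] by simp
  qed
  have **: "(ou_sd d)\<^sup>2 = 1 - b^2" using assms b2 by simp
  have "ou_weight x * normal_density (b * x) (ou_sd d) y
     = 1 / sqrt (2 * pi * (1 - b^2)) * (ou_weight x * exp (- (y - b * x)\<^sup>2 / (2 * (1 - b^2))))" for x y
    unfolding normal_density_def ** by simp
  moreover have "x^2 + y^2 - 2*b*x*y = y^2 + x^2 - 2*b*y*x" by simp
  ultimately show ?thesis unfolding b_def[symmetric] * by simp
qed

lemma ouK_sym:
  fixes D defines "D \<equiv> {-1<..<1::real}"
  assumes d: "d > 0" and f: "bdd_meas D f" and g: "bdd_meas D g"
  shows "(\<integral>x. indicator D x * ou_weight x * (g x * ouK D d f x) \<partial>lborel)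
       = (\<integral>x. indicator D x * ou_weight x * (f x * ouK D d g x) \<partial>lborel)"
proof -
  have D[measurable]: "D \<in> sets borel" by (simp add: D_def)
  note [measurable] = bdd_meas_measurable[OF f] bdd_meas_measurable[OF g]
  obtain Bf where Bf: "Bf \<ge> 0" "\<And>x. x \<in> D \<Longrightarrow> \<bar>f x\<bar> \<le> Bf" using f by (rule bdd_measE) blast
  obtain Bg where Bg: "Bg \<ge> 0" "\<And>x. x \<in> D \<Longrightarrow> \<bar>g x\<bar> \<le> Bg" using g by (rule bdd_measE) blast
  let ?n = "\<lambda>x. normal_density (exp (- d / 2) * x) (ou_sd d)"
  let ?F = "\<lambda>x y. indicator D x * ou_weight x * (g x * (?n x y * (indicator D y * f y)))"
  \<comment> \<open>\<open>N\<close> is the maximum of the transition density. The double integrand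
    is thus bounded and lives on \<open>D \<times> D\<close>, a set of finite area, which licenses
    Fubini.\<close>
  define N where "N = 1 / sqrt (2 * pi * (ou_sd d)\<^sup>2)"
  have nN: "?n x y \<le> N" for x y unfolding normal_density_def N_def
    using d by (auto simp: field_simps intro!: divide_right_mono)
  have N0: "N \<ge> 0" unfolding N_def by simp
  have int: "integrable (lborel \<Otimes>\<^sub>M lborel) (case_prod ?F)"
  proof (rule Bochner_Integration.integrable_bound)
    have "emeasure (lborel \<Otimes>\<^sub>M lborel) (D \<times> D) < \<infinity>"
      by (simp add: lborel.emeasure_pair_measure_Times D_def ennreal_mult_less_top)
    then have "integrable (lborel \<Otimes>\<^sub>M lborel) (indicator (D \<times> D) :: _ \<Rightarrow> real)"
      by (intro integrable_real_indicator) (auto simp: D_def)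
    then show "integrable (lborel \<Otimes>\<^sub>M lborel) (\<lambda>p. (Bg * (N * Bf)) * indicator (D \<times> D) p :: real)"
      by simp
    show "case_prod ?F \<in> borel_measurable (lborel \<Otimes>\<^sub>M lborel)"
      unfolding normal_density_def by measurable
    show "AE p in lborel \<Otimes>\<^sub>M lborel. norm (case_prod ?F p) \<le> norm (Bg * (N * Bf) * indicator (D \<times> D) p :: real)"
    proof (rule AE_I2, clarify)
      fix x y :: real
      show "norm (?F x y) \<le> norm (Bg * (N * Bf) * indicator (D \<times> D) (x, y) :: real)"
      proof (cases "x \<in> D \<and> y \<in> D")
        case True
        have "ou_weight x * (\<bar>g x\<bar> * (?n x y * \<bar>f y\<bar>)) \<le> 1 * (Bg * (N * Bf))"
          using True Bf Bg nN[of x y] N0 ou_weight_pos[of x] by (intro mult_mono) auto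
        then show ?thesis using True ou_weight_pos[of x] Bf Bg N0 by (simp add: abs_mult)
      qed (auto simp: indicator_def)
    qed
  qed
  have "(\<integral>x. indicator D x * ou_weight x * (g x * ouK D d f x) \<partial>lborel) = (\<integral>x. (\<integral>y. ?F x y \<partial>lborel) \<partial>lborel)"
    unfolding ouK_def by simp
  also have "\<dots> = (\<integral>y. (\<integral>x. ?F x y \<partial>lborel) \<partial>lborel)"
    using lborel_pair.Fubini_integral[OF int] by simp
  also have "\<dots> = (\<integral>y. (\<integral>x. indicator D y * ou_weight y * (f y * (?n y x * (indicator D x * g x))) \<partial>lborel) \<partial>lborel)"
  proof -
    have "?F x y = indicator D y * ou_weight y * (f y * (?n y x * (indicator D x * g x)))" for x y
      using ou_weight_nd_sym[OF d, of x y] by (simp add: algebra_simps)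
    then show ?thesis by presburger
  qed
  also have "\<dots> = (\<integral>x. indicator D x * ou_weight x * (f x * ouK D d g x) \<partial>lborel)"
    unfolding ouK_def by simp
  finally show ?thesis .
qed

lemma ouK_funpow_sym:
  fixes D defines "D \<equiv> {-1<..<1::real}"
  assumes d: "d > 0" and f: "bdd_meas D f" and g: "bdd_meas D g"
  shows "(\<integral>x. indicator D x * ou_weight x * (g x * (ouK D d ^^ n) f x) \<partial>lborel)
       = (\<integral>x. indicator D x * ou_weight x * (f x * (ouK D d ^^ n) g x) \<partial>lborel)"
  using g
proof (induction n arbitrary: g)
  case 0 then show ?case by (simp add: mult.commute mult.left_commute)
next
  case (Suc n)
  have D: "D \<in> sets borel" by (simp add: D_def)
  have "(\<integral>x. indicator D x * ou_weight x * (g x * (ouK D d ^^ Suc n) f x) \<partial>lborel)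
     = (\<integral>x. indicator D x * ou_weight x * ((ouK D d ^^ n) f x * ouK D d g x) \<partial>lborel)"
    using ouK_sym[OF d, of "(ouK D d ^^ n) f" g] bdd_meas_ouK_funpow[OF f D d] Suc.prems
    by (simp add: D_def)
  also have "\<dots> = (\<integral>x. indicator D x * ou_weight x * (ouK D d g x * (ouK D d ^^ n) f x) \<partial>lborel)"
    by (simp add: mult.commute)
  also have "\<dots> = (\<integral>x. indicator D x * ou_weight x * (f x * (ouK D d ^^ n) (ouK D d g) x) \<partial>lborel)"
    by (rule Suc.IH) (rule bdd_meas_ouK[OF Suc.prems D d])
  finally show ?case by (simp add: funpow_swap1)
qed

subsection \<open>Discretely observed paths\<close>

text \<open>Independence turns the joint law into a product, and Fubini freezes the first variable.
  \<open>indep_var\<close> wants both variables in one type \<open>'b\<close>.\<close>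

lemma (in prob_space) indep_var_expectation:
  fixes G :: "'b \<times> 'b \<Rightarrow> real"
  assumes ind: "indep_var S X T Z" and G[measurable]: "G \<in> borel_measurable (S \<Otimes>\<^sub>M T)"
    and B: "\<And>p. \<bar>G p\<bar> \<le> B"
  shows "expectation (\<lambda>\<omega>. G (X \<omega>, Z \<omega>)) = expectation (\<lambda>\<omega>. expectation (\<lambda>\<omega>'. G (X \<omega>, Z \<omega>')))"
proof -
  have X[measurable]: "random_variable S X" and Z[measurable]: "random_variable T Z"
    using ind by (auto dest: indep_var_rv1 indep_var_rv2)
  interpret X: prob_space "distr M S X" by (rule prob_space_distr) fact
  interpret Z: prob_space "distr M T Z" by (rule prob_space_distr) fact
  interpret P: pair_prob_space "distr M S X" "distr M T Z" ..
  have G': "G \<in> borel_measurable (distr M S X \<Otimes>\<^sub>M distr M T Z)"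
    by (simp cong: measurable_cong_sets)
  have int: "integrable (distr M S X \<Otimes>\<^sub>M distr M T Z) G"
    by (rule P.P.integrable_const_bound[where B=B]) (use B G' in auto)
  have "expectation (\<lambda>\<omega>. G (X \<omega>, Z \<omega>)) = integral\<^sup>L (distr M (S \<Otimes>\<^sub>M T) (\<lambda>\<omega>. (X \<omega>, Z \<omega>))) G"
    by (subst integral_distr) auto
  also have "\<dots> = integral\<^sup>L (distr M S X \<Otimes>\<^sub>M distr M T Z) G"
    using ind by (simp add: indep_var_distribution_eq)
  also have "\<dots> = (\<integral>x. (\<integral>z. G (x, z) \<partial>distr M T Z) \<partial>distr M S X)"
    using P.integral_fst'[OF int] by simp
  also have "\<dots> = expectation (\<lambda>\<omega>. \<integral>z. G (X \<omega>, z) \<partial>distr M T Z)"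
    by (rule integral_distr) (auto intro!: Z.borel_measurable_lebesgue_integral)
  also have "\<dots> = expectation (\<lambda>\<omega>. expectation (\<lambda>\<omega>'. G (X \<omega>, Z \<omega>')))"
  proof (rule Bochner_Integration.integral_cong[OF refl])
    fix \<omega> assume "\<omega> \<in> space M"
    then have "X \<omega> \<in> space S" using measurable_space[OF X] by blast
    then show "(\<integral>z. G (X \<omega>, z) \<partial>distr M T Z) = expectation (\<lambda>\<omega>'. G (X \<omega>, Z \<omega>'))"
      by (intro integral_distr) measurable
  qed
  finally show ?thesis .
qed

primrec chain :: "real \<Rightarrow> real \<Rightarrow> (nat \<Rightarrow> real) \<Rightarrow> nat \<Rightarrow> real" where
  "chain b x v 0 = x"
| "chain b x v (Suc i) = b * chain b x v i + v i"

lemma chain_measurable: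
  "i \<le> n \<Longrightarrow> (\<lambda>v. chain b x v i) \<in> borel_measurable (PiM {..<n} (\<lambda>_. borel))"
proof (induction i)
  case (Suc i)
  then have "i \<in> {..<n}" by simp
  then have [measurable]: "(\<lambda>v. v i) \<in> borel_measurable (PiM {..<n} (\<lambda>_. borel))"
    by (rule measurable_component_singleton)
  have [measurable]: "(\<lambda>v. chain b x v i) \<in> borel_measurable (PiM {..<n} (\<lambda>_. borel))"
    using Suc by simp
  show ?case by simp
qed simp

lemma chain_restrict: "i \<le> n \<Longrightarrow> chain b x (restrict v {..<n}) i = chain b x v i"
  by (induction i) auto

text \<open>The Markov property in discrete form. Integrating out the last innovation with the past
  frozen replaces \<open>f\<close> by \<open>ouK D d f\<close>, so the induction is over all
  \<open>f\<close>.\<close>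

lemma chain_expectation:
  assumes "prob_space M"
    and ind: "prob_space.indep_vars M (\<lambda>_. borel) \<xi> {..<n}"
    and dist: "\<And>i. i < n \<Longrightarrow> distributed M lborel (\<xi> i) (\<lambda>z. ennreal (normal_density 0 (ou_sd d) z))"
    and d: "d > 0" and D[measurable]: "D \<in> sets borel" and f: "bdd_meas D f"
  shows "(\<integral>\<omega>. (\<Prod>i\<in>{1..n}. indicator D (chain (exp (- d / 2)) x (\<lambda>i. \<xi> i \<omega>) i)) *
             f (chain (exp (- d / 2)) x (\<lambda>i. \<xi> i \<omega>) n) \<partial>M) = (ouK D d ^^ n) f x"
  using ind dist f
proof (induction n arbitrary: f)
  case 0
  interpret prob_space M by fact
  show ?case by (simp add: prob_space)
next
  case (Suc n)
  interpret prob_space M by fact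
  let ?b = "exp (- d / 2)"
  note [measurable] = bdd_meas_measurable[OF \<open>bdd_meas D f\<close>]
  obtain Bf where Bf: "Bf \<ge> 0" "\<And>x. x \<in> D \<Longrightarrow> \<bar>f x\<bar> \<le> Bf" using \<open>bdd_meas D f\<close> by (rule bdd_measE) blast
  have dn: "distributed M lborel (\<xi> n) (\<lambda>z. ennreal (normal_density 0 (ou_sd d) z))" using Suc.prems by simp
  have Zm[measurable]: "random_variable borel (\<xi> n)" using distributed_measurable[OF dn] by simp
  let ?C = "\<lambda>v i. chain ?b x v i"
  let ?Y = "\<lambda>v. ((\<Prod>i\<in>{1..n}. indicator D (?C v i)) :: real, ?C v n)"
  \<comment> \<open>The innovation is padded with a dummy 0 so that it has the same type as the pair
    describing the past. The clipping to the unit interval makes \<open>G\<close> bounded everywhere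
    and leaves the product of indicators unchanged.\<close>
  define G :: "(real \<times> real) \<times> (real \<times> real) \<Rightarrow> real" where
    "G p = min 1 (max 0 (fst (fst p))) * (indicator D (?b * snd (fst p) + fst (snd p)) * f (?b * snd (fst p) + fst (snd p)))" for p
  have G[measurable]: "G \<in> borel_measurable ((borel \<Otimes>\<^sub>M borel) \<Otimes>\<^sub>M (borel \<Otimes>\<^sub>M borel))"
    unfolding G_def by measurable
  have "indep_var (PiM {..<n} (\<lambda>_. borel)) (\<lambda>\<omega>. restrict (\<lambda>i. \<xi> i \<omega>) {..<n})
      (PiM {n} (\<lambda>_. borel)) (\<lambda>\<omega>. restrict (\<lambda>i. \<xi> i \<omega>) {n})"
    by (rule indep_var_restrict[OF Suc.prems(1)]) auto
  then have "indep_var (borel \<Otimes>\<^sub>M borel) (?Y \<circ> (\<lambda>\<omega>. restrict (\<lambda>i. \<xi> i \<omega>) {..<n}))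
      (borel \<Otimes>\<^sub>M borel) ((\<lambda>v. (v n, 0::real)) \<circ> (\<lambda>\<omega>. restrict (\<lambda>i. \<xi> i \<omega>) {n}))"
  proof (rule indep_var_compose)
    have [measurable]: "i \<in> {1..n} \<Longrightarrow> (\<lambda>v. ?C v i) \<in> borel_measurable (PiM {..<n} (\<lambda>_. borel))"
      "(\<lambda>v. ?C v n) \<in> borel_measurable (PiM {..<n} (\<lambda>_. borel))" for i
      by (auto intro: chain_measurable)
    show "?Y \<in> PiM {..<n} (\<lambda>_. borel) \<rightarrow>\<^sub>M borel \<Otimes>\<^sub>M borel" by measurable
  qed measurable
  moreover have "?Y \<circ> (\<lambda>\<omega>. restrict (\<lambda>i. \<xi> i \<omega>) {..<n}) = (\<lambda>\<omega>. ?Y (\<lambda>i. \<xi> i \<omega>))"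
    by (auto simp: fun_eq_iff chain_restrict intro!: prod.cong)
  moreover have "(\<lambda>v. (v n, 0::real)) \<circ> (\<lambda>\<omega>. restrict (\<lambda>i. \<xi> i \<omega>) {n}) = (\<lambda>\<omega>. (\<xi> n \<omega>, 0))" by (auto simp: fun_eq_iff)
  ultimately have ind: "indep_var (borel \<Otimes>\<^sub>M borel) (\<lambda>\<omega>. ?Y (\<lambda>i. \<xi> i \<omega>)) (borel \<Otimes>\<^sub>M borel) (\<lambda>\<omega>. (\<xi> n \<omega>, 0))" by simp
  have pr01: "0 \<le> (\<Prod>i\<in>{1..n}. indicator D (?C v i) :: real)" "(\<Prod>i\<in>{1..n}. indicator D (?C v i) :: real) \<le> 1" for v
    by (auto intro!: prod_nonneg prod_le_1)
  have prm: "min 1 (max 0 (\<Prod>i\<in>{1..n}. indicator D (?C v i) :: real)) = (\<Prod>i\<in>{1..n}. indicator D (?C v i))" for v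
    using pr01[of v] by (simp only: max_absorb2 min_absorb2)
  have GY: "G (?Y v, (z, u)) = (\<Prod>i\<in>{1..n}. indicator D (?C v i)) * (indicator D (?b * ?C v n + z) * f (?b * ?C v n + z))" for v z u
    unfolding G_def fst_conv snd_conv prm ..
  have GB: "\<bar>G p\<bar> \<le> Bf" for p
  proof -
    obtain q y z u where p: "p = ((q, y), (z, u))" by (metis surj_pair)
    have "min 1 (max 0 q) * \<bar>indicator D (?b * y + z) * f (?b * y + z)\<bar> \<le> 1 * Bf"
      using Bf by (intro mult_mono) (auto simp: indicator_def)
    then show ?thesis by (simp add: G_def p abs_mult)
  qed
  have one: "expectation (\<lambda>\<omega>. indicator D (?b * y + \<xi> n \<omega>) * f (?b * y + \<xi> n \<omega>)) = ouK D d f y" for y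
  proof -
    have "expectation (\<lambda>\<omega>. indicator D (?b * y + \<xi> n \<omega>) * f (?b * y + \<xi> n \<omega>))
       = (\<integral>z. normal_density 0 (ou_sd d) z * (indicator D (?b * y + z) * f (?b * y + z)) \<partial>lborel)"
      using distributed_integral[OF dn, of "\<lambda>z. indicator D (?b * y + z) * f (?b * y + z)"]
      by simp
    also have "\<dots> = (\<integral>z. normal_density (?b * y) (ou_sd d) z * (indicator D z * f z) \<partial>lborel)"
      by (subst (2) lborel_integral_real_affine[where c=1 and t="?b * y"]) (auto simp: normal_density_def)
    finally show ?thesis by (simp add: ouK_def)
  qed
  have "(\<integral>\<omega>. (\<Prod>i\<in>{1..Suc n}. indicator D (?C (\<lambda>i. \<xi> i \<omega>) i)) * f (?C (\<lambda>i. \<xi> i \<omega>) (Suc n)) \<partial>M)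
     = expectation (\<lambda>\<omega>. G (?Y (\<lambda>i. \<xi> i \<omega>), (\<xi> n \<omega>, 0)))"
    unfolding GY by (intro Bochner_Integration.integral_cong refl) (simp add: mult.assoc)
  also have "\<dots> = expectation (\<lambda>\<omega>. expectation (\<lambda>\<omega>'. G (?Y (\<lambda>i. \<xi> i \<omega>), (\<xi> n \<omega>', 0))))"
    by (rule indep_var_expectation[OF ind G GB])
  also have "\<dots> = expectation (\<lambda>\<omega>. (\<Prod>i\<in>{1..n}. indicator D (?C (\<lambda>i. \<xi> i \<omega>) i)) * ouK D d f (?C (\<lambda>i. \<xi> i \<omega>) n))"
    unfolding GY one[symmetric] by simp
  also have "\<dots> = (ouK D d ^^ n) (ouK D d f) x"
    by (rule Suc.IH) (use Suc.prems d in \<open>auto intro: indep_vars_subset bdd_meas_ouK\<close>)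
  also have "\<dots> = (ouK D d ^^ Suc n) f x" by (simp add: funpow_swap1)
  finally show ?case .
qed

subsection \<open>Brownian paths and the exit time\<close>

definition log_time :: "real \<Rightarrow> real \<Rightarrow> real" where "log_time s q = (s + 1) * exp q - 1"

lemma log_time_0[simp]: "log_time s 0 = s" by (simp add: log_time_def)

lemma log_time_ge: "s \<ge> 0 \<Longrightarrow> q \<ge> 0 \<Longrightarrow> log_time s q \<ge> s"
proof -
  assume "s \<ge> 0" "q \<ge> 0"
  then have "(s + 1) * 1 \<le> (s + 1) * exp q" by (intro mult_left_mono) auto
  then show ?thesis by (simp add: log_time_def)
qed

lemma log_time_strict: "s \<ge> 0 \<Longrightarrow> q < q' \<Longrightarrow> log_time s q < log_time s q'"
  by (simp add: log_time_def)

lemma log_time_mono: "s \<ge> 0 \<Longrightarrow> q \<le> q' \<Longrightarrow> log_time s q \<le> log_time s q'"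
  by (simp add: log_time_def)

lemma log_time_inverse: "s \<ge> 0 \<Longrightarrow> s \<le> u \<Longrightarrow> log_time s (ln ((u + 1) / (s + 1))) = u"
  by (simp add: log_time_def exp_ln)

text \<open>The dyadic points \<open>k n * (r / 2^n)\<close> approach \<open>q\<close> from the
  left. Closedness is essential: an open condition at dyadic times yields just its closure at the
  others.\<close>

lemma dyadic_dense:
  fixes g :: "real \<Rightarrow> real"
  assumes g: "continuous_on {0..r} g" and C: "closed C" and r: "r \<ge> 0"
    and dy: "\<And>n i. i \<le> 2^n \<Longrightarrow> g (real i * (r / 2^n)) \<in> C" and q: "q \<in> {0..r}"
  shows "g q \<in> C"
proof (cases "r = 0")
  case True then show ?thesis using dy[of 0 0] q by simp
next
  case False
  then have r: "r > 0" using r by simp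
  define k where "k n = nat \<lfloor>q / r * 2^n\<rfloor>" for n
  have qr: "0 \<le> q / r" "q / r \<le> 1" using q r by auto
  have k: "real (k n) \<le> q / r * 2^n" "q / r * 2^n < real (k n) + 1" for n
  proof -
    have "real (k n) = of_int \<lfloor>q / r * 2^n\<rfloor>" unfolding k_def by (intro of_nat_nat) (use mult_nonneg_nonneg[OF qr(1), of "2^n"] in simp)
    then show "real (k n) \<le> q / r * 2^n" "q / r * 2^n < real (k n) + 1"
      by (simp_all only: of_int_floor_le real_of_int_floor_add_one_gt)
  qed
  have kle: "k n \<le> 2^n" for n
  proof -
    have "real (k n) \<le> 1 * 2^n" using k(1)[of n] qr by (intro order_trans[OF k(1)] mult_right_mono) auto
    then show ?thesis by (metis mult_1 of_nat_le_iff of_nat_numeral of_nat_power)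
  qed
  have lim: "(\<lambda>n. real (k n) * (r / 2^n)) \<longlonglongrightarrow> q"
  proof (rule tendsto_sandwich)
    show "\<forall>\<^sub>F n in sequentially. q - r * (1/2)^n \<le> real (k n) * (r / 2^n)"
    proof (rule always_eventually, rule allI)
      fix n
      have "(q / r * 2^n) * (r / 2^n) \<le> (real (k n) + 1) * (r / 2^n)"
        using k(2)[of n] r by (intro mult_right_mono) auto
      also have "(real (k n) + 1) * (r / 2^n) = real (k n) * (r / 2^n) + r * (1/2)^n"
        by (simp only: power_inverse distrib_right divide_inverse mult_1_left)
      finally have "(q / r * 2^n) * (r / 2^n) - r * (1/2)^n \<le> real (k n) * (r / 2^n)"
        by (simp only: diff_le_eq)
      moreover have "(q / r * 2^n) * (r / 2^n) = q" using r by simp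
      ultimately show "q - r * (1/2)^n \<le> real (k n) * (r / 2^n)" by (rule back_subst[of "\<lambda>z. z - r * (1/2)^n \<le> real (k n) * (r / 2^n)"])
    qed
    show "\<forall>\<^sub>F n in sequentially. real (k n) * (r / 2^n) \<le> q"
    proof (rule always_eventually, rule allI)
      fix n
      have "real (k n) * (r / 2^n) \<le> (q / r * 2^n) * (r / 2^n)"
        using k(1)[of n] r by (intro mult_right_mono) auto
      also have "\<dots> = q" using r by simp
      finally show "real (k n) * (r / 2^n) \<le> q" .
    qed
    have "(\<lambda>n. q - r * (1/2)^n) \<longlonglongrightarrow> q - r * 0"
      by (intro tendsto_intros LIMSEQ_power_zero) auto
    then show "(\<lambda>n. q - r * (1/2)^n) \<longlonglongrightarrow> q" by simp
  qed simp
  have in_r: "real (k n) * (r / 2^n) \<in> {0..r}" for n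
  proof -
    have "real (k n) \<le> 2^n" using kle[of n] by (metis of_nat_le_iff of_nat_numeral of_nat_power)
    then have "real (k n) * (r / 2^n) \<le> 2^n * (r / 2^n)" using r by (intro mult_right_mono) auto
    then show ?thesis using r by simp
  qed
  have "(\<lambda>n. g (real (k n) * (r / 2^n))) \<longlonglongrightarrow> g q"
    by (rule continuous_on_tendsto_compose[OF g lim q]) (use in_r in auto)
  then show ?thesis
    by (rule closed_sequentially[OF C dy[OF kle]])
qed

locale brownian =
  fixes M :: "'a measure" and W :: "real \<Rightarrow> 'a \<Rightarrow> real"
  assumes std_BM: "std_BM M W"
begin

sublocale prob_space M using std_BM by (simp add: std_BM_def)

lemma W_measurable[measurable]: "t \<ge> 0 \<Longrightarrow> W t \<in> borel_measurable M"
  using std_BM by (simp add: std_BM_def)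

lemma W_0: "\<omega> \<in> space M \<Longrightarrow> W 0 \<omega> = 0"
  using std_BM by (simp add: std_BM_def)

lemma W_cont: "\<omega> \<in> space M \<Longrightarrow> continuous_on {0..} (\<lambda>t. W t \<omega>)"
  using std_BM by (simp add: std_BM_def)

lemma Xproc_measurable[measurable]: "s \<le> t \<Longrightarrow> Xproc W x s t \<in> borel_measurable M"
  unfolding Xproc_def by measurable

lemma Xproc_pair_measurable[measurable]:
  "s \<le> t \<Longrightarrow> (\<lambda>p. Xproc W (fst p) s t (snd p)) \<in> borel_measurable (borel \<Otimes>\<^sub>M M)"
  unfolding Xproc_def by measurable

lemma Xproc_start: "s \<ge> 0 \<Longrightarrow> \<omega> \<in> space M \<Longrightarrow> Xproc W x s s \<omega> = x"
  by (simp add: Xproc_def W_0)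

lemma Xproc_cont:
  assumes "s \<ge> 0" "\<omega> \<in> space M"
  shows "continuous_on {s..} (\<lambda>t. Xproc W x s t \<omega>)"
proof -
  have "continuous_on {s..} (\<lambda>t. W (t - s) \<omega>)"
    by (rule continuous_on_compose2[OF W_cont[OF assms(2)]]) (auto intro!: continuous_intros)
  then show ?thesis unfolding Xproc_def using assms(1)
    by (intro continuous_intros) auto
qed

lemma Xproc_log_time_cont:
  assumes "s \<ge> 0" "\<omega> \<in> space M"
  shows "continuous_on {0..r} (\<lambda>q. Xproc W x s (log_time s q) \<omega>)"
  by (rule continuous_on_compose2[OF Xproc_cont[OF assms]])
     (auto simp: log_time_def intro!: continuous_intros log_time_ge[unfolded log_time_def] assms)

lemma Xproc_chain:
  assumes s: "s \<ge> 0" and d: "d > 0" and w: "\<omega> \<in> space M"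
  shows "chain (exp (- d / 2)) x
     (\<lambda>i. (W (log_time s (real (Suc i) * d) - s) \<omega> - W (log_time s (real i * d) - s) \<omega>) / sqrt (log_time s (real (Suc i) * d) + 1)) i
     = Xproc W x s (log_time s (real i * d)) \<omega>"
proof (induction i)
  case 0 show ?case using Xproc_start[OF s w] by simp
next
  case (Suc i)
  have pos: "s + 1 > 0" using s by simp
  have e: "sqrt (exp q) = exp (q / 2)" for q
    by (rule real_sqrt_unique) (auto simp: exp_double[symmetric])
  have 1: "sqrt (log_time s q + 1) = sqrt (s + 1) * exp (q / 2)" for q
    by (simp add: log_time_def real_sqrt_mult e)
  have 2: "exp (real (Suc i) * d / 2) = exp (real i * d / 2) * exp (d / 2)"
    by (simp add: exp_add[symmetric] algebra_simps add_divide_distrib)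
  have 3: "exp (- d / 2) = 1 / exp (d / 2)" by (simp add: exp_minus field_simps)
  show ?case
    unfolding chain.simps Suc.IH unfolding Xproc_def 1 2 3 using pos
    by (simp add: field_simps)
qed

text \<open>The right side is free of \<open>s\<close>: a Brownian increment over one log-time step,
  divided by the square root of the new time plus one, has variance \<open>1 - exp (- d)\<close> at
  every stage. This is what the exponent 1/2 in the normalisation achieves.\<close>

lemma grid_expectation:
  assumes s: "s \<ge> 0" and d: "d > 0" and D: "D \<in> sets borel" and f: "bdd_meas D f"
  shows "(\<integral>\<omega>. (\<Prod>i\<in>{1..n}. indicator D (Xproc W x s (log_time s (real i * d)) \<omega>)) *
     f (Xproc W x s (log_time s (real n * d)) \<omega>) \<partial>M) = (ouK D d ^^ n) f x"
proof -
  let ?t = "\<lambda>i. log_time s (real i * d) - s"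
  let ?X = "\<lambda>i \<omega>. (W (?t (Suc i)) \<omega> - W (?t i) \<omega>) / sqrt (log_time s (real (Suc i) * d) + 1)"
  have t: "0 \<le> ?t i" "?t i < ?t (Suc i)" for i
    using s d by (auto intro: log_time_ge log_time_strict)
  have "indep_vars (\<lambda>_. borel) (\<lambda>i \<omega>. W (?t (Suc i)) \<omega> - W (?t i) \<omega>) {..<n}"
    using std_BM t unfolding std_BM_def by (elim conjE allE[of _ n] allE[of _ ?t]) blast
  then have ind: "indep_vars (\<lambda>_. borel) ?X {..<n}"
    by (rule indep_vars_compose2) simp
  have dist: "distributed M lborel (?X i) (\<lambda>z. ennreal (normal_density 0 (ou_sd d) z))" for i
  proof -
    let ?c = "1 / sqrt (log_time s (real (Suc i) * d) + 1)"
    have p: "log_time s (real (Suc i) * d) + 1 > 0" using s by (simp add: log_time_def)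
    have c0: "?c > 0" using p by simp
    have "distributed M lborel (\<lambda>\<omega>. W (?t (Suc i)) \<omega> - W (?t i) \<omega>)
         (\<lambda>x. ennreal (normal_density 0 (sqrt (?t (Suc i) - ?t i)) x))"
      using std_BM t[of i] unfolding std_BM_def by blast
    from normal_density_affine[OF this, of ?c 0] have
      *: "distributed M lborel (\<lambda>\<omega>. 0 + ?c * (W (?t (Suc i)) \<omega> - W (?t i) \<omega>))
         (\<lambda>x. ennreal (normal_density (0 + ?c * 0) (\<bar>?c\<bar> * sqrt (?t (Suc i) - ?t i)) x))"
      using t[of i] c0 by simp
    have "\<bar>?c\<bar> * sqrt (?t (Suc i) - ?t i) = sqrt ((?t (Suc i) - ?t i) / (log_time s (real (Suc i) * d) + 1))"
      using c0 by (simp add: real_sqrt_divide)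
    also have "(?t (Suc i) - ?t i) / (log_time s (real (Suc i) * d) + 1) = 1 - exp (- d)"
    proof -
      have "exp (real (Suc i) * d) = exp (real i * d) * exp d" by (simp add: exp_add[symmetric] algebra_simps)
      moreover have "(A * (E * e) - 1 - s - (A * E - 1 - s)) / (A * (E * e) - 1 + 1) = 1 - 1 / e"
        if "A > 0" "E > 0" "e > 0" for A E e :: real using that by (simp add: field_simps)
      ultimately show ?thesis using s by (simp add: log_time_def exp_minus inverse_eq_divide)
    qed
    finally show ?thesis using * by simp
  qed
  have "(\<integral>\<omega>. (\<Prod>i\<in>{1..n}. indicator D (Xproc W x s (log_time s (real i * d)) \<omega>)) *
     f (Xproc W x s (log_time s (real n * d)) \<omega>) \<partial>M)
    = (\<integral>\<omega>. (\<Prod>i\<in>{1..n}. indicator D (chain (exp (- d / 2)) x (\<lambda>i. ?X i \<omega>) i)) *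
             f (chain (exp (- d / 2)) x (\<lambda>i. ?X i \<omega>) n) \<partial>M)"
    by (intro Bochner_Integration.integral_cong refl) (simp only: Xproc_chain[OF s d])
  also have "\<dots> = (ouK D d ^^ n) f x"
    by (rule chain_expectation[OF prob_space_axioms ind dist d D f])
  finally show ?thesis .
qed

text \<open>Observation starts at index 1, not 0, to match \<open>ouK\<close>, which tests arrival
  points and never the start.\<close>

definition grid :: "real set \<Rightarrow> real \<Rightarrow> real \<Rightarrow> real \<Rightarrow> nat \<Rightarrow> 'a set" where
  "grid D x s r n = {\<omega> \<in> space M. \<forall>i\<in>{1..2^n}. Xproc W x s (log_time s (real i * (r / 2^n))) \<omega> \<in> D}"

lemma grid_measurable[measurable]:
  assumes "s \<ge> 0" "r \<ge> 0" and [measurable]: "D \<in> sets borel"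
  shows "grid D x s r n \<in> sets M"
proof -
  have [measurable]: "Xproc W x s (log_time s (real i * (r / 2^n))) \<in> borel_measurable M" for i
    using assms by (intro Xproc_measurable log_time_ge) auto
  show ?thesis unfolding grid_def by measurable
qed

lemma decseq_grid: "decseq (grid D x s r)"
proof (rule decseq_SucI, rule subsetI)
  fix n \<omega> assume w: "\<omega> \<in> grid D x s r (Suc n)"
  show "\<omega> \<in> grid D x s r n" unfolding grid_def
  proof (intro CollectI conjI ballI)
    fix i :: nat assume "i \<in> {1..2^n}"
    then have "2 * i \<in> {1..2^Suc n}" by auto
    then have "Xproc W x s (log_time s (real (2 * i) * (r / 2^Suc n))) \<omega> \<in> D" using w unfolding grid_def by blast
    moreover have "real (2 * i) * (r / 2^Suc n) = real i * (r / 2^n)" by simp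
    ultimately show "Xproc W x s (log_time s (real i * (r / 2^n))) \<omega> \<in> D" by metis
  qed (use w in \<open>simp add: grid_def\<close>)
qed

lemma grid_end: "\<omega> \<in> grid D x s r n \<Longrightarrow> Xproc W x s (log_time s r) \<omega> \<in> D"
proof -
  assume "\<omega> \<in> grid D x s r n"
  moreover have "(2::nat)^n \<in> {1..2^n}" by simp
  ultimately have "Xproc W x s (log_time s (real (2^n) * (r / 2^n))) \<omega> \<in> D" unfolding grid_def by blast
  then show ?thesis by simp
qed

lemma grid_funpow:
  assumes s: "s \<ge> 0" and r: "r > 0" and D: "D \<in> sets borel" and f: "bdd_meas D f"
  shows "(ouK D (r / 2^n) ^^ (2^n)) f x = (\<integral>\<omega>. indicator (grid D x s r n) \<omega> * f (Xproc W x s (log_time s r) \<omega>) \<partial>M)"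
proof -
  have "(ouK D (r / 2^n) ^^ (2^n)) f x
    = (\<integral>\<omega>. (\<Prod>i\<in>{1..2^n}. indicator D (Xproc W x s (log_time s (real i * (r / 2^n))) \<omega>)) *
     f (Xproc W x s (log_time s (real (2^n) * (r / 2^n))) \<omega>) \<partial>M)"
    by (rule grid_expectation[symmetric]) (use s r D f in auto)
  also have "\<dots> = (\<integral>\<omega>. indicator (grid D x s r n) \<omega> * f (Xproc W x s (log_time s r) \<omega>) \<partial>M)"
  proof (rule Bochner_Integration.integral_cong[OF refl])
    fix \<omega> assume w: "\<omega> \<in> space M"
    have "(\<Prod>i\<in>{1..2^n}. indicator D (Xproc W x s (log_time s (real i * (r / 2^n))) \<omega>)) = (indicator (grid D x s r n) \<omega> :: real)"
      using w by (auto simp: grid_def indicator_def prod_zero_iff)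
    then show "(\<Prod>i\<in>{1..2^n}. indicator D (Xproc W x s (log_time s (real i * (r / 2^n))) \<omega>)) *
       f (Xproc W x s (log_time s (real (2^n) * (r / 2^n))) \<omega>)
      = indicator (grid D x s r n) \<omega> * f (Xproc W x s (log_time s r) \<omega>)" by simp
  qed
  finally show ?thesis .
qed

text \<open>Dyadic refinement makes the events decreasing, so their indicators converge pointwise
  and dominated convergence applies. This is the reason for halving the mesh instead of using all
  grids.\<close>

lemma grid_limit:
  assumes s: "s \<ge> 0" and r: "r > 0" and D[measurable]: "D \<in> sets borel" and f: "bdd_meas D f"
  shows "(\<lambda>n. (ouK D (r / 2^n) ^^ (2^n)) f x) \<longlonglongrightarrow>
     (\<integral>\<omega>. indicator (\<Inter>n. grid D x s r n) \<omega> * f (Xproc W x s (log_time s r) \<omega>) \<partial>M)"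
proof -
  note [measurable] = bdd_meas_measurable[OF f]
  obtain B where B: "B \<ge> 0" "\<And>x. x \<in> D \<Longrightarrow> \<bar>f x\<bar> \<le> B" using f by (rule bdd_measE) blast
  have [measurable]: "Xproc W x s (log_time s r) \<in> borel_measurable M" using s r by (auto intro!: Xproc_measurable log_time_ge)
  have [measurable]: "grid D x s r n \<in> sets M" for n using s r D by (auto intro!: grid_measurable)
  show ?thesis
    unfolding grid_funpow[OF s r D f]
  proof (rule integral_dominated_convergence[where w="\<lambda>_. B"])
    show "AE \<omega> in M. (\<lambda>n. indicator (grid D x s r n) \<omega> * f (Xproc W x s (log_time s r) \<omega>)) \<longlonglongrightarrow>
       indicator (\<Inter>n. grid D x s r n) \<omega> * f (Xproc W x s (log_time s r) \<omega>)"
      by (intro AE_I2 tendsto_mult tendsto_const LIMSEQ_indicator_decseq decseq_grid)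
    show "AE \<omega> in M. norm (indicator (grid D x s r n) \<omega> * f (Xproc W x s (log_time s r) \<omega>)) \<le> B" for n
      using B grid_end by (auto simp: indicator_def)
  qed auto
qed

section \<open>The exit time, its measurability and the survival event\<close>

lemma tauX_gt_iff:
  assumes s: "s \<ge> 0" "s \<le> t" and w: "\<omega> \<in> space M"
  shows "tauX W x s \<omega> > ereal t \<longleftrightarrow> (\<forall>u\<in>{s..t}. \<bar>Xproc W x s u \<omega>\<bar> \<noteq> 1)"
proof
  assume gt: "tauX W x s \<omega> > ereal t"
  show "\<forall>u\<in>{s..t}. \<bar>Xproc W x s u \<omega>\<bar> \<noteq> 1"
  proof (rule ballI, rule notI)
    fix u assume u: "u \<in> {s..t}" "\<bar>Xproc W x s u \<omega>\<bar> = 1"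
    then have "tauX W x s \<omega> \<le> ereal u" unfolding tauX_def by (intro Inf_lower) auto
    also have "\<dots> \<le> ereal t" using u by simp
    finally show False using gt by simp
  qed
next
  assume no: "\<forall>u\<in>{s..t}. \<bar>Xproc W x s u \<omega>\<bar> \<noteq> 1"
  \<comment> \<open>The strict inequality could fail if hitting times accumulated at
    \<open>t\<close> from the right; continuity at \<open>t\<close> leaves a gap of length
    \<open>e\<close> free of them.\<close>
  have "continuous_on {s..} (\<lambda>u. \<bar>Xproc W x s u \<omega>\<bar>)"
    by (intro continuous_intros Xproc_cont s w)
  moreover have "\<bar>Xproc W x s t \<omega>\<bar> \<noteq> 1" "t \<in> {s..}" using no s by auto
  ultimately have "\<forall>\<^sub>F u in at t within {s..}. \<bar>Xproc W x s u \<omega>\<bar> \<noteq> 1"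
    by (auto simp: continuous_on_def intro: tendsto_imp_eventually_ne)
  then obtain e where e: "e > 0" "\<And>u. u \<ge> s \<Longrightarrow> u \<noteq> t \<Longrightarrow> dist u t < e \<Longrightarrow> \<bar>Xproc W x s u \<omega>\<bar> \<noteq> 1"
    unfolding eventually_at by auto
  have "ereal (t + e) \<le> tauX W x s \<omega>"
    unfolding tauX_def
  proof (rule Inf_greatest, clarsimp)
    fix u assume u: "s \<le> u" "\<bar>Xproc W x s u \<omega>\<bar> = 1"
    show "t + e \<le> u"
    proof (rule ccontr)
      assume "\<not> t + e \<le> u"
      moreover have "u > t" using no u by (meson atLeastAtMost_iff not_le)
      ultimately show False using e(2)[of u] u by (auto simp: dist_real_def)
    qed
  qed
  moreover have "ereal t < ereal (t + e)" using e by simp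
  ultimately show "ereal t < tauX W x s \<omega>" by (rule less_le_trans[rotated])
qed

lemma tauX_gt_iff_log_time:
  assumes s: "s \<ge> 0" "r \<ge> 0" and w: "\<omega> \<in> space M"
  shows "tauX W x s \<omega> > ereal (log_time s r) \<longleftrightarrow> (\<forall>q\<in>{0..r}. \<bar>Xproc W x s (log_time s q) \<omega>\<bar> \<noteq> 1)"
proof -
  have "{s..log_time s r} = log_time s ` {0..r}"
  proof (intro equalityI subsetI)
    fix u assume u: "u \<in> {s..log_time s r}"
    let ?q = "ln ((u + 1) / (s + 1))"
    have uq: "log_time s ?q = u" using u s by (intro log_time_inverse) auto
    have "?q \<ge> 0" using u s by simp
    moreover have "?q \<le> r"
    proof (rule ccontr)
      assume "\<not> ?q \<le> r"
      then have "log_time s r < log_time s ?q" using s by (intro log_time_strict) auto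
      then show False using uq u by simp
    qed
    ultimately show "u \<in> log_time s ` {0..r}" using uq by (intro image_eqI[of _ _ ?q]) auto
  next
    fix u assume "u \<in> log_time s ` {0..r}"
    then show "u \<in> {s..log_time s r}" using s by (auto intro: log_time_ge log_time_mono)
  qed
  then show ?thesis using tauX_gt_iff[OF s(1) log_time_ge[OF s] w] by simp
qed

text \<open>On a compact time interval, avoiding 1 means keeping a positive distance from it, and
  that can be tested at dyadic times. The countable form gives joint measurability in the starting
  point and the path, as the product space of \<open>cond_law\<close> requires.\<close>

lemma tauX_gt_iff_dyadic:
  assumes s: "s \<ge> 0" "r \<ge> 0" and w: "\<omega> \<in> space M"
  shows "tauX W x s \<omega> > ereal (log_time s r) \<longleftrightarrow>
     (\<exists>k::nat. \<forall>n. \<forall>i\<in>{..2^n}. 1 / real (Suc k) \<le> \<bar>\<bar>Xproc W x s (log_time s (real i * (r / 2^n))) \<omega>\<bar> - 1\<bar>)"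
    (is "_ \<longleftrightarrow> ?R")
proof -
  let ?g = "\<lambda>q. \<bar>\<bar>Xproc W x s (log_time s q) \<omega>\<bar> - 1\<bar>"
  have cont: "continuous_on {0..r} ?g"
    by (intro continuous_intros Xproc_log_time_cont s w)
  show ?thesis unfolding tauX_gt_iff_log_time[OF s w]
  proof
    assume no: "\<forall>q\<in>{0..r}. \<bar>Xproc W x s (log_time s q) \<omega>\<bar> \<noteq> 1"
    obtain q0 where q0: "q0 \<in> {0..r}" "\<And>q. q \<in> {0..r} \<Longrightarrow> ?g q0 \<le> ?g q"
      using continuous_attains_inf[OF _ _ cont] s by auto
    have "?g q0 > 0" using no q0 by auto
    then obtain k where k: "inverse (real (Suc k)) < ?g q0" using reals_Archimedean by blast
    show ?R
    proof (intro exI[of _ k] allI ballI)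
      fix n i assume i: "i \<in> {..(2::nat)^n}"
      then have "real i \<le> 2^n" by (metis atMost_iff of_nat_le_iff of_nat_numeral of_nat_power)
      then have "real i * (r / 2^n) \<le> 2^n * (r / 2^n)" using s by (intro mult_right_mono) auto
      then have "real i * (r / 2^n) \<in> {0..r}" using s by simp
      from q0(2)[OF this] k show "1 / real (Suc k) \<le> ?g (real i * (r / 2^n))" by (simp add: inverse_eq_divide)
    qed
  next
    assume ?R
    then obtain k where k: "\<And>n i. i \<le> 2^n \<Longrightarrow> ?g (real i * (r / 2^n)) \<in> {1 / real (Suc k)..}" by auto
    show "\<forall>q\<in>{0..r}. \<bar>Xproc W x s (log_time s q) \<omega>\<bar> \<noteq> 1"
    proof
      fix q assume "q \<in> {0..r}"
      from dyadic_dense[OF cont _ s(2) k this] have "1 / real (Suc k) \<le> ?g q" by simp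
      moreover have "0 < 1 / real (Suc k)" by simp
      ultimately show "\<bar>Xproc W x s (log_time s q) \<omega>\<bar> \<noteq> 1" by auto
    qed
  qed
qed

definition surv :: "real \<Rightarrow> real \<Rightarrow> real \<Rightarrow> 'a set" where
  "surv x s r = {\<omega> \<in> space M. tauX W x s \<omega> > ereal (log_time s r)}"

lemma surv_pair_measurable:
  assumes s: "s \<ge> 0" "r \<ge> 0"
  shows "{p \<in> space (borel \<Otimes>\<^sub>M M). tauX W (fst p) s (snd p) > ereal (log_time s r)} \<in> sets (borel \<Otimes>\<^sub>M M)"
proof -
  have [measurable]: "(\<lambda>p. Xproc W (fst p) s (log_time s (real i * (r / 2^n))) (snd p)) \<in> borel_measurable (borel \<Otimes>\<^sub>M M)" for i n
    using s by (intro Xproc_pair_measurable log_time_ge) auto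
  have "{p \<in> space (borel \<Otimes>\<^sub>M M). tauX W (fst p) s (snd p) > ereal (log_time s r)} =
    {p \<in> space (borel \<Otimes>\<^sub>M M). \<exists>k::nat. \<forall>n. \<forall>i\<in>{..2^n}.
       1 / real (Suc k) \<le> \<bar>\<bar>Xproc W (fst p) s (log_time s (real i * (r / 2^n))) (snd p)\<bar> - 1\<bar>}"
  proof (intro Collect_cong conj_cong refl)
    fix p :: "real \<times> 'a" assume "p \<in> space (borel \<Otimes>\<^sub>M M)"
    then have "snd p \<in> space M" by (auto simp: space_pair_measure)
    from tauX_gt_iff_dyadic[OF s this]
    show "tauX W (fst p) s (snd p) > ereal (log_time s r) \<longleftrightarrow> (\<exists>k::nat. \<forall>n. \<forall>i\<in>{..2^n}.
       1 / real (Suc k) \<le> \<bar>\<bar>Xproc W (fst p) s (log_time s (real i * (r / 2^n))) (snd p)\<bar> - 1\<bar>)" .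
  qed
  also have "\<dots> \<in> sets (borel \<Otimes>\<^sub>M M)" by measurable
  finally show ?thesis .
qed

lemma surv_measurable[measurable]:
  assumes s: "s \<ge> 0" "r \<ge> 0"
  shows "surv x s r \<in> sets M"
proof -
  have "surv x s r = {\<omega> \<in> space M. (x, \<omega>) \<in> {p \<in> space (borel \<Otimes>\<^sub>M M). tauX W (fst p) s (snd p) > ereal (log_time s r)}}"
    by (auto simp: surv_def space_pair_measure)
  also have "\<dots> \<in> sets M" using surv_pair_measurable[OF s] by measurable
  finally show ?thesis .
qed

text \<open>By the intermediate value theorem a path that starts inside and avoids absolute value 1
  never gets out, so it passes every grid test.\<close>

lemma surv_subset_grid:
  assumes s: "s \<ge> 0" "r \<ge> 0" and x: "\<bar>x\<bar> < 1"
  shows "surv x s r \<subseteq> (\<Inter>n. grid {-1<..<1} x s r n)"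
proof
  fix \<omega> assume "\<omega> \<in> surv x s r"
  then have w: "\<omega> \<in> space M" and no: "\<forall>q\<in>{0..r}. \<bar>Xproc W x s (log_time s q) \<omega>\<bar> \<noteq> 1"
    using tauX_gt_iff_log_time[OF s] by (auto simp: surv_def)
  have in1: "\<bar>Xproc W x s (log_time s q) \<omega>\<bar> < 1" if q: "q \<in> {0..r}" for q
  proof (rule ccontr)
    assume "\<not> ?thesis"
    moreover have "continuous_on {0..q} (\<lambda>q. \<bar>Xproc W x s (log_time s q) \<omega>\<bar>)"
      by (intro continuous_intros Xproc_log_time_cont s w)
    ultimately have "\<exists>p\<ge>0. p \<le> q \<and> \<bar>Xproc W x s (log_time s p) \<omega>\<bar> = 1"
      using q x Xproc_start[OF s(1) w] by (intro IVT') auto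
    then show False using no q by auto
  qed
  have "Xproc W x s (log_time s (real i * (r / 2^n))) \<omega> \<in> {-1<..<1}" if i: "i \<in> {1..2^n}" for i n
  proof -
    have "real i \<le> 2^n" using i by (metis atLeastAtMost_iff of_nat_le_iff of_nat_numeral of_nat_power)
    then have "real i * (r / 2^n) \<le> 2^n * (r / 2^n)" using s by (intro mult_right_mono) auto
    then have "\<bar>Xproc W x s (log_time s (real i * (r / 2^n))) \<omega>\<bar> < 1" using s by (intro in1) simp
    then show ?thesis by auto
  qed
  then show "\<omega> \<in> (\<Inter>n. grid {-1<..<1} x s r n)" using w by (auto simp: grid_def)
qed

text \<open>Dyadic tests give the closed interval \<open>{-a..a}\<close> at all times, and
  \<open>a < 1\<close> keeps that away from the endpoints. With \<open>surv_subset_grid\<close> this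
  encloses survival between two limits of grid events.\<close>

lemma grid_subset_surv:
  assumes s: "s \<ge> 0" "r \<ge> 0" and x: "\<bar>x\<bar> < a" and a: "a < 1"
  shows "(\<Inter>n. grid {-a<..<a} x s r n) \<subseteq> surv x s r"
proof
  fix \<omega> assume g: "\<omega> \<in> (\<Inter>n. grid {-a<..<a} x s r n)"
  then have w: "\<omega> \<in> space M" by (auto simp: grid_def)
  have "Xproc W x s (log_time s q) \<omega> \<in> {-a..a}" if q: "q \<in> {0..r}" for q
  proof (rule dyadic_dense[OF Xproc_log_time_cont[OF s(1) w, of r x] _ s(2) _ q])
    fix n i assume i: "i \<le> (2::nat)^n"
    show "Xproc W x s (log_time s (real i * (r / 2^n))) \<omega> \<in> {-a..a}"
    proof (cases "i = 0")
      case True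
      then show ?thesis using x Xproc_start[OF s(1) w] by auto
    next
      case False
      have "\<omega> \<in> grid {-a<..<a} x s r n" using g by blast
      then have "\<forall>i\<in>{1..2^n}. Xproc W x s (log_time s (real i * (r / 2^n))) \<omega> \<in> {-a<..<a}"
        unfolding grid_def by blast
      moreover have "i \<in> {1..2^n}" using i False by simp
      ultimately have "Xproc W x s (log_time s (real i * (r / 2^n))) \<omega> \<in> {-a<..<a}" by (rule bspec)
      then show ?thesis unfolding greaterThanLessThan_iff atLeastAtMost_iff by linarith
    qed
  qed simp
  then have "\<forall>q\<in>{0..r}. \<bar>Xproc W x s (log_time s q) \<omega>\<bar> \<noteq> 1" using a by fastforce
  then show "\<omega> \<in> surv x s r" using w tauX_gt_iff_log_time[OF s w] by (simp add: surv_def)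
qed

end

subsection \<open>The killed semigroup\<close>

abbreviation unit_ball :: "real set" where "unit_ball \<equiv> {-1<..<1}"

abbreviation dyadic_ou :: "nat \<Rightarrow> real \<Rightarrow> (real \<Rightarrow> real) \<Rightarrow> real \<Rightarrow> real" where
  "dyadic_ou n r f \<equiv> (ouK unit_ball (r / 2^n) ^^ (2^n)) f"

lemma mesh_error_limit: "(\<lambda>n. real (2^n) * (c * (r / real (2^n))^2)) \<longlonglongrightarrow> 0"
proof -
  have "(\<lambda>n. (c * r^2) * (1/2)^n) \<longlonglongrightarrow> (c * r^2) * 0"
    by (intro tendsto_intros LIMSEQ_power_zero) auto
  moreover have "real (2^n) * (c * (r / real (2^n))^2) = (c * r^2) * (1/2)^n" for n
    by (simp add: power_one_over power2_eq_square)
  ultimately show ?thesis by (simp only: mult_zero_right)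
qed

context brownian begin

lemma Xtm_measurable: "s \<ge> 0 \<Longrightarrow> r \<ge> 0 \<Longrightarrow> Xproc W x s (log_time s r) \<in> borel_measurable M"
  by (intro Xproc_measurable log_time_ge)

lemma integrable_grid:
  assumes "s \<ge> 0" "r > 0" "D \<in> sets borel" "bdd_meas D f" "A \<in> sets M" "\<And>\<omega>. \<omega> \<in> A \<Longrightarrow> Xproc W x s (log_time s r) \<omega> \<in> D"
  shows "integrable M (\<lambda>\<omega>. indicator A \<omega> * f (Xproc W x s (log_time s r) \<omega>))"
proof -
  note [measurable] = bdd_meas_measurable[OF assms(4)] assms(5)
  have [measurable]: "Xproc W x s (log_time s r) \<in> borel_measurable M" using assms by (auto intro: Xtm_measurable)
  obtain B where "B \<ge> 0" "\<And>x. x \<in> D \<Longrightarrow> \<bar>f x\<bar> \<le> B" using assms(4) by (rule bdd_measE) blast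
  then show ?thesis using assms(6)
    by (intro integrable_const_bound[where B=B]) (auto simp: indicator_def)
qed

lemma gridI_measurable:
  "s \<ge> 0 \<Longrightarrow> r > 0 \<Longrightarrow> D \<in> sets borel \<Longrightarrow> (\<Inter>n. grid D x s r n) \<in> sets M"
  by (intro sets.countable_INT) (auto intro!: grid_measurable)

lemma gridI_end: "\<omega> \<in> (\<Inter>n. grid D x s r n) \<Longrightarrow> Xproc W x s (log_time s r) \<omega> \<in> D"
  using grid_end[of \<omega> D x s r 0] by blast

lemma surv_end: "s \<ge> 0 \<Longrightarrow> r \<ge> 0 \<Longrightarrow> \<bar>x\<bar> < 1 \<Longrightarrow> \<omega> \<in> surv x s r \<Longrightarrow> Xproc W x s (log_time s r) \<omega> \<in> unit_ball"
  by (rule gridI_end[OF subsetD[OF surv_subset_grid]])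

lemma grid_ground_le:
  assumes s: "s \<ge> 0" and r: "r > 0" and x: "\<bar>x\<bar> < 1"
  shows "(\<integral>\<omega>. indicator (\<Inter>n. grid unit_ball x s r n) \<omega> * ground (Xproc W x s (log_time s r) \<omega>) \<partial>M) \<le> exp (- r) * ground x"
proof (rule field_le_epsilon)
  fix e :: real assume "e > 0"
  from ground_kill_upper[OF this] obtain C where C: "\<And>d n x. d > 0 \<Longrightarrow> \<bar>x\<bar> < 1 \<Longrightarrow>
     (ouK unit_ball d ^^ n) ground x \<le> exp (- (real n * d)) * ground x + e + n * (3 * C * d^2)" by blast
  have l: "(\<lambda>n. dyadic_ou n r ground x) \<longlonglongrightarrow> (\<integral>\<omega>. indicator (\<Inter>n. grid unit_ball x s r n) \<omega> * ground (Xproc W x s (log_time s r) \<omega>) \<partial>M)"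
    by (rule grid_limit[OF s r _ bdd_meas_ground]) simp
  have u: "(\<lambda>n. (exp (- r) * ground x + e) + real (2^n) * (3 * C * (r / real (2^n))^2)) \<longlonglongrightarrow> (exp (- r) * ground x + e) + 0"
    by (intro tendsto_add tendsto_const mesh_error_limit)
  show "(\<integral>\<omega>. indicator (\<Inter>n. grid unit_ball x s r n) \<omega> * ground (Xproc W x s (log_time s r) \<omega>) \<partial>M) \<le> exp (- r) * ground x + e"
  proof (rule LIMSEQ_le[OF l u[unfolded add_0_right]], intro exI[of _ 0] allI impI)
    fix n
    have "real (2^n) * (r / real (2^n)) = r" "r / real (2^n) > 0" using r by simp_all
    then show "dyadic_ou n r ground x \<le> (exp (- r) * ground x + e) + real (2^n) * (3 * C * (r / real (2^n))^2)"
      using C[of "r / real (2^n)" x "2^n"] x by (simp only: of_nat_power of_nat_numeral)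
  qed
qed

text \<open>Each \<open>a\<close> between \<open>\<bar>x\<bar>\<close> and 1 gives the bound with
  loss \<open>1 - a\<^sup>2\<close>, through a grid event contained in survival; the loss vanishes
  as \<open>a\<close> tends to 1.\<close>

lemma surv_ground_ge:
  assumes s: "s \<ge> 0" and r: "r > 0" and x: "\<bar>x\<bar> < 1"
  shows "(\<integral>\<omega>. indicator (surv x s r) \<omega> * ground (Xproc W x s (log_time s r) \<omega>) \<partial>M) \<ge> exp (- r) * ground x"
proof -
  let ?I = "(\<integral>\<omega>. indicator (surv x s r) \<omega> * ground (Xproc W x s (log_time s r) \<omega>) \<partial>M)"
  have ge: "?I \<ge> exp (- r) * ground x - (1 - a\<^sup>2)" if a: "\<bar>x\<bar> < a" "a < 1" for a
  proof -
    have D[measurable]: "{-a<..<a} \<in> sets borel" by simp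
    have bma: "bdd_meas {-a<..<a} ground" using a by (intro bdd_meas_subset[OF bdd_meas_ground]) auto
    have sub: "(\<Inter>n. grid {-a<..<a} x s r n) \<subseteq> surv x s r"
      using grid_subset_surv[of s r x a] s r a by auto
    have l: "(\<lambda>n. (ouK {-a<..<a} (r / 2^n) ^^ 2^n) ground x) \<longlonglongrightarrow> (\<integral>\<omega>. indicator (\<Inter>n. grid {-a<..<a} x s r n) \<omega> * ground (Xproc W x s (log_time s r) \<omega>) \<partial>M)"
      by (rule grid_limit[OF s r D bma])
    have "exp (- r) * ground x - (1 - a\<^sup>2) \<le> (\<integral>\<omega>. indicator (\<Inter>n. grid {-a<..<a} x s r n) \<omega> * ground (Xproc W x s (log_time s r) \<omega>) \<partial>M)"
    proof (rule LIMSEQ_le_const[OF l], intro exI[of _ 0] allI impI)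
      fix n show "exp (- r) * ground x - (1 - a\<^sup>2) \<le> (ouK {-a<..<a} (r / 2^n) ^^ 2^n) ground x"
        using ground_kill_lower[of "r / 2^n" a "2^n" x] r a by simp
    qed
    also have "\<dots> \<le> ?I"
    proof (rule integral_mono)
      show "integrable M (\<lambda>\<omega>. indicator (\<Inter>n. grid {-a<..<a} x s r n) \<omega> * ground (Xproc W x s (log_time s r) \<omega>))"
        by (rule integrable_grid[OF s r D bma gridI_measurable[OF s r D] gridI_end])
      show "integrable M (\<lambda>\<omega>. indicator (surv x s r) \<omega> * ground (Xproc W x s (log_time s r) \<omega>))"
        by (rule integrable_grid[OF s r _ bdd_meas_ground]) (use s r x in \<open>auto intro!: surv_measurable surv_end simp del: greaterThanLessThan_iff\<close>)
      fix \<omega>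
      have "\<omega> \<in> surv x s r \<Longrightarrow> 0 \<le> ground (Xproc W x s (log_time s r) \<omega>)"
        using surv_end[of s r x \<omega>] ground_pos[of "Xproc W x s (log_time s r) \<omega>"] s r x by (auto simp: abs_less_iff)
      then show "indicator (\<Inter>n. grid {-a<..<a} x s r n) \<omega> * ground (Xproc W x s (log_time s r) \<omega>)
        \<le> indicator (surv x s r) \<omega> * ground (Xproc W x s (log_time s r) \<omega>)"
        using sub by (auto simp: indicator_def)
    qed
    finally show ?thesis .
  qed
  have "((\<lambda>a. exp (- r) * ground x - (1 - a\<^sup>2)) \<longlongrightarrow> exp (- r) * ground x - (1 - 1\<^sup>2)) (at_left 1)"
    by (intro tendsto_intros)
  moreover have "\<forall>\<^sub>F a in at_left 1. exp (- r) * ground x - (1 - a\<^sup>2) \<le> ?I"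
    using x eventually_at_left[of "\<bar>x\<bar>" 1] ge by blast
  ultimately have "exp (- r) * ground x - (1 - 1\<^sup>2) \<le> ?I"
    by (intro tendsto_upperbound) auto
  then show ?thesis by simp
qed

lemma integrable_surv:
  assumes "s \<ge> 0" "r > 0" "\<bar>x\<bar> < 1" "bdd_meas unit_ball f"
  shows "integrable M (\<lambda>\<omega>. indicator (surv x s r) \<omega> * f (Xproc W x s (log_time s r) \<omega>))"
  by (rule integrable_grid[OF assms(1,2) _ assms(4)])
     (use assms in \<open>auto intro!: surv_measurable surv_end simp del: greaterThanLessThan_iff\<close>)

text \<open>A path could touch the boundary without leaving the interval at a dyadic time. That this has probability zero follows from the eigenfunction: both events give \<open>h\<close> the same expectation, and \<open>h\<close> is positive inside.\<close>

lemma AE_grid_surv: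
  assumes s: "s \<ge> 0" and r: "r > 0" and x: "\<bar>x\<bar> < 1"
  shows "AE \<omega> in M. indicator (\<Inter>n. grid unit_ball x s r n) \<omega> = (indicator (surv x s r) \<omega> :: real)"
proof -
  let ?A = "\<Inter>n. grid unit_ball x s r n" and ?S = "surv x s r" let ?h = "\<lambda>\<omega>. ground (Xproc W x s (log_time s r) \<omega>)"
  have sub: "?S \<subseteq> ?A" using surv_subset_grid s r x by auto
  have hp: "?h \<omega> > 0" if "\<omega> \<in> ?A" for \<omega>
    using gridI_end[OF that] by (intro ground_pos) auto
  have iA: "integrable M (\<lambda>\<omega>. indicator ?A \<omega> * ?h \<omega>)"
    by (rule integrable_grid[OF s r _ bdd_meas_ground gridI_measurable[OF s r] gridI_end]) auto
  have iS: "integrable M (\<lambda>\<omega>. indicator ?S \<omega> * ?h \<omega>)"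
    by (rule integrable_surv[OF s r x bdd_meas_ground])
  have nn: "0 \<le> indicator ?A \<omega> * ?h \<omega> - indicator ?S \<omega> * ?h \<omega>" for \<omega>
    using sub hp[of \<omega>] by (auto simp: indicator_def)
  have "(\<integral>\<omega>. indicator ?A \<omega> * ?h \<omega> - indicator ?S \<omega> * ?h \<omega> \<partial>M) \<le> 0"
    using iA iS grid_ground_le[OF assms] surv_ground_ge[OF assms] by simp
  moreover have "(\<integral>\<omega>. indicator ?A \<omega> * ?h \<omega> - indicator ?S \<omega> * ?h \<omega> \<partial>M) \<ge> 0"
    using nn by (rule Bochner_Integration.integral_nonneg)
  ultimately have "AE \<omega> in M. indicator ?A \<omega> * ?h \<omega> - indicator ?S \<omega> * ?h \<omega> = 0"
    using integral_nonneg_eq_0_iff_AE[OF Bochner_Integration.integrable_diff[OF iA iS]] nn by auto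
  then show ?thesis
  proof eventually_elim
    case (elim \<omega>)
    show ?case
    proof (cases "\<omega> \<in> ?A")
      case True
      then show ?thesis using elim hp[OF True] by (cases "\<omega> \<in> ?S") (simp_all del: INT_iff)
    next
      case False
      then have "\<omega> \<notin> ?S" using sub by blast
      with False show ?thesis by (simp del: INT_iff)
    qed
  qed
qed

lemma dyadic_ou_limit:
  assumes s: "s \<ge> 0" and r: "r > 0" and x: "\<bar>x\<bar> < 1" and f: "bdd_meas unit_ball f"
  shows "(\<lambda>n. dyadic_ou n r f x) \<longlonglongrightarrow> (\<integral>\<omega>. indicator (surv x s r) \<omega> * f (Xproc W x s (log_time s r) \<omega>) \<partial>M)"
proof -
  have "(\<integral>\<omega>. indicator (\<Inter>n. grid unit_ball x s r n) \<omega> * f (Xproc W x s (log_time s r) \<omega>) \<partial>M)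
     = (\<integral>\<omega>. indicator (surv x s r) \<omega> * f (Xproc W x s (log_time s r) \<omega>) \<partial>M)"
  proof (rule Bochner_Integration.integral_cong_AE)
    show "AE \<omega> in M. indicator (\<Inter>n. grid unit_ball x s r n) \<omega> * f (Xproc W x s (log_time s r) \<omega>)
       = indicator (surv x s r) \<omega> * f (Xproc W x s (log_time s r) \<omega>)"
      using AE_grid_surv[OF s r x] by eventually_elim simp
    show "(\<lambda>\<omega>. indicator (\<Inter>n. grid unit_ball x s r n) \<omega> * f (Xproc W x s (log_time s r) \<omega>)) \<in> borel_measurable M"
      by (rule borel_measurable_integrable, rule integrable_grid[OF s r _ f gridI_measurable[OF s r] gridI_end]) auto
    show "(\<lambda>\<omega>. indicator (surv x s r) \<omega> * f (Xproc W x s (log_time s r) \<omega>)) \<in> borel_measurable M"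
      by (rule borel_measurable_integrable, rule integrable_surv[OF s r x f])
  qed
  then show ?thesis using grid_limit[OF s r _ f, of x] by simp
qed

text \<open>Taken as a limit of deterministic Gaussian iterates, not as an expectation, so that
  neither \<open>s\<close> nor the path enters; Brownian paths serve to show that the limit exists
  (\<open>dyadic_ou_limit\<close>).\<close>

definition killed :: "real \<Rightarrow> (real \<Rightarrow> real) \<Rightarrow> real \<Rightarrow> real" where
  "killed r f x = lim (\<lambda>n. dyadic_ou n r f x)"

lemma killed_eq:
  assumes "s \<ge> 0" "r > 0" "\<bar>x\<bar> < 1" "bdd_meas unit_ball f"
  shows "killed r f x = (\<integral>\<omega>. indicator (surv x s r) \<omega> * f (Xproc W x s (log_time s r) \<omega>) \<partial>M)"
  unfolding killed_def by (rule limI[OF dyadic_ou_limit[OF assms]])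

lemma killed_lim:
  assumes "r > 0" "\<bar>x\<bar> < 1" "bdd_meas unit_ball f"
  shows "(\<lambda>n. dyadic_ou n r f x) \<longlonglongrightarrow> killed r f x"
  using dyadic_ou_limit[of 0 r x f] killed_eq[of 0 r x f] assms by simp

lemma killed_measurable[measurable]:
  assumes "bdd_meas unit_ball f" "r > 0" shows "killed r f \<in> borel_measurable borel"
proof -
  have [measurable]: "dyadic_ou n r f \<in> borel_measurable borel" for n
    using bdd_meas_ouK_funpow[OF assms(1), of "r / 2^n" "2^n"] assms(2) by (auto dest: bdd_meas_measurable)
  show ?thesis unfolding killed_def by measurable
qed

lemma killed_bound:
  assumes "r > 0" "\<bar>x\<bar> < 1" "f \<in> borel_measurable borel" "B \<ge> 0" "\<And>y. y \<in> unit_ball \<Longrightarrow> \<bar>f y\<bar> \<le> B"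
  shows "\<bar>killed r f x\<bar> \<le> B"
proof (rule LIMSEQ_le_const2)
  have "bdd_meas unit_ball f" using assms by (intro bdd_measI[where B=B]) auto
  then show "(\<lambda>n. \<bar>dyadic_ou n r f x\<bar>) \<longlonglongrightarrow> \<bar>killed r f x\<bar>" by (intro tendsto_rabs killed_lim assms)
  show "\<exists>N. \<forall>n\<ge>N. \<bar>dyadic_ou n r f x\<bar> \<le> B"
    using assms by (intro exI allI impI ouK_funpow_bound) auto
qed

lemma bdd_meas_killed: assumes "bdd_meas unit_ball f" "r > 0" shows "bdd_meas unit_ball (killed r f)"
proof -
  obtain B where B: "B \<ge> 0" "\<And>x. x \<in> unit_ball \<Longrightarrow> \<bar>f x\<bar> \<le> B" using assms(1) by (rule bdd_measE) blast
  show ?thesis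
    by (rule bdd_measI[where B=B]) (use assms B in \<open>auto intro!: killed_measurable killed_bound bdd_meas_measurable\<close>)
qed

lemma killed_mono:
  assumes "r > 0" "\<bar>x\<bar> < 1" "bdd_meas unit_ball f" "bdd_meas unit_ball g" "\<And>y. y \<in> unit_ball \<Longrightarrow> f y \<le> g y"
  shows "killed r f x \<le> killed r g x"
  by (rule LIMSEQ_le[OF killed_lim killed_lim])
     (use assms in \<open>auto intro!: exI[of _ 0] ouK_funpow_mono\<close>)

lemma killed_cong:
  assumes "r > 0" "\<bar>x\<bar> < 1" "bdd_meas unit_ball f" "bdd_meas unit_ball g" "\<And>y. y \<in> unit_ball \<Longrightarrow> f y = g y"
  shows "killed r f x = killed r g x"
  by (rule antisym; rule killed_mono) (use assms in auto)

lemma killed_scale: "r > 0 \<Longrightarrow> \<bar>x\<bar> < 1 \<Longrightarrow> bdd_meas unit_ball f \<Longrightarrow> killed r (\<lambda>y. c * f y) x = c * killed r f x"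
  using killed_lim[of r x f] unfolding killed_def[of r "\<lambda>y. c * f y"] ouK_funpow_scale
  by (intro limI tendsto_mult tendsto_const)

lemma killed_add:
  assumes "r > 0" "\<bar>x\<bar> < 1" "bdd_meas unit_ball f" "bdd_meas unit_ball g"
  shows "killed r (\<lambda>y. f y + g y) x = killed r f x + killed r g x"
proof -
  obtain B where B: "\<And>x. x \<in> unit_ball \<Longrightarrow> \<bar>f x\<bar> \<le> B" using assms(3) by (rule bdd_measE) blast
  obtain C where C: "\<And>x. x \<in> unit_ball \<Longrightarrow> \<bar>g x\<bar> \<le> C" using assms(4) by (rule bdd_measE) blast
  note [measurable] = bdd_meas_measurable[OF assms(3)] bdd_meas_measurable[OF assms(4)]
  have "bdd_meas unit_ball (\<lambda>y. f y + g y)"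
    by (rule bdd_measI[where B="B+C"]) (auto intro!: order_trans[OF abs_triangle_ineq] add_mono B C)
  then show ?thesis
    using assms integrable_surv[of 0 r x f] integrable_surv[of 0 r x g]
    by (simp add: killed_eq[of 0] distrib_left)
qed

lemma killed_ground:
  assumes "r > 0" "\<bar>x\<bar> < 1" shows "killed r ground x = exp (- r) * ground x"
proof (rule antisym)
  show "killed r ground x \<ge> exp (- r) * ground x"
    using surv_ground_ge[of 0 r x] killed_eq[of 0 r x ground] assms bdd_meas_ground by simp
  show "killed r ground x \<le> exp (- r) * ground x"
    using grid_ground_le[of 0 r x] assms bdd_meas_ground
    by (simp add: LIMSEQ_unique[OF killed_lim grid_limit[of 0 r unit_ball ground]])
qed

lemma killed_one_le:
  assumes r: "r \<in> {ln 2 / 2..ln 2}" and x: "\<bar>x\<bar> < 1" shows "killed r (\<lambda>_. 1) x \<le> 2 * ground x"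
proof (rule field_le_epsilon)
  fix e :: real assume e: "e > 0"
  have "ln 2 > (0::real)" by simp
  with r have r0: "r > 0" unfolding atLeastAtMost_iff by linarith
  have "2 * e > 0" using e by simp
  from one_kill_upper[OF this] obtain C where C: "\<And>r n x. r \<in> {ln 2 / 2..ln 2} \<Longrightarrow> \<bar>x\<bar> < 1 \<Longrightarrow> n > 0 \<Longrightarrow>
     2 * (ouK unit_ball (r / real n) ^^ n) (\<lambda>_. 1) x \<le> 4 * ground x + 2 * e + n * (3 * C * (r / real n)^2)" by blast
  have l: "(\<lambda>n. 2 * dyadic_ou n r (\<lambda>_. 1) x) \<longlonglongrightarrow> 2 * killed r (\<lambda>_. 1) x"
    by (intro tendsto_mult tendsto_const killed_lim r0 x bdd_meas_const)
  have u: "(\<lambda>n. (4 * ground x + 2 * e) + real (2^n) * (3 * C * (r / real (2^n))^2)) \<longlonglongrightarrow> (4 * ground x + 2 * e) + 0"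
    by (intro tendsto_add tendsto_const mesh_error_limit)
  have "2 * killed r (\<lambda>_. 1) x \<le> 4 * ground x + 2 * e"
  proof (rule LIMSEQ_le[OF l u[unfolded add_0_right]], intro exI[of _ 0] allI impI)
    fix n
    show "2 * dyadic_ou n r (\<lambda>_. 1) x \<le> (4 * ground x + 2 * e) + real (2^n) * (3 * C * (r / real (2^n))^2)"
      using C[OF r x, of "2^n"] by (simp only: of_nat_power of_nat_numeral zero_less_power zero_less_numeral)
  qed
  then show "killed r (\<lambda>_. 1) x \<le> 2 * ground x + e" by simp
qed

text \<open>Level \<open>Suc n\<close> on \<open>[0, 2 * r]\<close> has the mesh of level
  \<open>n\<close> on \<open>[0, r]\<close> and twice the steps, so it splits exactly into two
  iterates. For a sum of two unequal times the meshes would not agree; this is why times are doubled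
  throughout.\<close>

lemma killed_double:
  assumes r: "r > 0" and x: "\<bar>x\<bar> < 1" and f: "bdd_meas unit_ball f"
  shows "killed (2 * r) f x = killed r (killed r f) x"
proof -
  have I: "unit_ball \<in> sets borel" by simp
  obtain B where B: "B \<ge> 0" "\<And>x. x \<in> unit_ball \<Longrightarrow> \<bar>f x\<bar> \<le> B" using f by (rule bdd_measE) blast
  note fm[measurable] = bdd_meas_measurable[OF f]
  let ?X = "\<lambda>\<omega>. Xproc W x 0 (log_time 0 r) \<omega>"
  have [measurable]: "?X \<in> borel_measurable M" using r by (intro Xtm_measurable) auto
  have [measurable]: "grid unit_ball x 0 r n \<in> sets M" for n using r by (auto intro!: grid_measurable)
  have bmT: "bdd_meas unit_ball (dyadic_ou n r f)" for n using f r by (intro bdd_meas_ouK_funpow) auto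
  have [measurable]: "dyadic_ou n r f \<in> borel_measurable borel" for n using bmT by (rule bdd_meas_measurable)
  have [measurable]: "killed r f \<in> borel_measurable borel" by (rule killed_measurable[OF f r])
  have "dyadic_ou (Suc n) (2 * r) f = dyadic_ou n r (dyadic_ou n r f)" for n
  proof -
    have "2 * r / 2 ^ Suc n = r / 2^n" "(2::nat) ^ Suc n = 2^n + 2^n" by simp_all
    then show ?thesis by (simp only: funpow_add o_apply)
  qed
  then have l1: "(\<lambda>n. dyadic_ou n r (dyadic_ou n r f) x) \<longlonglongrightarrow> killed (2 * r) f x"
    using LIMSEQ_Suc[OF killed_lim[of "2 * r" x f]] r x f by simp
  \<comment> \<open>The grid event and the inner iterate both move with \<open>n\<close>; the common
    bound \<open>B\<close> allows a single passage to the limit. \<open>l3\<close> and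
    \<open>l4\<close> then recognise the result.\<close>
  have l2: "(\<lambda>n. dyadic_ou n r (dyadic_ou n r f) x) \<longlonglongrightarrow>
     (\<integral>\<omega>. indicator (\<Inter>n. grid unit_ball x 0 r n) \<omega> * killed r f (?X \<omega>) \<partial>M)"
    unfolding grid_funpow[OF order_refl r I bmT]
  proof (rule integral_dominated_convergence[where w="\<lambda>_. B"])
    show "AE \<omega> in M. (\<lambda>n. indicator (grid unit_ball x 0 r n) \<omega> * dyadic_ou n r f (?X \<omega>)) \<longlonglongrightarrow>
       indicator (\<Inter>n. grid unit_ball x 0 r n) \<omega> * killed r f (?X \<omega>)"
    proof (rule AE_I2)
      fix \<omega>
      show "(\<lambda>n. indicator (grid unit_ball x 0 r n) \<omega> * dyadic_ou n r f (?X \<omega>)) \<longlonglongrightarrow>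
       indicator (\<Inter>n. grid unit_ball x 0 r n) \<omega> * killed r f (?X \<omega>)"
      proof (cases "?X \<omega> \<in> unit_ball")
        case True
        then show ?thesis
          by (intro tendsto_mult LIMSEQ_indicator_decseq decseq_grid killed_lim r f) auto
      next
        case False
        then have "\<omega> \<notin> grid unit_ball x 0 r n" for n using grid_end by blast
        then show ?thesis by (simp add: indicator_def)
      qed
    qed
    show "AE \<omega> in M. norm (indicator (grid unit_ball x 0 r n) \<omega> * dyadic_ou n r f (?X \<omega>)) \<le> B" for n
    proof (rule AE_I2)
      fix \<omega>
      have "\<omega> \<in> grid unit_ball x 0 r n \<Longrightarrow> \<bar>dyadic_ou n r f (?X \<omega>)\<bar> \<le> B"
        using grid_end[of \<omega> unit_ball x 0 r n] B r fm by (intro ouK_funpow_bound) auto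
      then show "norm (indicator (grid unit_ball x 0 r n) \<omega> * dyadic_ou n r f (?X \<omega>)) \<le> B"
        using B by (auto simp: indicator_def)
    qed
  qed auto
  have l3: "(\<lambda>n. dyadic_ou n r (killed r f) x) \<longlonglongrightarrow>
     (\<integral>\<omega>. indicator (\<Inter>n. grid unit_ball x 0 r n) \<omega> * killed r f (?X \<omega>) \<partial>M)"
    by (rule grid_limit[OF order_refl r I bdd_meas_killed[OF f r]])
  have l4: "(\<lambda>n. dyadic_ou n r (killed r f) x) \<longlonglongrightarrow> killed r (killed r f) x"
    by (rule killed_lim[OF r x bdd_meas_killed[OF f r]])
  show ?thesis using LIMSEQ_unique[OF l1 l2] LIMSEQ_unique[OF l4 l3] by simp
qed

lemma killed_sym:
  assumes r: "r > 0" and f: "bdd_meas unit_ball f" and g: "bdd_meas unit_ball g"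
  shows "(\<integral>x. indicator unit_ball x * ou_weight x * (g x * killed r f x) \<partial>lborel)
       = (\<integral>x. indicator unit_ball x * ou_weight x * (f x * killed r g x) \<partial>lborel)"
proof -
  have lim: "(\<lambda>n. \<integral>x. indicator unit_ball x * ou_weight x * (g x * dyadic_ou n r f x) \<partial>lborel) \<longlonglongrightarrow>
      (\<integral>x. indicator unit_ball x * ou_weight x * (g x * killed r f x) \<partial>lborel)"
    if f: "bdd_meas unit_ball f" and g: "bdd_meas unit_ball g" for f g
  proof -
    obtain B where B: "B \<ge> 0" "\<And>x. x \<in> unit_ball \<Longrightarrow> \<bar>f x\<bar> \<le> B" using f by (rule bdd_measE) blast
    obtain C where C: "C \<ge> 0" "\<And>x. x \<in> unit_ball \<Longrightarrow> \<bar>g x\<bar> \<le> C" using g by (rule bdd_measE) blast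
    have [measurable]: "dyadic_ou n r f \<in> borel_measurable borel" for n
      using bdd_meas_ouK_funpow[OF f, of "r / 2^n" "2^n"] r by (auto dest: bdd_meas_measurable)
    note fm[measurable] = bdd_meas_measurable[OF f] bdd_meas_measurable[OF g] killed_measurable[OF f r]
    show ?thesis
    proof (rule integral_dominated_convergence[where w="\<lambda>x. indicator unit_ball x * (C * B)"])
      show "AE x in lborel. (\<lambda>n. indicator unit_ball x * ou_weight x * (g x * dyadic_ou n r f x)) \<longlonglongrightarrow>
         indicator unit_ball x * ou_weight x * (g x * killed r f x)"
      proof (rule AE_I2)
        fix x :: real
        show "(\<lambda>n. indicator unit_ball x * ou_weight x * (g x * dyadic_ou n r f x)) \<longlonglongrightarrow>
         indicator unit_ball x * ou_weight x * (g x * killed r f x)"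
          by (cases "x \<in> unit_ball") (auto intro!: tendsto_mult tendsto_const killed_lim r f)
      qed
      show "AE x in lborel. norm (indicator unit_ball x * ou_weight x * (g x * dyadic_ou n r f x)) \<le> indicator unit_ball x * (C * B)" for n
      proof (rule AE_I2)
        fix x :: real
        have "ou_weight x * (\<bar>g x\<bar> * \<bar>dyadic_ou n r f x\<bar>) \<le> 1 * (C * B)" if "x \<in> unit_ball"
          using that B C r fm ou_weight_pos[of x] by (intro mult_mono ouK_funpow_bound) auto
        then show "norm (indicator unit_ball x * ou_weight x * (g x * dyadic_ou n r f x)) \<le> indicator unit_ball x * (C * B)"
          using ou_weight_pos[of x] by (auto simp: indicator_def abs_mult)
      qed
      show "integrable lborel (\<lambda>x. indicator unit_ball x * (C * B))" by simp
    qed measurable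
  qed
  have "(\<integral>x. indicator unit_ball x * ou_weight x * (g x * dyadic_ou n r f x) \<partial>lborel)
     = (\<integral>x. indicator unit_ball x * ou_weight x * (f x * dyadic_ou n r g x) \<partial>lborel)" for n
    by (rule ouK_funpow_sym) (use r f g in auto)
  then show ?thesis using lim[OF f g] lim[OF g f] by (simp add: LIMSEQ_unique)
qed

end

subsection \<open>Minorization by the method of images\<close>

lemma exp_minus_le: "exp (- u) \<le> 1 / (1 + u + u\<^sup>2 / 2)" if "u \<ge> 0" for u :: real
proof -
  have "0 < 1 + u + u\<^sup>2 / 2" using that by (intro add_pos_nonneg) auto
  then show ?thesis
    using exp_lower_Taylor_quadratic[OF that] by (simp add: exp_minus field_simps)
qed

text \<open>The exponentials dominate the ratios of the two reflected densities to the direct one.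
  At \<open>x = 1\<close> or \<open>x = -1\<close> one of them equals 1, so \<open>x\<close> must
  stay away from the endpoints. After reduction to \<open>x \<ge> 0\<close>, the split at 1/2
  balances them: above it \<open>1 - x \<ge> 1/10\<close> and the far image is small, below it both
  are moderate.\<close>

lemma two_images_bound:
  fixes x z :: real
  assumes x: "x\<^sup>2 \<le> 4/5" and z: "\<bar>z\<bar> \<le> 1/16"
  shows "exp (- (2 * (1 - x) * (1 - z))) + exp (- (2 * (1 + x) * (1 + z))) \<le> 49/50"
proof -
  have main: "exp (- (2 * (1 - x) * (1 - z))) + exp (- (2 * (1 + x) * (1 + z))) \<le> 49/50"
    if x: "x\<^sup>2 \<le> 4/5" and z: "\<bar>z\<bar> \<le> 1/16" and x0: "x \<ge> 0" for x z :: real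
  proof -
    have "\<bar>x\<bar> \<le> 1" using x by (simp add: abs_square_le_1[symmetric])
    then have x1: "x \<le> 1" using x0 by simp
    have mono: "exp (- u) \<le> 1 / (1 + v + v\<^sup>2 / 2)" if "u \<ge> v" "v \<ge> 0" for u v :: real
      using exp_minus_le[OF that(2)] that(1) by (meson exp_le_cancel_iff neg_le_iff_le order_trans)
    have 1: "2 * p * (15/16) \<le> 2 * (1 - x) * (1 - z)" if "p \<le> 1 - x" "p \<ge> 0" for p
      using that z x1 by (intro mult_mono) auto
    have 2: "2 * p * (15/16) \<le> 2 * (1 + x) * (1 + z)" if "p \<le> 1 + x" "p \<ge> 0" for p
      using that z x0 by (intro mult_mono) auto
    show ?thesis
    proof (cases "x \<ge> 1/2")
      case True
      have "(1 - x) * (1 + x) \<ge> 1/5" using x by (simp add: algebra_simps power2_eq_square)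
      moreover have "(1 - x) * (1 + x) \<le> (1 - x) * 2" using x1 by (intro mult_left_mono) auto
      ultimately have "1/10 \<le> 1 - x" by simp
      from mono[OF 1[OF this]] mono[OF 2[of "3/2"]] True
      show ?thesis by (simp add: power2_eq_square)
    next
      case False
      from mono[OF 1[of "1/2"]] mono[OF 2[of 1]] False x0
      show ?thesis by (simp add: power2_eq_square)
    qed
  qed
  show ?thesis
  proof (cases "x \<ge> 0")
    case True then show ?thesis by (rule main[OF x z])
  next
    case False
    then show ?thesis using main[of "-x" "-z"] x z by simp
  qed
qed

text \<open>The half-width is chosen so that \<open>y / a\<close>, with \<open>a \<ge> 1/2\<close>,
  stays within 1/16, the range of \<open>two_images_bound\<close>.\<close>

definition core :: "real set" where "core = {-(1/32)..1/32}"

lemma core_measurable[measurable]: "core \<in> sets borel" by (simp add: core_def)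

lemma images_swap:
  fixes m :: real
  assumes [measurable]: "f \<in> borel_measurable borel" and b: "\<And>y. \<bar>f y\<bar> \<le> B" and s: "\<sigma> > 0"
  shows "(\<integral>y. normal_density m \<sigma> y * f (t - y) \<partial>lborel) = (\<integral>y. normal_density m \<sigma> (t - y) * f y \<partial>lborel)"
  by (subst lborel_integral_real_affine[where c="-1" and t=t]) auto

text \<open>The images at \<open>\<plusminus>2 a\<close> make the kernel nonpositive outside the strip, so no overshoot error arises.\<close>

lemma images_kernel_nonpos:
  fixes a \<mu> y \<sigma> :: real
  assumes a: "0 < a" and mu: "\<bar>\<mu>\<bar> \<ge> a" and y: "\<bar>y\<bar> \<le> a"
  shows "normal_density \<mu> \<sigma> y - normal_density \<mu> \<sigma> (2 * a - y) - normal_density \<mu> \<sigma> (- (2 * a) - y) \<le> 0"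
proof -
  have le: "normal_density \<mu> \<sigma> y \<le> normal_density \<mu> \<sigma> w" if "(w - \<mu>)\<^sup>2 \<le> (y - \<mu>)\<^sup>2" for w
    unfolding normal_density_def using that by (intro mult_left_mono) (auto intro!: divide_right_mono)
  have nn: "normal_density \<mu> \<sigma> w \<ge> 0" for w by simp
  show ?thesis
  proof (cases "\<mu> \<ge> 0")
    case True
    have "(2 * a - 2 * y) * (2 * a - 2 * \<mu>) \<le> 0" using True mu y by (intro mult_nonneg_nonpos) auto
    moreover have "(2 * a - y - \<mu>)\<^sup>2 - (y - \<mu>)\<^sup>2 = (2 * a - 2 * y) * (2 * a - 2 * \<mu>)" by algebra
    ultimately have "(2 * a - y - \<mu>)\<^sup>2 \<le> (y - \<mu>)\<^sup>2" by linarith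
    from le[OF this] nn[of "- (2 * a) - y"] show ?thesis by linarith
  next
    case False
    have "(2 * a + 2 * y) * (2 * a + 2 * \<mu>) \<le> 0" using False mu y by (intro mult_nonneg_nonpos) auto
    moreover have "(- (2 * a) - y - \<mu>)\<^sup>2 - (y - \<mu>)\<^sup>2 = (2 * a + 2 * y) * (2 * a + 2 * \<mu>)" by algebra
    ultimately have "(- (2 * a) - y - \<mu>)\<^sup>2 \<le> (y - \<mu>)\<^sup>2" by linarith
    from le[OF this] nn[of "2 * a - y"] show ?thesis by linarith
  qed
qed

text \<open>The three factors bound from below, in \<open>images_kernel_lower\<close>, the
  normalisation (\<open>\<sigma> \<le> 1\<close>), the direct Gaussian
  (\<open>\<bar>y - a * x\<bar> \<le> 2\<close> and \<open>\<sigma>\<^sup>2 \<ge> 1/4\<close> give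
  the exponent 8), and what the images leave over (1 - 49/50).\<close>

definition minor_const :: real where "minor_const = 1 / sqrt (2 * pi) * (exp (- 8) * (1/50))"

lemma minor_const_pos: "minor_const > 0" by (simp add: minor_const_def)

text \<open>With \<open>y = a * z\<close>, reflecting at \<open>a\<close> raises the squared
  distance to the mean by exactly \<open>4 * a\<^sup>2 * (1 - x) * (1 - z)\<close>, and reflecting
  at \<open>-a\<close> by the same with plus signs. Factoring out the direct density leaves one
  minus the two ratios.\<close>

lemma images_kernel_lower:
  fixes a x y :: real
  assumes a: "0 < a" "1/2 \<le> a\<^sup>2" "a\<^sup>2 \<le> 3/4" and x: "x\<^sup>2 \<le> 4/5" and y: "\<bar>y\<bar> \<le> 1/32"
    and \<sigma>: "\<sigma> = sqrt (1 - a\<^sup>2)"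
  shows "normal_density (a * x) \<sigma> y - normal_density (a * x) \<sigma> (2 * a - y) - normal_density (a * x) \<sigma> (- (2 * a) - y) \<ge> minor_const"
proof -
  have s2: "\<sigma>\<^sup>2 = 1 - a\<^sup>2" using a \<sigma> by simp
  have sa: "0 < \<sigma>\<^sup>2" "\<sigma>\<^sup>2 \<le> a\<^sup>2" "1/4 \<le> \<sigma>\<^sup>2" "\<sigma>\<^sup>2 \<le> 1" using a unfolding s2 by auto
  have a12: "a \<ge> 1/2"
  proof (rule ccontr)
    assume "\<not> a \<ge> 1/2"
    then have "a\<^sup>2 < (1/2)\<^sup>2" using a by (intro power_strict_mono) auto
    then show False using a by (simp add: power2_eq_square)
  qed
  define z where "z = y / a"
  have yz: "y = a * z" using a by (simp add: z_def)
  have z: "\<bar>z\<bar> \<le> 1/16"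
  proof -
    have "\<bar>z\<bar> = \<bar>y\<bar> / a" using a by (simp add: z_def)
    also have "\<dots> \<le> (1/32) / (1/2)" using y a12 by (intro frac_le) auto
    finally show ?thesis by simp
  qed
  have "\<bar>x\<bar> \<le> 1" using x by (simp add: abs_square_le_1[symmetric])
  then have x1: "1 - x \<ge> 0" "1 + x \<ge> 0" by auto
  have z1: "1 - z \<ge> 0" "1 + z \<ge> 0" using z by auto
  define N where "N = 1 / sqrt (2 * pi * \<sigma>\<^sup>2)"
  have N: "N \<ge> 1 / sqrt (2 * pi)" "N > 0" unfolding N_def using sa
    by (auto intro!: divide_left_mono simp: mult_left_le)
  define E where "E = exp (- (y - a * x)\<^sup>2 / (2 * \<sigma>\<^sup>2))"
  have E: "E \<ge> exp (- 8)"
  proof -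
    have "\<bar>y - a * x\<bar> \<le> 2"
    proof -
      have "a \<le> 1" using a by (intro power_le_imp_le_base[of a 1 1]) (auto simp: power2_eq_square intro: ccontr mult_less_cancel_left1)
      then have "\<bar>a * x\<bar> \<le> 1" using a \<open>\<bar>x\<bar> \<le> 1\<close> by (simp add: abs_mult mult_le_one)
      then show ?thesis using y by linarith
    qed
    then have "(y - a * x)\<^sup>2 \<le> 2\<^sup>2" by (metis abs_le_square_iff abs_numeral)
    then have "(y - a * x)\<^sup>2 / (2 * \<sigma>\<^sup>2) \<le> 4 / (2 * (1/4))" using sa by (intro frac_le) auto
    then show ?thesis unfolding E_def by simp
  qed
  have key: "normal_density (a * x) \<sigma> w = N * (E * exp (- (4 * (a\<^sup>2 * (p * q))) / (2 * \<sigma>\<^sup>2)))"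
    if "(w - a * x)\<^sup>2 = (y - a * x)\<^sup>2 + 4 * (a\<^sup>2 * (p * q))" for w p q
    unfolding normal_density_def N_def E_def exp_add[symmetric] that
    by (simp add: add_divide_distrib diff_divide_distrib)
  \<comment> \<open>Here \<open>\<sigma>\<^sup>2 \<le> a\<^sup>2\<close> enters, equivalently
    \<open>a\<^sup>2 \<ge> 1/2\<close>; for \<open>a = exp (- r / 2)\<close> this is the restriction
    \<open>r \<le> ln 2\<close>.\<close>
  have red: "exp (- (4 * (a\<^sup>2 * (p * q))) / (2 * \<sigma>\<^sup>2)) \<le> exp (- (2 * p * q))" if "p \<ge> 0" "q \<ge> 0" for p q
  proof -
    have "2 * (p * q) * \<sigma>\<^sup>2 \<le> 2 * (p * q) * a\<^sup>2" using that sa by (intro mult_left_mono) auto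
    then have "2 * p * q \<le> 4 * (a\<^sup>2 * (p * q)) / (2 * \<sigma>\<^sup>2)" using sa(1) by (simp add: field_simps)
    then show ?thesis by simp
  qed
  have 0: "normal_density (a * x) \<sigma> y = N * (E * 1)" using key[of y 0 0] by simp
  have 1: "normal_density (a * x) \<sigma> (2 * a - y) \<le> N * (E * exp (- (2 * (1 - x) * (1 - z))))"
    by (subst key[of _ "1 - x" "1 - z"]) (use N red[OF x1(1) z1(1)] in \<open>auto simp: E_def yz power2_eq_square algebra_simps simp del: exp_le_cancel_iff intro!: mult_left_mono\<close>)
  have 2: "normal_density (a * x) \<sigma> (- (2 * a) - y) \<le> N * (E * exp (- (2 * (1 + x) * (1 + z))))"
    by (subst key[of _ "1 + x" "1 + z"]) (use N red[OF x1(2) z1(2)] in \<open>auto simp: E_def yz power2_eq_square algebra_simps simp del: exp_le_cancel_iff intro!: mult_left_mono\<close>)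
  let ?e = "exp (- (2 * (1 - x) * (1 - z)))" let ?f = "exp (- (2 * (1 + x) * (1 + z)))"
  have "1/50 \<le> 1 - ?e - ?f" using two_images_bound[OF x z] by linarith
  then have "exp (- 8) * (1/50) \<le> E * (1 - ?e - ?f)"
    by (rule mult_mono[OF E]) (simp_all add: E_def)
  then have "minor_const \<le> N * (E * (1 - ?e - ?f))"
    unfolding minor_const_def by (rule mult_mono[OF N(1)]) (use N(2) in simp_all)
  also have "\<dots> \<le> normal_density (a * x) \<sigma> y - normal_density (a * x) \<sigma> (2 * a - y) - normal_density (a * x) \<sigma> (- (2 * a) - y)"
    using 0 1 2 by (simp add: algebra_simps)
  finally show ?thesis .
qed

section \<open>The image barrier on grids and its limit\<close>

context brownian begin

text \<open>Chapman-Kolmogorov without convolutions: both sides are the same Brownian expectation,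
  once observed on a grid of \<open>m\<close> steps and once in a single step.\<close>

lemma ouK_UNIV_funpow:
  assumes d: "d > 0" and F: "bdd_meas UNIV F" and m: "m > 0"
  shows "(ouK UNIV d ^^ m) F x = ouK UNIV (real m * d) F x"
proof -
  have md: "real m * d > 0" using d m by simp
  have "(ouK UNIV d ^^ m) F x = (\<integral>\<omega>. F (Xproc W x 0 (log_time 0 (real m * d)) \<omega>) \<partial>M)"
    using grid_expectation[OF order_refl d _ F, where n=m and x=x] by simp
  also have "\<dots> = (ouK UNIV (real m * d) ^^ 1) F x"
    using grid_expectation[OF order_refl md _ F, where n=1 and x=x] by simp
  finally show ?thesis by simp
qed

text \<open>The reflections are moved from the function to the density by substitution, so that
  pointwise signs and bounds of the image kernel become signs and bounds of the free
  evolution.\<close>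

lemma ouK_images:
  fixes x q a :: real
  assumes q: "q > 0" and f[measurable]: "f \<in> borel_measurable borel" and B: "\<And>y. \<bar>f y\<bar> \<le> B"
  defines "p \<equiv> normal_density (exp (- q / 2) * x) (ou_sd q)"
  shows "integrable lborel (\<lambda>y. (p y - p (2 * a - y) - p (- (2 * a) - y)) * f y)"
    "ouK UNIV q (\<lambda>y. f y - f (2 * a - y) - f (- (2 * a) - y)) x
       = (\<integral>y. (p y - p (2 * a - y) - p (- (2 * a) - y)) * f y \<partial>lborel)"
proof -
  have sq: "ou_sd q > 0" using q by simp
  have p_int: "integrable lborel (\<lambda>y. p y * g y)" if [measurable]: "g \<in> borel_measurable borel" and "\<And>y. \<bar>g y\<bar> \<le> B" for g
    using integrable_nd_bm[of UNIV g "ou_sd q" "exp (- q / 2) * x"] that sq by (auto simp: p_def bdd_meas_def)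
  have i0: "integrable lborel (\<lambda>y. p y * f y)" by (rule p_int) (use B in auto)
  have i1: "integrable lborel (\<lambda>y. p y * f (t - y))" for t by (rule p_int) (use B in auto)
  have i2: "integrable lborel (\<lambda>y. p (t - y) * f y)" for t
    using lborel_integrable_real_affine[OF i1[of t], of "-1" t] by simp
  have sw: "(\<integral>y. p y * f (t - y) \<partial>lborel) = (\<integral>y. p (t - y) * f y \<partial>lborel)" for t
    unfolding p_def by (rule images_swap[OF f B sq])
  show "integrable lborel (\<lambda>y. (p y - p (2 * a - y) - p (- (2 * a) - y)) * f y)"
    unfolding left_diff_distrib by (intro Bochner_Integration.integrable_diff i0 i2)
  have "ouK UNIV q (\<lambda>y. f y - f (2 * a - y) - f (- (2 * a) - y)) x
     = (\<integral>y. p y * f y - p y * f (2 * a - y) - p y * f (- (2 * a) - y) \<partial>lborel)"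
    unfolding ouK_def p_def by (simp add: algebra_simps)
  also have "\<dots> = (\<integral>y. p y * f y \<partial>lborel) - (\<integral>y. p y * f (2 * a - y) \<partial>lborel) - (\<integral>y. p y * f (- (2 * a) - y) \<partial>lborel)"
    using i0 i1[of "2 * a"] i1[of "- (2 * a)"] by simp
  also have "\<dots> = (\<integral>y. p y * f y \<partial>lborel) - (\<integral>y. p (2 * a - y) * f y \<partial>lborel) - (\<integral>y. p (- (2 * a) - y) * f y \<partial>lborel)"
    unfolding sw ..
  also have "\<dots> = (\<integral>y. (p y - p (2 * a - y) - p (- (2 * a) - y)) * f y \<partial>lborel)"
    unfolding left_diff_distrib using i0 i2[of "2 * a"] i2[of "- (2 * a)"] by simp
  finally show "ouK UNIV q (\<lambda>y. f y - f (2 * a - y) - f (- (2 * a) - y)) x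
       = (\<integral>y. (p y - p (2 * a - y) - p (- (2 * a) - y)) * f y \<partial>lborel)" .
qed

text \<open>The part of \<open>f\<close> on the core minus its two reflections evolves freely into a
  function that is nonpositive off the interval. It is therefore a lower barrier for
  \<open>kill_lower\<close> with \<open>c = 0\<close>, lies below \<open>f\<close> at the terminal
  time, and is bounded below at the start by the image kernel.\<close>

lemma ouK_minorization:
  assumes r: "r \<in> {ln 2 / 2..ln 2}" and n: "n > 0" and x: "x\<^sup>2 \<le> 4/5"
    and f: "bdd_meas unit_ball f" and f0: "\<And>y. y \<in> unit_ball \<Longrightarrow> f y \<ge> 0"
  shows "(ouK unit_ball (r / real n) ^^ n) f x \<ge> minor_const * (\<integral>y. indicator core y * f y \<partial>lborel)"
proof -
  note fm[measurable] = bdd_meas_measurable[OF f]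
  have "ln 2 > (0::real)" by simp
  with r have r0: "r > 0" unfolding atLeastAtMost_iff by linarith
  define d where "d = r / real n"
  have d: "d > 0" and nd: "real n * d = r" using r0 n by (auto simp: d_def)
  define g where "g y = indicator core y * f y" for y
  have gm[measurable]: "g \<in> borel_measurable borel" unfolding g_def by measurable
  have JI: "core \<subseteq> unit_ball" by (auto simp: core_def)
  obtain B where B: "B \<ge> 0" "\<And>y. y \<in> unit_ball \<Longrightarrow> \<bar>f y\<bar> \<le> B" using f by (rule bdd_measE) blast
  have gB: "\<bar>g y\<bar> \<le> B" for y using B JI by (auto simp: g_def indicator_def)
  have g0: "g y \<ge> 0" for y using f0 JI by (auto simp: g_def indicator_def)
  have gz: "g y = 0" if "\<bar>y\<bar> > 1/32" for y using that by (auto simp: g_def core_def indicator_def)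
  \<comment> \<open>Measured in units of the terminal time the boundary is
    \<open>exp (- q / 2)\<close> with \<open>q\<close> the remaining time, so it widens from
    \<open>a\<close> to 1. The flat strip of half-width \<open>a\<close> stays inside it, and
    reflections are taken in that strip.\<close>
  define a where "a = exp (- r / 2)"
  have a2: "a\<^sup>2 = exp (- r)" by (simp add: a_def exp_double[symmetric])
  have a: "0 < a" "1/2 \<le> a\<^sup>2" "a\<^sup>2 \<le> 3/4" "1/2 \<le> a"
  proof -
    show "0 < a" by (simp add: a_def)
    have "exp (- ln 2) \<le> exp (- r)" using r by (subst exp_le_cancel_iff) auto
    then show h: "1/2 \<le> a\<^sup>2" unfolding a2 by (simp add: exp_minus)
    have "(exp (- r))\<^sup>2 \<le> exp (- ln 2)" unfolding exp_double[symmetric] using r by (subst exp_le_cancel_iff) auto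
    then have "(a\<^sup>2)\<^sup>2 \<le> (3/4)\<^sup>2" unfolding a2 by (simp add: exp_minus power2_eq_square)
    then show "a\<^sup>2 \<le> 3/4" by (rule power2_le_imp_le) simp
    show "1/2 \<le> a" using h \<open>0 < a\<close> by (intro power2_le_imp_le[of "1/2" a]) (auto simp: power2_eq_square)
  qed
  define F where "F y = g y - g (2 * a - y) - g (- (2 * a) - y)" for y
  have FB: "\<bar>F y\<bar> \<le> 3 * B" for y using gB[of y] gB[of "2 * a - y"] gB[of "- (2 * a) - y"] unfolding F_def by linarith
  have Fm[measurable]: "F \<in> borel_measurable borel" unfolding F_def by measurable
  have bmF: "bdd_meas UNIV F" using FB by (intro bdd_measI[where B="3 * B"]) auto
  let ?U = "\<lambda>m. (ouK UNIV d ^^ m) F"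
  have bmU: "bdd_meas UNIV (?U m)" for m by (rule bdd_meas_ouK_funpow[OF bmF _ d]) simp
  let ?p = "\<lambda>q x. normal_density (exp (- q / 2) * x) (ou_sd q)"
  have Uq: "integrable lborel (\<lambda>y. (?p q x y - ?p q x (2 * a - y) - ?p q x (- (2 * a) - y)) * g y)"
     "?U m x = (\<integral>y. (?p q x y - ?p q x (2 * a - y) - ?p q x (- (2 * a) - y)) * g y \<partial>lborel)"
    if "m > 0" and q: "q = real m * d" for m q x
    using ouK_images[OF _ gm gB, where q=q and x=x and a=a] ouK_UNIV_funpow[OF d bmF that(1), of x] that d
    unfolding F_def by auto
  have "?U n x - 0 \<le> (ouK unit_ball d ^^ n) (?U 0) x"
  proof (rule kill_lower[OF d])
    show "bdd_meas unit_ball (?U 0)" using bmF by (auto intro: bdd_meas_subset)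
    fix m :: nat and x :: real assume m: "m < n"
    show "has_bochner_integral lborel (\<lambda>y. normal_density (exp (- d / 2) * x) (ou_sd d) y * ?U m y) (?U (Suc m) x)"
      using integrable_nd_bm[OF bmU[of m] _ ou_sd_pos[OF d], of "exp (- d / 2) * x"]
      by (simp add: has_bochner_integral_iff ouK_def[of UNIV d "?U m"])
  next
    fix m :: nat and x :: real assume m: "m < n" and "x \<notin> unit_ball"
    then have x1: "\<bar>x\<bar> \<ge> 1" by auto
    show "?U m x \<le> 0"
    \<comment> \<open>At remaining time 0 there is no density yet, so the sign is read off from
      \<open>F\<close> itself: the direct term vanishes and the reflected ones are
      subtracted.\<close>
    proof (cases "m = 0")
      case True
      have "g x = 0" using x1 by (intro gz) simp
      then show ?thesis using True g0[of "2 * a - x"] g0[of "- (2 * a) - x"] by (simp add: F_def)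
    next
      case False
      define q where "q = real m * d"
      have "q \<le> r" unfolding q_def nd[symmetric] using m d by (intro mult_right_mono) auto
      then have "a \<le> exp (- q / 2) * 1" by (simp add: a_def)
      also have "\<dots> \<le> \<bar>exp (- q / 2) * x\<bar>" using x1 by (simp add: abs_mult)
      finally have mu: "a \<le> \<bar>exp (- q / 2) * x\<bar>" .
      have "(?p q x y - ?p q x (2 * a - y) - ?p q x (- (2 * a) - y)) * g y \<le> 0" for y
      proof (cases "\<bar>y\<bar> \<le> a")
        case True
        then show ?thesis by (intro mult_nonpos_nonneg images_kernel_nonpos a mu g0)
      next
        case False
        then have "g y = 0" using a by (intro gz) simp
        then show ?thesis by simp
      qed
      then have "(\<integral>y. (?p q x y - ?p q x (2 * a - y) - ?p q x (- (2 * a) - y)) * g y \<partial>lborel) \<le> 0"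
        using Bochner_Integration.integral_nonneg[of lborel "\<lambda>y. - ((?p q x y - ?p q x (2 * a - y) - ?p q x (- (2 * a) - y)) * g y)"]
        by simp
      then show ?thesis using Uq(2)[of m q x] False q_def by simp
    qed
  qed auto
  also have "(ouK unit_ball d ^^ n) (?U 0) x \<le> (ouK unit_ball d ^^ n) f x" if "x \<in> unit_ball"
  proof (rule ouK_funpow_mono[OF _ f _ d _ that])
    show "bdd_meas unit_ball (?U 0)" using bmF by (auto intro: bdd_meas_subset)
    fix y assume y: "y \<in> unit_ball"
    have "F y \<le> g y" using g0[of "2 * a - y"] g0[of "- (2 * a) - y"] by (simp add: F_def)
    also have "\<dots> \<le> f y" using f0[OF y] by (auto simp: g_def indicator_def)
    finally show "?U 0 y \<le> f y" by simp
  qed simp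
  finally have "x \<in> unit_ball \<Longrightarrow> ?U n x \<le> (ouK unit_ball d ^^ n) f x" by simp
  moreover have "x \<in> unit_ball"
  proof -
    have "x\<^sup>2 < 1" using x by simp
    then have "\<bar>x\<bar> < 1" by (simp add: abs_square_less_1)
    then show ?thesis by auto
  qed
  ultimately have "?U n x \<le> (ouK unit_ball d ^^ n) f x" by simp
  moreover have "minor_const * (\<integral>y. g y \<partial>lborel) \<le> ?U n x"
  proof -
    have gint: "integrable lborel g"
    proof (rule Bochner_Integration.integrable_bound[where f="\<lambda>y. indicator core y * B"])
      show "integrable lborel (\<lambda>y. indicator core y * B)" by (simp add: core_def)
      show "AE y in lborel. norm (g y) \<le> norm (indicator core y * B)"
      proof (rule AE_I2)
        fix y
        show "norm (g y) \<le> norm (indicator core y * B)"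
          using gB[of y] B(1) by (cases "y \<in> core") (simp_all add: g_def)
      qed
    qed measurable
    have "(\<integral>y. minor_const * g y \<partial>lborel) \<le> (\<integral>y. (?p r x y - ?p r x (2 * a - y) - ?p r x (- (2 * a) - y)) * g y \<partial>lborel)"
    proof (rule integral_mono)
      fix y
      show "minor_const * g y \<le> (?p r x y - ?p r x (2 * a - y) - ?p r x (- (2 * a) - y)) * g y"
      proof (cases "\<bar>y\<bar> \<le> 1/32")
        case True
        then show ?thesis
          using images_kernel_lower[OF a(1-3) x True, of "ou_sd r"] unfolding a_def[symmetric] a2
          by (intro mult_right_mono g0) simp
      next
        case False then show ?thesis using gz by simp
      qed
    qed (use Uq(1)[OF n nd[symmetric]] gint in auto)
    then show ?thesis unfolding Uq(2)[OF n nd[symmetric]] by simp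
  qed
  ultimately show ?thesis unfolding d_def g_def by linarith
qed

lemma killed_minorization:
  assumes r: "r \<in> {ln 2 / 2..ln 2}" and x: "x\<^sup>2 \<le> 4/5"
    and f: "bdd_meas unit_ball f" and f0: "\<And>y. y \<in> unit_ball \<Longrightarrow> f y \<ge> 0"
  shows "killed r f x \<ge> minor_const * (\<integral>y. indicator core y * f y \<partial>lborel)"
proof (rule LIMSEQ_le_const)
  have "ln 2 > (0::real)" by simp
  with r have r0: "r > 0" unfolding atLeastAtMost_iff by linarith
  have "x\<^sup>2 < 1" using x by simp
  then have "\<bar>x\<bar> < 1" by (simp add: abs_square_less_1)
  then show "(\<lambda>n. dyadic_ou n r f x) \<longlonglongrightarrow> killed r f x" by (rule killed_lim[OF r0 _ f])
  show "\<exists>N. \<forall>n\<ge>N. minor_const * (\<integral>y. indicator core y * f y \<partial>lborel) \<le> dyadic_ou n r f x"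
    using ouK_minorization[OF r _ x f f0, of "2^_"] by auto
qed

end

subsection \<open>Doeblin contraction of the ground state transform\<close>

lemma ground_unit_ball: "x \<in> unit_ball \<Longrightarrow> ground x > 0" "x \<in> unit_ball \<Longrightarrow> \<bar>ground x\<bar> \<le> 1"
  using ground_pos[of x] ground_le_1[of x] by (auto simp: abs_less_iff)

lemma ou_weight_ground_integrable:
  assumes "bdd_meas unit_ball f" shows "integrable lborel (\<lambda>x. indicator unit_ball x * ou_weight x * (ground x * f x))"
proof -
  obtain B where B: "B \<ge> 0" "\<And>x. x \<in> unit_ball \<Longrightarrow> \<bar>f x\<bar> \<le> B" using assms by (rule bdd_measE) blast
  note [measurable] = bdd_meas_measurable[OF assms]
  show ?thesis
  proof (rule Bochner_Integration.integrable_bound[where f="\<lambda>x. indicator unit_ball x * B"])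
    show "AE x in lborel. norm (indicator unit_ball x * ou_weight x * (ground x * f x)) \<le> norm (indicator unit_ball x * B)"
    proof (rule AE_I2)
      fix x :: real
      have "ou_weight x * (\<bar>ground x\<bar> * \<bar>f x\<bar>) \<le> 1 * (1 * B)" if "x \<in> unit_ball"
        using that B ou_weight_pos[of x] ground_unit_ball[of x] by (intro mult_mono) (simp_all del: greaterThanLessThan_iff)
      then show "norm (indicator unit_ball x * ou_weight x * (ground x * f x)) \<le> norm (indicator unit_ball x * B)"
        using B ou_weight_pos[of x] by (cases "x \<in> unit_ball") (simp_all add: abs_mult)
    qed
  qed (simp, measurable)
qed

text \<open>Integration against \<open>alpha_OU\<close> up to normalisation. Reversibility makes it
  an eigenfunctional of the killed semigroup, see \<open>ground_int_killed\<close>.\<close>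

definition ground_int :: "(real \<Rightarrow> real) \<Rightarrow> real" where
  "ground_int f = (\<integral>x. indicator unit_ball x * ou_weight x * (ground x * f x) \<partial>lborel)"

lemma ground_int_mono:
  assumes "bdd_meas unit_ball f" "bdd_meas unit_ball g" "\<And>x. x \<in> unit_ball \<Longrightarrow> f x \<le> g x" shows "ground_int f \<le> ground_int g"
  unfolding ground_int_def
proof (intro integral_mono ou_weight_ground_integrable assms)
  fix x
  show "indicator unit_ball x * ou_weight x * (ground x * f x) \<le> indicator unit_ball x * ou_weight x * (ground x * g x)"
    using assms(3)[of x] ou_weight_pos[of x] ground_unit_ball(1)[of x]
    by (cases "x \<in> unit_ball") (simp_all add: mult_left_mono del: greaterThanLessThan_iff)
qed

lemma ground_int_scale: "ground_int (\<lambda>x. c * f x) = c * ground_int f"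
proof -
  have "ground_int (\<lambda>x. c * f x) = (\<integral>x. c * (indicator unit_ball x * ou_weight x * (ground x * f x)) \<partial>lborel)"
    unfolding ground_int_def by (intro Bochner_Integration.integral_cong refl) (simp only: mult.left_commute)
  then show ?thesis by (simp add: ground_int_def)
qed

lemma ground_int_pos:
  assumes "bdd_meas unit_ball f" "\<And>x. x \<in> unit_ball \<Longrightarrow> f x > 0" shows "ground_int f > 0"
proof -
  let ?F = "\<lambda>x. indicator unit_ball x * ou_weight x * (ground x * f x)"
  have p: "?F x > 0" if "x \<in> unit_ball" for x using that assms(2)[OF that] ou_weight_pos(1)[of x] ground_unit_ball(1)[OF that] by (simp del: greaterThanLessThan_iff)
  have nn: "?F x \<ge> 0" for x using p[of x] by (cases "x \<in> unit_ball") auto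
  have "ground_int f \<ge> 0" unfolding ground_int_def using nn by (rule Bochner_Integration.integral_nonneg)
  moreover have "ground_int f \<noteq> 0"
  proof
    assume "ground_int f = 0"
    then have "AE x in lborel. ?F x = 0"
      unfolding ground_int_def using integral_nonneg_eq_0_iff_AE[OF ou_weight_ground_integrable[OF assms(1)]] nn by simp
    then have "AE x in lborel. x \<notin> unit_ball"
      by eventually_elim (metis p less_irrefl)
    then have "emeasure lborel unit_ball = 0"
      using AE_iff_measurable[of unit_ball lborel "\<lambda>x. x \<notin> unit_ball"] by (simp del: greaterThanLessThan_iff)
    then show False by simp
  qed
  ultimately show ?thesis by simp
qed

text \<open>The coefficient of \<open>killed_doeblin\<close> at \<open>f = ground\<close>; it is the
  proportion of oscillation lost in one step.\<close>

definition doeblin_const :: real where "doeblin_const = minor_const / 10 * (\<integral>y. indicator core y * ground y \<partial>lborel)"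

lemma core_subset: "core \<subseteq> unit_ball" by (auto simp: core_def)

lemma core_integrable:
  assumes "bdd_meas unit_ball f" shows "integrable lborel (\<lambda>y. indicator core y * f y)"
proof -
  obtain B where B: "B \<ge> 0" "\<And>x. x \<in> unit_ball \<Longrightarrow> \<bar>f x\<bar> \<le> B" using assms by (rule bdd_measE) blast
  note [measurable] = bdd_meas_measurable[OF assms]
  show ?thesis
  proof (rule Bochner_Integration.integrable_bound[where f="\<lambda>x. indicator core x * B"])
    show "integrable lborel (\<lambda>y. indicator core y * B)" by (simp add: core_def)
    show "AE x in lborel. norm (indicator core x * f x) \<le> norm (indicator core x * B)"
    proof (rule AE_I2)
      fix x show "norm (indicator core x * f x) \<le> norm (indicator core x * B)"
        using B core_subset by (cases "x \<in> core") auto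
    qed
  qed measurable
qed

lemma doeblin_const_bounds: "0 < doeblin_const" "doeblin_const \<le> 1/2"
proof -
  have m: "minor_const \<le> 1"
  proof -
    have "1 / sqrt (2 * pi) \<le> 1" using pi_gt3 by (simp add: divide_le_eq_1)
    moreover have "exp (- 8) * (1/50) \<le> (1::real) * 1" by (intro mult_mono) auto
    ultimately have "minor_const \<le> 1 * (1 * 1)" unfolding minor_const_def by (intro mult_mono) auto
    then show ?thesis by simp
  qed
  have i: "integrable lborel (\<lambda>y. indicator core y * ground y)" by (rule core_integrable[OF bdd_meas_ground])
  have i1: "integrable lborel (\<lambda>y. indicator core y * c)" for c :: real by (rule core_integrable[OF bdd_meas_const])
  have c: "(\<integral>y. indicator core y * c \<partial>lborel) = c / 16" for c :: real by (simp add: core_def)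
  have "(\<integral>y. indicator core y * ground y \<partial>lborel) \<le> (\<integral>y. indicator core y * 1 \<partial>lborel)"
    using ground_le_1 by (intro integral_mono i i1) (auto simp: indicator_def)
  then have u: "(\<integral>y. indicator core y * ground y \<partial>lborel) \<le> 1 / 16" unfolding c .
  have "(\<integral>y. indicator core y * (1/2) \<partial>lborel) \<le> (\<integral>y. indicator core y * ground y \<partial>lborel)"
  proof (intro integral_mono i i1)
    fix y
    have "ground y \<ge> 1/2" if "y \<in> core"
    proof -
      have "\<bar>y\<bar> \<le> 1/32" using that by (auto simp: core_def)
      then have "y\<^sup>2 \<le> (1/32)\<^sup>2" using power_mono[of "\<bar>y\<bar>" "1/32" 2] by simp
      then show ?thesis by (simp add: ground_def power2_eq_square)
    qed
    then show "indicator core y * (1/2) \<le> indicator core y * ground y" by (cases "y \<in> core") auto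
  qed
  then have l: "1/32 \<le> (\<integral>y. indicator core y * ground y \<partial>lborel)" unfolding c by simp
  show "0 < doeblin_const" unfolding doeblin_const_def using minor_const_pos l by (intro mult_pos_pos) auto
  have "doeblin_const \<le> 1 / 10 * (1 / 16)" unfolding doeblin_const_def using m minor_const_pos u l by (intro mult_mono) auto
  then show "doeblin_const \<le> 1/2" by simp
qed

text \<open>One step loses a factor of at most \<open>exp (- doeblin_const)\<close> and lasts at
  most \<open>2 * ln 2\<close>.\<close>

definition decay_rate :: real where "decay_rate = doeblin_const / (2 * ln 2)"

lemma decay_rate_pos: "decay_rate > 0" using doeblin_const_bounds by (simp add: decay_rate_def)

text \<open>Since \<open>killed\<close> composes by doubling, a long time has to be a power of two
  times a length admissible for the Doeblin step.\<close>

lemma dyadic_scale: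
  assumes "R \<ge> ln 2" shows "\<exists>j. R / 2^j \<in> {ln 2..2 * ln (2::real)}"
proof -
  have l2: "ln 2 > (0::real)" by simp
  obtain n where "R / ln 2 < 2^n" using real_arch_pow[of 2 "R / ln 2"] by auto
  then have ex: "R < 2^n * ln 2" using l2 by (simp add: field_simps)
  define j where "j = (LEAST n. R < 2^Suc n * ln 2)"
  have "2^n * ln 2 \<le> 2^Suc n * ln (2::real)" using l2 by (intro mult_right_mono) auto
  with ex have "R < 2^Suc n * ln 2" by (rule less_le_trans)
  then have u: "R < 2^Suc j * ln 2" unfolding j_def by (rule LeastI)
  have l: "2^j * ln 2 \<le> R"
  proof (cases j)
    case 0 then show ?thesis using assms by simp
  next
    case (Suc i)
    then have "\<not> R < 2^Suc i * ln 2" unfolding j_def by (metis not_less_Least lessI)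
    then show ?thesis using Suc by simp
  qed
  have "R / 2^j \<le> 2 * ln 2" using u by (simp add: divide_le_eq mult.commute mult.left_commute)
  moreover have "ln 2 \<le> R / 2^j" using l by (simp add: le_divide_eq mult.commute)
  ultimately show ?thesis by auto
qed

section \<open>One-step bounds and contraction for the killed semigroup\<close>

context brownian begin

lemma killed_nonneg:
  assumes "r > 0" "\<bar>x\<bar> < 1" "bdd_meas unit_ball f" "\<And>y. y \<in> unit_ball \<Longrightarrow> f y \<ge> 0" shows "killed r f x \<ge> 0"
  using killed_mono[OF assms(1,2) bdd_meas_const[of unit_ball 0] assms(3)] assms(4)
    killed_scale[OF assms(1,2) bdd_meas_const[of unit_ball 0], of 0] by auto

lemma killed_diff:
  assumes "r > 0" "\<bar>x\<bar> < 1" "bdd_meas unit_ball f" "bdd_meas unit_ball g"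
  shows "killed r (\<lambda>y. f y - c * g y) x = killed r f x - c * killed r g x"
proof -
  obtain B where B: "\<And>x. x \<in> unit_ball \<Longrightarrow> \<bar>g x\<bar> \<le> B" using assms(4) by (rule bdd_measE) blast
  note [measurable] = bdd_meas_measurable[OF assms(4)]
  have b: "bdd_meas unit_ball (\<lambda>y. (- c) * g y)"
    by (rule bdd_measI[where B="\<bar>c\<bar> * B"]) (use B in \<open>auto simp: abs_mult intro!: mult_left_mono\<close>)
  show ?thesis using killed_add[OF assms(1-3) b] killed_scale[OF assms(1,2,4), of "- c"] by simp
qed

text \<open>Apply the semigroup to \<open>ground \<le> indicator + 1/5\<close>. The left side
  becomes at least \<open>ground / 2\<close> since \<open>r \<le> ln 2\<close>, while the constant
  contributes at most \<open>1/5 * (2 * ground)\<close>; what remains is 1/2 - 2/5 = 1/10.\<close>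

lemma killed_core:
  assumes r: "r \<in> {ln 2 / 2..ln 2}" and x: "\<bar>x\<bar> < 1"
  shows "killed r (indicator {y. y\<^sup>2 \<le> 4/5}) x \<ge> ground x / 10"
proof -
  have "ln 2 > (0::real)" by simp
  with r have r0: "r > 0" unfolding atLeastAtMost_iff by linarith
  let ?k = "indicator {y. y\<^sup>2 \<le> 4/5} :: real \<Rightarrow> real"
  have bk: "bdd_meas unit_ball ?k" by (rule bdd_measI[where B=1]) (auto simp: indicator_def)
  have "exp (- ln 2) \<le> exp (- r)" using r by (subst exp_le_cancel_iff) auto
  then have e: "1/2 \<le> exp (- r)" by (simp add: exp_minus)
  have "1/2 * ground x \<le> exp (- r) * ground x" using e ground_pos[OF x] by (intro mult_right_mono) auto
  also have "\<dots> = killed r ground x" using killed_ground[OF r0 x] by simp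
  also have "\<dots> \<le> killed r (\<lambda>y. ?k y + 1/5) x"
  proof (rule killed_mono[OF r0 x bdd_meas_ground])
    show "bdd_meas unit_ball (\<lambda>y. ?k y + 1/5)" by (rule bdd_measI[where B=2]) (auto simp: indicator_def)
    fix y show "ground y \<le> ?k y + 1/5" 
    proof (cases "y\<^sup>2 \<le> 4/5")
      case True
      have "ground y \<le> 1 + 1/5" using ground_le_1[of y] by linarith
      with True show ?thesis by simp
    qed (simp add: ground_def)
  qed
  also have "\<dots> = killed r ?k x + killed r (\<lambda>y. 1/5 * 1) x"
    using killed_add[OF r0 x bk bdd_meas_const] by simp
  also have "killed r (\<lambda>y. 1/5 * 1) x = 1/5 * killed r (\<lambda>_. 1) x" by (rule killed_scale[OF r0 x bdd_meas_const])
  also have "\<dots> \<le> 1/5 * (2 * ground x)" using killed_one_le[OF r x] by simp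
  finally show ?thesis by simp
qed

text \<open>Half of the time is spent on reaching \<open>y\<^sup>2 \<le> 4/5\<close>, which yields
  the factor \<open>ground x / 10\<close>; the other half on the image bound from there, which
  yields \<open>minor_const\<close>.\<close>

lemma killed_doeblin:
  assumes r: "r \<in> {ln 2..2 * ln 2}" and x: "\<bar>x\<bar> < 1" and f: "bdd_meas unit_ball f" and f0: "\<And>y. y \<in> unit_ball \<Longrightarrow> f y \<ge> 0"
  shows "killed r f x \<ge> minor_const / 10 * (\<integral>y. indicator core y * f y \<partial>lborel) * ground x"
proof -
  let ?q = "r / 2"
  have q: "?q \<in> {ln 2 / 2..ln 2}" using r by auto
  have "ln 2 > (0::real)" by simp
  with q have q0: "?q > 0" unfolding atLeastAtMost_iff by linarith
  let ?k = "indicator {y. y\<^sup>2 \<le> 4/5} :: real \<Rightarrow> real"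
  define c where "c = minor_const * (\<integral>y. indicator core y * f y \<partial>lborel)"
  have c0: "c \<ge> 0" unfolding c_def
  proof (rule mult_nonneg_nonneg[OF _ Bochner_Integration.integral_nonneg])
    fix y show "0 \<le> indicator core y * f y" using f0[of y] core_subset by (cases "y \<in> core") auto
  qed (use minor_const_pos in simp)
  have bk: "bdd_meas unit_ball ?k" by (rule bdd_measI[where B=1]) (auto simp: indicator_def)
  have bck: "bdd_meas unit_ball (\<lambda>y. c * ?k y)" by (rule bdd_measI[where B=c]) (use c0 in \<open>auto simp: indicator_def\<close>)
  have "c * (ground x / 10) \<le> c * killed ?q ?k x" using killed_core[OF q x] c0 by (rule mult_left_mono)
  also have "\<dots> = killed ?q (\<lambda>y. c * ?k y) x" using killed_scale[OF q0 x bk] by simp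
  also have "\<dots> \<le> killed ?q (killed ?q f) x"
  proof (rule killed_mono[OF q0 x bck bdd_meas_killed[OF f q0]])
    fix y :: real assume "y \<in> unit_ball"
    then have y: "\<bar>y\<bar> < 1" by auto
    show "c * ?k y \<le> killed ?q f y"
    proof (cases "y\<^sup>2 \<le> 4/5")
      case True
      then show ?thesis using killed_minorization[OF q True f f0] by (simp add: c_def)
    next
      case False
      then show ?thesis using killed_nonneg[OF q0 y f f0] by simp
    qed
  qed
  also have "\<dots> = killed r f x" using killed_double[OF q0 x f] by simp
  finally show ?thesis by (simp add: c_def mult.commute mult.left_commute)
qed

lemma killed_one_le':
  assumes r: "r \<in> {ln 2..2 * ln 2}" and x: "\<bar>x\<bar> < 1"
  shows "killed r (\<lambda>_. 1) x \<le> 2 * ground x"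
proof -
  let ?q = "r / 2"
  have q: "?q \<in> {ln 2 / 2..ln 2}" using r by auto
  have "ln 2 > (0::real)" by simp
  with q have q0: "?q > 0" unfolding atLeastAtMost_iff by linarith
  have b2: "bdd_meas unit_ball (\<lambda>y. 2 * ground y)"
  proof (rule bdd_measI[where B=2])
    fix y :: real assume "y \<in> unit_ball"
    then have "\<bar>y\<bar> < 1" by auto
    then show "\<bar>2 * ground y\<bar> \<le> 2" using ground_pos[of y] ground_le_1[of y] by simp
  qed measurable
  have "killed r (\<lambda>_. 1) x = killed ?q (killed ?q (\<lambda>_. 1)) x" using killed_double[OF q0 x bdd_meas_const] by simp
  also have "\<dots> \<le> killed ?q (\<lambda>y. 2 * ground y) x"
    by (rule killed_mono[OF q0 x bdd_meas_killed[OF bdd_meas_const q0] b2]) (use killed_one_le[OF q] in auto)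
  also have "\<dots> = 2 * (exp (- ?q) * ground x)" using killed_scale[OF q0 x bdd_meas_ground] killed_ground[OF q0 x] by simp
  also have "\<dots> \<le> 2 * (1 * ground x)" using q0 ground_pos[OF x] by (intro mult_left_mono mult_right_mono) auto
  finally show ?thesis by simp
qed

lemma bdd_meas_killed_funpow: "bdd_meas unit_ball f \<Longrightarrow> r > 0 \<Longrightarrow> bdd_meas unit_ball ((killed r ^^ k) f)"
  by (induction k) (auto intro: bdd_meas_killed)

lemma killed_funpow_cong:
  assumes "r > 0" "bdd_meas unit_ball f" "bdd_meas unit_ball g" "\<And>y. y \<in> unit_ball \<Longrightarrow> f y = g y" "x \<in> unit_ball"
  shows "(killed r ^^ k) f x = (killed r ^^ k) g x"
  using assms(5)
proof (induction k arbitrary: x)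
  case (Suc k)
  then have "\<bar>x\<bar> < 1" by auto
  then show ?case using Suc.IH assms(1-3) by (auto intro!: killed_cong bdd_meas_killed_funpow)
qed (use assms in simp)

lemma killed_dyadic:
  assumes "r > 0" "bdd_meas unit_ball f" "x \<in> unit_ball"
  shows "killed (2^j * r) f x = (killed r ^^ (2^j)) f x"
  using assms(2,3)
proof (induction j arbitrary: f x)
  case 0 then show ?case by simp
next
  case (Suc j)
  let ?q = "2^j * r"
  have q: "?q > 0" using assms by simp
  have x: "\<bar>x\<bar> < 1" using Suc.prems by auto
  have "killed (2^Suc j * r) f x = killed ?q (killed ?q f) x"
    using killed_double[OF q x Suc.prems(1)] by (simp add: mult.assoc)
  also have "\<dots> = (killed r ^^ (2^j)) (killed ?q f) x"
    by (rule Suc.IH[OF bdd_meas_killed[OF Suc.prems(1) q] Suc.prems(2)])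
  also have "\<dots> = (killed r ^^ (2^j)) ((killed r ^^ (2^j)) f) x"
    by (rule killed_funpow_cong[OF assms(1) bdd_meas_killed[OF Suc.prems(1) q] bdd_meas_killed_funpow[OF Suc.prems(1) assms(1)] Suc.IH[OF Suc.prems(1)] Suc.prems(2)])
  also have "\<dots> = (killed r ^^ (2^Suc j)) f x" by (simp add: funpow_add mult_2)
  finally show ?case .
qed

lemma ground_int_killed:
  assumes "r > 0" "bdd_meas unit_ball f" shows "ground_int (killed r f) = exp (- r) * ground_int f"
proof -
  have "ground_int (killed r f) = (\<integral>x. indicator unit_ball x * ou_weight x * (f x * killed r ground x) \<partial>lborel)"
    unfolding ground_int_def by (rule killed_sym[OF assms bdd_meas_ground])
  also have "\<dots> = (\<integral>x. exp (- r) * (indicator unit_ball x * ou_weight x * (ground x * f x)) \<partial>lborel)"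
  proof (rule Bochner_Integration.integral_cong[OF refl])
    fix x :: real
    show "indicator unit_ball x * ou_weight x * (f x * killed r ground x) = exp (- r) * (indicator unit_ball x * ou_weight x * (ground x * f x))"
    proof (cases "x \<in> unit_ball")
      case True
      then have "\<bar>x\<bar> < 1" by auto
      from killed_ground[OF assms(1) this] show ?thesis by simp
    qed simp
  qed
  finally show ?thesis by (simp add: ground_int_def)
qed

text \<open>The Doeblin bound is applied to the nonnegative functions \<open>w - m * ground\<close>
  and \<open>M' * ground - w\<close>. The gains at the two ends depend on \<open>w\<close>, but
  their sum is the core integral of \<open>(M' - m) * ground\<close> times a constant, hence a fixed
  proportion of \<open>M' - m\<close>.\<close>

lemma killed_osc_step:
  assumes r: "r \<in> {ln 2..2 * ln 2}" and w: "bdd_meas unit_ball w"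
    and b: "\<And>x. x \<in> unit_ball \<Longrightarrow> m * ground x \<le> w x \<and> w x \<le> M' * ground x"
  shows "\<exists>m2 M2. M2 - m2 = (1 - doeblin_const) * (M' - m) \<and>
     (\<forall>x\<in>unit_ball. m2 * ground x \<le> exp r * killed r w x \<and> exp r * killed r w x \<le> M2 * ground x)"
proof -
  have "ln 2 > (0::real)" by simp
  with r have r0: "r > 0" unfolding atLeastAtMost_iff by linarith
  have er: "exp r * exp (- r) = (1::real)" by (simp add: exp_minus)
  define c where "c = minor_const / 10"
  have c0: "c > 0" using minor_const_pos by (simp add: c_def)
  let ?J = "\<lambda>f. (\<integral>y. indicator core y * f y \<partial>lborel)"
  note [measurable] = bdd_meas_measurable[OF w]
  obtain B where B: "B \<ge> 0" "\<And>x. x \<in> unit_ball \<Longrightarrow> \<bar>w x\<bar> \<le> B" using w by (rule bdd_measE) blast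
  obtain H where H: "H \<ge> 0" "\<And>x. x \<in> unit_ball \<Longrightarrow> \<bar>ground x\<bar> \<le> H" using bdd_meas_ground by (rule bdd_measE) blast
  have lin: "?J (\<lambda>y. p * w y - q * ground y) = p * ?J w - q * ?J ground" for p q
  proof -
    have "indicator core y * (p * w y - q * ground y) = p * (indicator core y * w y) - q * (indicator core y * ground y)" for y
      by (simp add: algebra_simps)
    then show ?thesis using core_integrable[OF w] core_integrable[OF bdd_meas_ground] by simp
  qed
  have bmd: "bdd_meas unit_ball (\<lambda>y. p * w y - q * ground y)" for p q
  proof (rule bdd_measI[where B="\<bar>p\<bar> * B + \<bar>q\<bar> * H"])
    fix x assume x: "x \<in> unit_ball"
    have "\<bar>p * w x - q * ground x\<bar> \<le> \<bar>p * w x\<bar> + \<bar>q * ground x\<bar>" by (rule abs_triangle_ineq4)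
    also have "\<dots> \<le> \<bar>p\<bar> * B + \<bar>q\<bar> * H" unfolding abs_mult using x B H by (intro add_mono mult_left_mono) auto
    finally show "\<bar>p * w x - q * ground x\<bar> \<le> \<bar>p\<bar> * B + \<bar>q\<bar> * H" .
  qed measurable
  have bmp: "bdd_meas unit_ball (\<lambda>y. p * w y)" for p using bmd[of p 0] by simp
  \<comment> \<open>Both ends in one statement: \<open>p = 1, q = m\<close> raises the lower
    constant, \<open>p = -1, q = - M'\<close> lowers the upper one. The factor
    \<open>exp r \<ge> 1\<close> is discarded from the Doeblin gain.\<close>
  have main: "exp r * (p * killed r w x - q * (exp (- r) * ground x)) \<ge> c * (p * ?J w - q * ?J ground) * ground x"
    if x: "x \<in> unit_ball" and nn: "\<And>y. y \<in> unit_ball \<Longrightarrow> p * w y - q * ground y \<ge> 0" for p q x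
  proof -
    have x1: "\<bar>x\<bar> < 1" using x by auto
    have J0: "?J (\<lambda>y. p * w y - q * ground y) \<ge> 0"
    proof (rule Bochner_Integration.integral_nonneg)
      fix y show "0 \<le> indicator core y * (p * w y - q * ground y)" using nn[of y] core_subset by (cases "y \<in> core") auto
    qed
    have "killed r (\<lambda>y. p * w y - q * ground y) x = p * killed r w x - q * (exp (- r) * ground x)"
      using killed_diff[OF r0 x1 bmp bdd_meas_ground, of p q] killed_scale[OF r0 x1 w, of p] killed_ground[OF r0 x1] by simp
    moreover have "c * ?J (\<lambda>y. p * w y - q * ground y) * ground x \<le> killed r (\<lambda>y. p * w y - q * ground y) x"
      unfolding c_def by (rule killed_doeblin[OF r x1 bmd nn])
    moreover have z: "0 \<le> c * ?J (\<lambda>y. p * w y - q * ground y) * ground x" using c0 J0 ground_pos[OF x1] by simp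
    ultimately have "1 * (c * ?J (\<lambda>y. p * w y - q * ground y) * ground x) \<le> exp r * (p * killed r w x - q * (exp (- r) * ground x))"
      using r0 by (intro mult_mono) auto
    then show ?thesis unfolding lin by simp
  qed
  define m2 where "m2 = m + c * (?J w - m * ?J ground)"
  define M2 where "M2 = M' - c * (M' * ?J ground - ?J w)"
  have "M2 - m2 = (1 - doeblin_const) * (M' - m)"
  proof -
    have "doeblin_const = c * ?J ground" by (simp add: doeblin_const_def c_def)
    then show ?thesis unfolding m2_def M2_def by (simp add: algebra_simps)
  qed
  moreover have "m2 * ground x \<le> exp r * killed r w x \<and> exp r * killed r w x \<le> M2 * ground x" if x: "x \<in> unit_ball" for x
  proof
    have "c * (1 * ?J w - m * ?J ground) * ground x \<le> exp r * (1 * killed r w x - m * (exp (- r) * ground x))"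
      by (rule main[OF x]) (use b in auto)
    also have "\<dots> = exp r * killed r w x - (exp r * exp (- r)) * (m * ground x)" by (simp only: algebra_simps)
    finally show "m2 * ground x \<le> exp r * killed r w x" unfolding er m2_def by (simp add: algebra_simps)
    have "c * ((-1) * ?J w - (- M') * ?J ground) * ground x \<le> exp r * ((-1) * killed r w x - (- M') * (exp (- r) * ground x))"
      by (rule main[OF x]) (use b in auto)
    also have "\<dots> = (exp r * exp (- r)) * (M' * ground x) - exp r * killed r w x" by algebra
    finally show "exp r * killed r w x \<le> M2 * ground x" unfolding er M2_def by (simp add: algebra_simps)
  qed
  ultimately show ?thesis by blast
qed

text \<open>The count starts at \<open>Suc 0\<close> because \<open>f\<close> itself need not be
  comparable with \<open>ground\<close>; one application makes it so.\<close>

lemma killed_funpow_osc: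
  assumes r: "r \<in> {ln 2..2 * ln 2}" and f: "bdd_meas unit_ball f" and f1: "\<And>x. x \<in> unit_ball \<Longrightarrow> \<bar>f x\<bar> \<le> 1"
  shows "\<exists>m M'. M' - m = 16 * (1 - doeblin_const)^k \<and>
    (\<forall>x\<in>unit_ball. m * ground x \<le> exp (real (Suc k) * r) * (killed r ^^ Suc k) f x \<and> exp (real (Suc k) * r) * (killed r ^^ Suc k) f x \<le> M' * ground x)"
proof (induction k)
  case 0
  have "ln 2 > (0::real)" by simp
  with r have r0: "r > 0" unfolding atLeastAtMost_iff by linarith
  have "exp r \<le> exp (2 * ln 2)" using r by (subst exp_le_cancel_iff) auto
  then have e4: "exp r \<le> 4" by (simp add: exp_double)
  \<comment> \<open>8 comes from \<open>exp r \<le> 4\<close> and survival probability at most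
    \<open>2 * ground\<close>; the resulting width is 16.\<close>
  have "- 8 * ground x \<le> exp r * killed r f x \<and> exp r * killed r f x \<le> 8 * ground x" if x: "x \<in> unit_ball" for x
  proof -
    have x1: "\<bar>x\<bar> < 1" using x by auto
    have "killed r f x \<le> killed r (\<lambda>_. 1) x"
      by (rule killed_mono[OF r0 x1 f bdd_meas_const]) (use f1 in force)
    moreover have "killed r (\<lambda>_. (- 1) * 1) x \<le> killed r f x"
      by (rule killed_mono[OF r0 x1 bdd_meas_const f]) (use f1 in force)
    moreover have "killed r (\<lambda>_. (- 1) * 1) x = - killed r (\<lambda>_. 1) x"
      using killed_scale[OF r0 x1 bdd_meas_const, of "- 1" 1] by simp
    ultimately have "\<bar>killed r f x\<bar> \<le> 2 * ground x" using killed_one_le'[OF r x1] by linarith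
    then have "exp r * \<bar>killed r f x\<bar> \<le> 4 * (2 * ground x)" using e4 by (intro mult_mono) auto
    then have "\<bar>exp r * killed r f x\<bar> \<le> 8 * ground x" by (simp add: abs_mult)
    then show ?thesis by linarith
  qed
  then show ?case by (intro exI[of _ "-8"] exI[of _ 8]) auto
next
  case (Suc k)
  have "ln 2 > (0::real)" by simp
  with r have r0: "r > 0" unfolding atLeastAtMost_iff by linarith
  let ?V = "(killed r ^^ Suc k) f" let ?e = "exp (real (Suc k) * r)"
  have V: "bdd_meas unit_ball ?V" by (rule bdd_meas_killed_funpow[OF f r0])
  note [measurable] = bdd_meas_measurable[OF V]
  obtain B where B: "B \<ge> 0" "\<And>x. x \<in> unit_ball \<Longrightarrow> \<bar>?V x\<bar> \<le> B" using V by (rule bdd_measE) blast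
  have W: "bdd_meas unit_ball (\<lambda>x. ?e * ?V x)"
    by (rule bdd_measI[where B="?e * B"]) (use B in \<open>auto simp: abs_mult simp del: funpow.simps\<close>)
  obtain m M' where mM: "M' - m = 16 * (1 - doeblin_const)^k"
    "\<And>x. x \<in> unit_ball \<Longrightarrow> m * ground x \<le> ?e * ?V x \<and> ?e * ?V x \<le> M' * ground x" using Suc by blast
  obtain m2 M2 where 2: "M2 - m2 = (1 - doeblin_const) * (M' - m)"
     "\<And>x. x\<in>unit_ball \<Longrightarrow> m2 * ground x \<le> exp r * killed r (\<lambda>x. ?e * ?V x) x \<and> exp r * killed r (\<lambda>x. ?e * ?V x) x \<le> M2 * ground x"
    using killed_osc_step[OF r W mM(2)] by blast
  have "exp r * killed r (\<lambda>x. ?e * ?V x) x = exp (real (Suc (Suc k)) * r) * (killed r ^^ Suc (Suc k)) f x" if x: "x \<in> unit_ball" for x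
  proof -
    have x1: "\<bar>x\<bar> < 1" using x by auto
    have "exp r * killed r (\<lambda>x. ?e * ?V x) x = exp r * (?e * killed r ?V x)"
      unfolding killed_scale[OF r0 x1 V] ..
    also have "\<dots> = (exp r * ?e) * (killed r ^^ Suc (Suc k)) f x" by simp
    also have "exp r * ?e = exp (real (Suc (Suc k)) * r)" by (simp add: exp_add[symmetric] algebra_simps)
    finally show ?thesis .
  qed
  then show ?case using 2 mM(1) by (intro exI[of _ m2] exI[of _ M2]) auto
qed

text \<open>The contraction alone does not name the limit. \<open>ground_int\<close> is preserved by
  \<open>exp R * killed R\<close>, so integrating the enclosure between \<open>m * ground\<close>
  and \<open>M' * ground\<close> puts \<open>ground_int f / ground_int ground\<close> between
  \<open>m\<close> and \<open>M'\<close> as well.\<close>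

lemma killed_converges:
  assumes R: "R \<ge> ln 2" and f: "bdd_meas unit_ball f" and f1: "\<And>x. x \<in> unit_ball \<Longrightarrow> \<bar>f x\<bar> \<le> 1" and x: "x \<in> unit_ball"
  shows "\<bar>exp R * killed R f x - ground_int f / ground_int ground * ground x\<bar> \<le> 32 * exp (- decay_rate * R) * ground x"
proof -
  obtain j where j: "R / 2^j \<in> {ln 2..2 * ln 2}" using dyadic_scale[OF R] by blast
  define r where "r = R / 2^j"
  have r: "r \<in> {ln 2..2 * ln 2}" using j by (simp add: r_def)
  have l2: "ln 2 > (0::real)" by simp
  with r have r0: "r > 0" unfolding atLeastAtMost_iff by linarith
  have Rr: "R = 2^j * r" by (simp add: r_def)
  obtain k where k: "2^j = Suc k" by (metis not0_implies_Suc power_eq_0_iff zero_neq_numeral)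
  have kR: "real (Suc k) * r = R" unfolding k[symmetric] Rr by simp
  obtain m M' where mM: "M' - m = 16 * (1 - doeblin_const)^k"
    "\<And>x. x \<in> unit_ball \<Longrightarrow> m * ground x \<le> exp R * (killed r ^^ Suc k) f x \<and> exp R * (killed r ^^ Suc k) f x \<le> M' * ground x"
    using killed_funpow_osc[OF r f f1, of k] unfolding kR by blast
  have P: "(killed r ^^ Suc k) f x = killed R f x" if "x \<in> unit_ball" for x
    using killed_dyadic[OF r0 f that, of j] unfolding k Rr by simp
  have bnd: "m * ground x \<le> exp R * killed R f x \<and> exp R * killed R f x \<le> M' * ground x" if "x \<in> unit_ball" for x
    using mM(2)[OF that] unfolding P[OF that] .
  have R0: "R > 0" using R l2 by linarith
  have bP: "bdd_meas unit_ball (killed R f)" by (rule bdd_meas_killed[OF f R0])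
  note [measurable] = bdd_meas_measurable[OF bP]
  obtain B where B: "\<And>x. x \<in> unit_ball \<Longrightarrow> \<bar>killed R f x\<bar> \<le> B" using bP by (rule bdd_measE) blast
  have bs: "bdd_meas unit_ball (\<lambda>x. c * killed R f x)" for c
    by (rule bdd_measI[where B="\<bar>c\<bar> * B"]) (use B in \<open>auto simp: abs_mult intro!: mult_left_mono\<close>)
  obtain H where H: "\<And>x. x \<in> unit_ball \<Longrightarrow> \<bar>ground x\<bar> \<le> H" using bdd_meas_ground by (rule bdd_measE) blast
  have bh: "bdd_meas unit_ball (\<lambda>x. c * ground x)" for c
    by (rule bdd_measI[where B="\<bar>c\<bar> * H"]) (use H in \<open>auto simp: abs_mult intro!: mult_left_mono\<close>)
  have A: "ground_int (\<lambda>x. exp R * killed R f x) = ground_int f"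
    unfolding ground_int_scale ground_int_killed[OF R0 f] by (simp add: exp_minus)
  have Ah: "ground_int ground > 0" by (rule ground_int_pos[OF bdd_meas_ground]) (auto intro: ground_pos)
  have "m * ground_int ground \<le> ground_int f" unfolding A[symmetric] ground_int_scale[symmetric, of m] by (rule ground_int_mono[OF bh bs]) (use bnd in blast)
  moreover have "ground_int f \<le> M' * ground_int ground" unfolding A[symmetric] ground_int_scale[symmetric, of M'] by (rule ground_int_mono[OF bs bh]) (use bnd in blast)
  ultimately have L: "m \<le> ground_int f / ground_int ground" "ground_int f / ground_int ground \<le> M'" using Ah by (auto simp: field_simps)
  have hp: "ground x > 0" using x by (intro ground_pos) auto
  have "m * ground x \<le> ground_int f / ground_int ground * ground x" "ground_int f / ground_int ground * ground x \<le> M' * ground x"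
    using L hp by (auto intro!: mult_right_mono simp del: times_divide_eq_left)
  then have "\<bar>exp R * killed R f x - ground_int f / ground_int ground * ground x\<bar> \<le> M' * ground x - m * ground x"
    using bnd[OF x] by linarith
  also have "\<dots> = 16 * (1 - doeblin_const)^k * ground x" unfolding mM(1)[symmetric] by (simp add: algebra_simps)
  \<comment> \<open>There are \<open>Suc k\<close> steps but \<open>k\<close> contractions; the
    missing factor \<open>1 - doeblin_const\<close> is at least 1/2, which turns 16 into 32.\<close>
  also have "16 * (1 - doeblin_const)^k \<le> 32 * exp (- decay_rate * R)"
  proof -
    have b: "0 < 1 - doeblin_const" "1/2 \<le> 1 - doeblin_const" using doeblin_const_bounds by auto
    have "(1 - doeblin_const)^k * (1/2) \<le> (1 - doeblin_const)^k * (1 - doeblin_const)" using b by (intro mult_left_mono) auto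
    also have "\<dots> = (1 - doeblin_const)^Suc k" by simp
    also have "\<dots> \<le> (exp (- doeblin_const))^Suc k" using b exp_ge_add_one_self[of "- doeblin_const"] by (intro power_mono) auto
    also have "\<dots> = exp (- (doeblin_const * real (Suc k)))" unfolding exp_of_nat_mult[symmetric] by (simp add: mult.commute)
    also have "\<dots> \<le> exp (- decay_rate * R)"
    proof -
      have "R \<le> real (Suc k) * (2 * ln 2)" unfolding kR[symmetric] using r by (intro mult_left_mono) auto
      then have "decay_rate * R \<le> decay_rate * (real (Suc k) * (2 * ln 2))" using decay_rate_pos by (intro mult_left_mono) auto
      also have "\<dots> = doeblin_const * real (Suc k)" using l2 by (simp add: decay_rate_def)
      finally show ?thesis by simp
    qed
    finally show ?thesis by simp
  qed
  finally show ?thesis using hp by (simp add: mult_right_mono)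
qed

end

subsection \<open>The conditional laws\<close>

lemma bdd_meas_bounded: "f \<in> borel_measurable borel \<Longrightarrow> (\<And>x. \<bar>f x\<bar> \<le> 1) \<Longrightarrow> bdd_meas unit_ball f"
  by (rule bdd_measI)

lemma ground_int_one_pos: "ground_int (\<lambda>_. 1) > 0"
  by (rule ground_int_pos[OF bdd_meas_const]) simp

lemma K_OU_eq: "K_OU = 1 / ground_int (\<lambda>_. 1)"
  unfolding K_OU_def ground_int_def ground_def ou_weight_def by (simp add: mult.assoc mult.commute mult.left_commute)

lemma alpha_OU_eq: "alpha_OU = density lborel (\<lambda>x. ennreal (K_OU * (indicator unit_ball x * ou_weight x * (ground x * 1))))"
  unfolding alpha_OU_def ground_def ou_weight_def by (simp add: mult.assoc mult.commute mult.left_commute)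

lemma alpha_weight_nonneg: "0 \<le> K_OU * (indicator unit_ball x * ou_weight x * (ground x * 1))"
  using ground_int_one_pos ou_weight_pos[of x] ground_unit_ball(1)[of x]
  by (cases "x \<in> unit_ball") (simp_all add: K_OU_eq del: greaterThanLessThan_iff)

lemma sets_alpha_OU[measurable_cong]: "sets alpha_OU = sets borel"
  by (simp add: alpha_OU_def)

lemma alpha_OU_integral:
  assumes [measurable]: "f \<in> borel_measurable borel"
  shows "integral\<^sup>L alpha_OU f = ground_int f / ground_int (\<lambda>_. 1)"
proof -
  have "integral\<^sup>L alpha_OU f = (\<integral>x. (K_OU * (indicator unit_ball x * ou_weight x * (ground x * 1))) *\<^sub>R f x \<partial>lborel)"
    unfolding alpha_OU_eq using alpha_weight_nonneg by (intro integral_density) auto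
  also have "\<dots> = (\<integral>x. K_OU * (indicator unit_ball x * ou_weight x * (ground x * f x)) \<partial>lborel)"
    by (simp add: mult.assoc)
  finally show ?thesis by (simp add: ground_int_def K_OU_eq)
qed

lemma alpha_OU_prob: "prob_on_interval alpha_OU"
proof -
  have 1: "emeasure alpha_OU A = 1" if A: "A \<in> sets borel" "unit_ball \<subseteq> A" for A
  proof -
    have "emeasure alpha_OU A = (\<integral>\<^sup>+x. ennreal (K_OU * (indicator unit_ball x * ou_weight x * (ground x * 1))) * indicator A x \<partial>lborel)"
      unfolding alpha_OU_eq using A by (intro emeasure_density) auto
    also have "\<dots> = (\<integral>\<^sup>+x. ennreal (K_OU * (indicator unit_ball x * ou_weight x * (ground x * 1))) \<partial>lborel)"
    proof (rule nn_integral_cong)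
      fix x
      show "ennreal (K_OU * (indicator unit_ball x * ou_weight x * (ground x * 1))) * indicator A x = ennreal (K_OU * (indicator unit_ball x * ou_weight x * (ground x * 1)))"
        using A(2) by (cases "x \<in> unit_ball") (auto simp: indicator_def)
    qed
    also have "\<dots> = ennreal (\<integral>x. K_OU * (indicator unit_ball x * ou_weight x * (ground x * 1)) \<partial>lborel)"
      using ou_weight_ground_integrable[OF bdd_meas_const[of unit_ball 1]] alpha_weight_nonneg
      by (intro nn_integral_eq_integral integrable_mult_right AE_I2) auto
    also have "(\<integral>x. K_OU * (indicator unit_ball x * ou_weight x * (ground x * 1)) \<partial>lborel) = K_OU * ground_int (\<lambda>_. 1)"
      unfolding ground_int_def by simp
    also have "\<dots> = 1" using ground_int_one_pos by (simp add: K_OU_eq)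
    finally show ?thesis by simp
  qed
  have "prob_space alpha_OU"
    by (rule prob_spaceI) (use 1[of UNIV] in \<open>simp add: alpha_OU_def\<close>)
  then show ?thesis using 1[of unit_ball] by (simp add: prob_on_interval_def sets_alpha_OU)
qed

lemma prob_on_interval_AE:
  assumes "prob_on_interval \<mu>" shows "AE x in \<mu>. x \<in> unit_ball"
proof -
  interpret prob_space \<mu> using assms by (simp add: prob_on_interval_def)
  have "unit_ball \<in> sets \<mu>" "prob unit_ball = 1" using assms by (auto simp: prob_on_interval_def measure_def)
  then show ?thesis using AE_in_set_eq_1 by blast
qed

lemma prob_on_interval_integrable:
  assumes "prob_on_interval \<mu>" "bdd_meas unit_ball f" shows "integrable \<mu> f"
proof -
  interpret prob_space \<mu> using assms by (simp add: prob_on_interval_def)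
  have s[measurable_cong]: "sets \<mu> = sets borel" using assms by (simp add: prob_on_interval_def)
  note [measurable] = bdd_meas_measurable[OF assms(2)]
  obtain B where B: "\<And>x. x \<in> unit_ball \<Longrightarrow> \<bar>f x\<bar> \<le> B" using assms(2) by (rule bdd_measE) blast
  have "AE x in \<mu>. norm (f x) \<le> B" using prob_on_interval_AE[OF assms(1)] by eventually_elim (simp add: B)
  then show ?thesis by (rule integrable_const_bound) measurable
qed

lemma ground_mean_pos:
  assumes mu: "prob_on_interval \<mu>" shows "integral\<^sup>L \<mu> ground > 0"
proof -
  interpret prob_space \<mu> using mu by (simp add: prob_on_interval_def)
  have i: "integrable \<mu> ground" by (rule prob_on_interval_integrable[OF mu bdd_meas_ground])
  have ae: "AE x in \<mu>. 0 \<le> ground x" using prob_on_interval_AE[OF mu] by eventually_elim (use ground_unit_ball(1) in force)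
  have "integral\<^sup>L \<mu> ground \<ge> 0" using ae by (rule integral_nonneg_AE)
  moreover have "integral\<^sup>L \<mu> ground \<noteq> 0"
  proof
    assume "integral\<^sup>L \<mu> ground = 0"
    then have "AE x in \<mu>. ground x = 0" using integral_nonneg_eq_0_iff_AE[OF i ae] by simp
    with prob_on_interval_AE[OF mu] have "AE x in \<mu>. False" by eventually_elim (use ground_unit_ball(1) in force)
    then show False by simp
  qed
  ultimately show ?thesis by simp
qed

lemma measure_eqI_bounded:
  assumes "prob_space \<mu>" "prob_space \<nu>" and s: "sets \<mu> = sets borel" "sets \<nu> = sets borel"
    and eq: "\<And>A. A \<in> sets borel \<Longrightarrow> integral\<^sup>L \<mu> (indicator A :: real \<Rightarrow> real) = integral\<^sup>L \<nu> (indicator A)"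
  shows "\<mu> = \<nu>"
proof (rule measure_eqI)
  interpret m: prob_space \<mu> by fact
  interpret n: prob_space \<nu> by fact
  fix A assume A: "A \<in> sets \<mu>"
  have "space \<mu> = UNIV" "space \<nu> = UNIV" using s sets_eq_imp_space_eq[of _ borel] by auto
  then have "measure \<mu> A = measure \<nu> A" using eq[of A] A s by simp
  then show "emeasure \<mu> A = emeasure \<nu> A" by (simp add: m.emeasure_eq_measure n.emeasure_eq_measure)
qed (simp add: s)

context brownian begin

text \<open>\<open>killed\<close> is meaningless at time \<open>0\<close>, where its mesh degenerates.\<close>

definition killed0 :: "real \<Rightarrow> (real \<Rightarrow> real) \<Rightarrow> real \<Rightarrow> real" where
  "killed0 r g x = (if r = 0 then g x else killed r g x)"

lemma bdd_meas_killed0: "r \<ge> 0 \<Longrightarrow> bdd_meas unit_ball g \<Longrightarrow> bdd_meas unit_ball (killed0 r g)"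
  by (cases "r = 0") (simp_all add: killed0_def[abs_def] bdd_meas_killed)

lemma killed0_mono:
  assumes "r \<ge> 0" "x \<in> unit_ball" "bdd_meas unit_ball f" "bdd_meas unit_ball g" "\<And>y. y \<in> unit_ball \<Longrightarrow> f y \<le> g y"
  shows "killed0 r f x \<le> killed0 r g x"
  using assms killed_mono[of r x f g] by (auto simp: killed0_def)

lemma killed0_ground: "r \<ge> 0 \<Longrightarrow> x \<in> unit_ball \<Longrightarrow> killed0 r ground x = exp (- r) * ground x"
  using killed_ground[of r x] by (auto simp: killed0_def)

lemma killed0_one_ge: "r \<ge> 0 \<Longrightarrow> x \<in> unit_ball \<Longrightarrow> exp (- r) * ground x \<le> killed0 r (\<lambda>_. 1) x"
  using killed0_mono[OF _ _ bdd_meas_ground bdd_meas_const, of r x 1] killed0_ground[of r x] ground_le_1 by auto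

lemma killed0_abs_le:
  assumes "r \<ge> 0" "x \<in> unit_ball" "bdd_meas unit_ball f" "\<And>y. y \<in> unit_ball \<Longrightarrow> \<bar>f y\<bar> \<le> 1"
  shows "\<bar>killed0 r f x\<bar> \<le> killed0 r (\<lambda>_. 1) x"
proof -
  have x1: "\<bar>x\<bar> < 1" using assms by auto
  have "killed0 r f x \<le> killed0 r (\<lambda>_. 1) x"
    by (rule killed0_mono[OF assms(1-3) bdd_meas_const]) (use assms(4) in force)
  moreover have "killed0 r (\<lambda>_. (- 1) * 1) x \<le> killed0 r f x"
    by (rule killed0_mono[OF assms(1,2) bdd_meas_const assms(3)]) (use assms(4) in force)
  moreover have "killed0 r (\<lambda>_. (- 1) * 1) x = - killed0 r (\<lambda>_. 1) x"
    using killed_scale[OF _ x1 bdd_meas_const, of r "- 1" 1] assms(1) by (auto simp: killed0_def)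
  ultimately show ?thesis by linarith
qed

lemma killed0_eq:
  assumes s: "s \<ge> 0" and r: "r \<ge> 0" and x: "x \<in> unit_ball" and g: "bdd_meas unit_ball g"
  shows "(\<integral>\<omega>. indicator (surv x s r) \<omega> * g (Xproc W x s (log_time s r) \<omega>) \<partial>M) = killed0 r g x"
proof (cases "r = 0")
  case False
  then show ?thesis using killed_eq[of s r x g] s r x g by (auto simp: killed0_def)
next
  case True
  have "\<bar>x\<bar> \<noteq> 1" using x by auto
  then have "surv x s r = space M"
    using tauX_gt_iff_log_time[OF s r] Xproc_start[OF s] True unfolding surv_def by auto
  then have "(\<integral>\<omega>. indicator (surv x s r) \<omega> * g (Xproc W x s (log_time s r) \<omega>) \<partial>M) = (\<integral>\<omega>. g x \<partial>M)"
    using True Xproc_start[OF s] by (intro Bochner_Integration.integral_cong) auto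
  then show ?thesis using True by (simp add: killed0_def prob_space)
qed

section \<open>The conditional law as a quotient of killed expectations\<close>

context
  fixes \<mu> :: "real measure" and s r :: real
  assumes mu: "prob_on_interval \<mu>" and s: "s \<ge> 0" and r: "r \<ge> 0"
begin

lemma surv_event_measurable: "surv_event \<mu> M W s (log_time s r) \<in> sets (\<mu> \<Otimes>\<^sub>M M)"
proof -
  have s1: "sets (\<mu> \<Otimes>\<^sub>M M) = sets (borel \<Otimes>\<^sub>M M)"
    using mu by (intro sets_pair_measure_cong) (auto simp: prob_on_interval_def)
  show ?thesis unfolding surv_event_def
    unfolding s1 sets_eq_imp_space_eq[OF s1] by (rule surv_pair_measurable[OF s r])
qed

lemma surv_event_integral:
  assumes g[measurable]: "g \<in> borel_measurable borel" and g1: "\<And>x. \<bar>g x\<bar> \<le> 1"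
  shows "(\<integral>p. indicator (surv_event \<mu> M W s (log_time s r)) p * g (Xproc W (fst p) s (log_time s r) (snd p)) \<partial>(\<mu> \<Otimes>\<^sub>M M))
     = (\<integral>x. killed0 r g x \<partial>\<mu>)"
proof -
  interpret mu: prob_space \<mu> using mu by (simp add: prob_on_interval_def)
  interpret P: pair_prob_space \<mu> M ..
  have sm[measurable_cong]: "sets \<mu> = sets borel" using mu by (simp add: prob_on_interval_def)
  note [measurable] = surv_event_measurable
  have [measurable]: "(\<lambda>p. Xproc W (fst p) s (log_time s r) (snd p)) \<in> borel_measurable (\<mu> \<Otimes>\<^sub>M M)"
    using Xproc_pair_measurable[OF log_time_ge[OF s r]] by (simp cong: measurable_cong_sets)
  let ?F = "\<lambda>p. indicator (surv_event \<mu> M W s (log_time s r)) p * g (Xproc W (fst p) s (log_time s r) (snd p))"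
  have int: "integrable (\<mu> \<Otimes>\<^sub>M M) ?F"
    by (rule P.P.integrable_const_bound[where B=1]) (use g1 in \<open>auto simp: indicator_def\<close>)
  have sp: "space \<mu> = UNIV" using sets_eq_imp_space_eq[OF sm] by simp
  have bg: "bdd_meas unit_ball g" by (rule bdd_meas_bounded[OF g g1])
  have "(\<integral>p. ?F p \<partial>(\<mu> \<Otimes>\<^sub>M M)) = (\<integral>x. (\<integral>\<omega>. ?F (x, \<omega>) \<partial>M) \<partial>\<mu>)"
    using P.integral_fst'[OF int] by simp
  also have "\<dots> = (\<integral>x. killed0 r g x \<partial>\<mu>)"
  proof (rule Bochner_Integration.integral_cong_AE)
    show "(\<lambda>x. \<integral>\<omega>. ?F (x, \<omega>) \<partial>M) \<in> borel_measurable \<mu>"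
      using P.integrable_fst'[OF int] by (rule borel_measurable_integrable)
    show "killed0 r g \<in> borel_measurable \<mu>"
      using bdd_meas_measurable[OF bdd_meas_killed0[OF r bg]] by (simp cong: measurable_cong_sets add: sm)
    show "AE x in \<mu>. (\<integral>\<omega>. ?F (x, \<omega>) \<partial>M) = killed0 r g x"
      using prob_on_interval_AE[OF mu]
    proof eventually_elim
      case (elim x)
      have "(\<integral>\<omega>. ?F (x, \<omega>) \<partial>M) = (\<integral>\<omega>. indicator (surv x s r) \<omega> * g (Xproc W x s (log_time s r) \<omega>) \<partial>M)"
        by (intro Bochner_Integration.integral_cong refl)
           (auto simp: surv_event_def surv_def space_pair_measure sp indicator_def)
      then show ?case using killed0_eq[OF s r elim bg] by simp
    qed
  qed
  finally show ?thesis .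
qed

lemma surv_event_measure: "measure (\<mu> \<Otimes>\<^sub>M M) (surv_event \<mu> M W s (log_time s r)) = (\<integral>x. killed0 r (\<lambda>_. 1) x \<partial>\<mu>)"
proof -
  have "measure (\<mu> \<Otimes>\<^sub>M M) (surv_event \<mu> M W s (log_time s r)) = (\<integral>p. indicator (surv_event \<mu> M W s (log_time s r)) p * 1 \<partial>(\<mu> \<Otimes>\<^sub>M M))"
    using sets.sets_into_space[OF surv_event_measurable] by (simp add: Int_absorb2)
  then show ?thesis using surv_event_integral[of "\<lambda>_. 1"] by simp
qed

lemma killed0_one_integral_ge: "exp (- r) * integral\<^sup>L \<mu> ground \<le> (\<integral>x. killed0 r (\<lambda>_. 1) x \<partial>\<mu>)"
proof -
  have "(\<integral>x. exp (- r) * ground x \<partial>\<mu>) \<le> (\<integral>x. killed0 r (\<lambda>_. 1) x \<partial>\<mu>)"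
  proof (rule integral_mono_AE)
    show "integrable \<mu> (\<lambda>x. exp (- r) * ground x)"
      by (intro integrable_mult_right prob_on_interval_integrable[OF mu bdd_meas_ground])
    show "integrable \<mu> (killed0 r (\<lambda>_. 1))" by (rule prob_on_interval_integrable[OF mu bdd_meas_killed0[OF r bdd_meas_const]])
    show "AE x in \<mu>. exp (- r) * ground x \<le> killed0 r (\<lambda>_. 1) x"
      using prob_on_interval_AE[OF mu] by eventually_elim (rule killed0_one_ge[OF r])
  qed
  then show ?thesis by simp
qed

lemma killed0_one_integral_pos: "(\<integral>x. killed0 r (\<lambda>_. 1) x \<partial>\<mu>) > 0"
  using killed0_one_integral_ge ground_mean_pos[OF mu] by (intro less_le_trans[OF mult_pos_pos killed0_one_integral_ge]) auto

lemma cond_law_integral: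
  assumes g[measurable]: "g \<in> borel_measurable borel" and g1: "\<And>x. \<bar>g x\<bar> \<le> 1"
  shows "integral\<^sup>L (cond_law M W \<mu> s (log_time s r)) g = (\<integral>x. killed0 r g x \<partial>\<mu>) / (\<integral>x. killed0 r (\<lambda>_. 1) x \<partial>\<mu>)"
proof -
  have sm[measurable_cong]: "sets \<mu> = sets borel" using mu by (simp add: prob_on_interval_def)
  note [measurable] = surv_event_measurable
  let ?S = "surv_event \<mu> M W s (log_time s r)"
  let ?X = "\<lambda>p. Xproc W (fst p) s (log_time s r) (snd p)"
  have [measurable]: "?X \<in> borel_measurable (\<mu> \<Otimes>\<^sub>M M)"
    using Xproc_pair_measurable[OF log_time_ge[OF s r]] by (simp cong: measurable_cong_sets)
  have "integral\<^sup>L (cond_law M W \<mu> s (log_time s r)) g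
    = integral\<^sup>L (density (\<mu> \<Otimes>\<^sub>M M) (\<lambda>p. ennreal (indicator ?S p / measure (\<mu> \<Otimes>\<^sub>M M) ?S))) (\<lambda>p. g (?X p))"
    unfolding cond_law_def by (rule integral_distr) measurable
  also have "\<dots> = (\<integral>p. (indicator ?S p / measure (\<mu> \<Otimes>\<^sub>M M) ?S) *\<^sub>R g (?X p) \<partial>(\<mu> \<Otimes>\<^sub>M M))"
  proof (rule integral_density)
    show "(\<lambda>p. g (?X p)) \<in> borel_measurable (\<mu> \<Otimes>\<^sub>M M)" by measurable
    show "(\<lambda>p. indicator ?S p / measure (\<mu> \<Otimes>\<^sub>M M) ?S :: real) \<in> borel_measurable (\<mu> \<Otimes>\<^sub>M M)" by measurable
    show "AE p in \<mu> \<Otimes>\<^sub>M M. 0 \<le> (indicator ?S p / measure (\<mu> \<Otimes>\<^sub>M M) ?S :: real)" by (rule AE_I2) simp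
  qed
  also have "\<dots> = (\<integral>p. (indicator ?S p * g (?X p)) / measure (\<mu> \<Otimes>\<^sub>M M) ?S \<partial>(\<mu> \<Otimes>\<^sub>M M))"
    by simp
  also have "\<dots> = (\<integral>p. indicator ?S p * g (?X p) \<partial>(\<mu> \<Otimes>\<^sub>M M)) / measure (\<mu> \<Otimes>\<^sub>M M) ?S"
    by (rule integral_divide_zero)
  finally show ?thesis unfolding surv_event_integral[OF g g1] surv_event_measure .
qed

lemma cond_law_prob: "prob_space (cond_law M W \<mu> s (log_time s r))"
proof -
  interpret mu: prob_space \<mu> using mu by (simp add: prob_on_interval_def)
  interpret P: pair_prob_space \<mu> M ..
  have sm[measurable_cong]: "sets \<mu> = sets borel" using mu by (simp add: prob_on_interval_def)
  note SE[measurable] = surv_event_measurable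
  let ?S = "surv_event \<mu> M W s (log_time s r)" let ?m = "measure (\<mu> \<Otimes>\<^sub>M M) ?S"
  have m: "?m > 0" unfolding surv_event_measure by (rule killed0_one_integral_pos)
  have X: "(\<lambda>p. Xproc W (fst p) s (log_time s r) (snd p)) \<in> borel_measurable (\<mu> \<Otimes>\<^sub>M M)"
    using Xproc_pair_measurable[OF log_time_ge[OF s r]] by (simp cong: measurable_cong_sets)
  have "prob_space (density (\<mu> \<Otimes>\<^sub>M M) (\<lambda>p. ennreal (indicator ?S p / ?m)))"
  proof (rule prob_spaceI)
    have "emeasure (density (\<mu> \<Otimes>\<^sub>M M) (\<lambda>p. ennreal (indicator ?S p / ?m))) (space (\<mu> \<Otimes>\<^sub>M M))
       = (\<integral>\<^sup>+p. ennreal (indicator ?S p / ?m) * indicator (space (\<mu> \<Otimes>\<^sub>M M)) p \<partial>(\<mu> \<Otimes>\<^sub>M M))"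
      by (rule emeasure_density) measurable
    also have "\<dots> = (\<integral>\<^sup>+p. ennreal (indicator ?S p / ?m) \<partial>(\<mu> \<Otimes>\<^sub>M M))"
      by (rule nn_integral_cong) simp
    also have "\<dots> = ennreal (\<integral>p. indicator ?S p / ?m \<partial>(\<mu> \<Otimes>\<^sub>M M))"
      by (rule nn_integral_eq_integral) (auto intro!: P.P.integrable_const_bound[where B="1 / ?m"] divide_right_mono simp: indicator_def)
    also have "(\<integral>p. indicator ?S p / ?m \<partial>(\<mu> \<Otimes>\<^sub>M M)) = 1"
      using m sets.sets_into_space[OF SE] by (simp add: Int_absorb2)
    finally show "emeasure (density (\<mu> \<Otimes>\<^sub>M M) (\<lambda>p. ennreal (indicator ?S p / ?m)))
      (space (density (\<mu> \<Otimes>\<^sub>M M) (\<lambda>p. ennreal (indicator ?S p / ?m)))) = 1" by simp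
  qed
  then show ?thesis unfolding cond_law_def
    by (rule prob_space.prob_space_distr) (use X in simp)
qed

text \<open>Numerator and denominator, scaled by \<open>exp r\<close>, are each within
  \<open>32 * exp (- decay_rate * r)\<close> times the mean of \<open>ground\<close> of their
  limits. That mean is at most the scaled denominator, so it cancels on division and the bound is
  free of \<open>\<mu>\<close>; the two errors add up to 64.\<close>

lemma cond_law_rate:
  assumes f: "f \<in> borel_measurable borel" and f1: "\<And>x. \<bar>f x\<bar> \<le> 1"
  shows "\<bar>integral\<^sup>L (cond_law M W \<mu> s (log_time s r)) f - integral\<^sup>L alpha_OU f\<bar> \<le> 64 * exp (- decay_rate * r)"
proof -
  have bf: "bdd_meas unit_ball f" by (rule bdd_meas_bounded[OF f f1])
  let ?N = "\<integral>x. killed0 r f x \<partial>\<mu>" let ?D = "\<integral>x. killed0 r (\<lambda>_. 1) x \<partial>\<mu>"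
  let ?a = "ground_int f / ground_int (\<lambda>_. 1)"
  have D: "?D > 0" by (rule killed0_one_integral_pos)
  have a: "\<bar>?a\<bar> \<le> 1"
  proof -
    have "ground_int f \<le> ground_int (\<lambda>_. 1)" by (rule ground_int_mono[OF bf bdd_meas_const]) (use f1 in \<open>auto simp: abs_le_iff\<close>)
    moreover have "ground_int (\<lambda>_. (- 1) * 1) \<le> ground_int f" by (rule ground_int_mono[OF bdd_meas_const bf]) (use f1 in \<open>auto simp: abs_le_iff minus_le_iff\<close>)
    moreover have "ground_int (\<lambda>_. (- 1) * 1) = - ground_int (\<lambda>_. 1)" using ground_int_scale[of "- 1" "\<lambda>_. 1"] by simp
    ultimately have "\<bar>ground_int f\<bar> \<le> ground_int (\<lambda>_. 1)" by linarith
    then show ?thesis using ground_int_one_pos by simp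
  qed
  have iN: "integrable \<mu> (killed0 r f)" by (rule prob_on_interval_integrable[OF mu bdd_meas_killed0[OF r bf]])
  have iD: "integrable \<mu> (killed0 r (\<lambda>_. 1))" by (rule prob_on_interval_integrable[OF mu bdd_meas_killed0[OF r bdd_meas_const]])
  have ih: "integrable \<mu> ground" by (rule prob_on_interval_integrable[OF mu bdd_meas_ground])
  have int_bound: "\<bar>\<integral>x. G x \<partial>\<mu>\<bar> \<le> (\<integral>x. H x \<partial>\<mu>)"
    if "integrable \<mu> G" "integrable \<mu> H" "\<And>x. x \<in> unit_ball \<Longrightarrow> \<bar>G x\<bar> \<le> H x" for G H :: "real \<Rightarrow> real"
  proof -
    have "\<bar>\<integral>x. G x \<partial>\<mu>\<bar> \<le> (\<integral>x. \<bar>G x\<bar> \<partial>\<mu>)" by (rule integral_abs_bound)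
    also have "\<dots> \<le> (\<integral>x. H x \<partial>\<mu>)"
    proof (rule integral_mono_AE)
      show "AE x in \<mu>. \<bar>G x\<bar> \<le> H x"
        using prob_on_interval_AE[OF mu] by eventually_elim (rule that(3))
    qed (use that in auto)
    finally show ?thesis .
  qed
  show ?thesis
  proof (cases "r \<ge> ln 2")
    case True
    have "ln 2 > (0::real)" by simp
    with True have r0: "r > 0" by linarith
    let ?e = "32 * exp (- decay_rate * r)"
    let ?L = "\<lambda>f. ground_int f / ground_int ground"
    have est: "\<bar>exp r * (\<integral>x. killed0 r g x \<partial>\<mu>) - ?L g * (\<integral>x. ground x \<partial>\<mu>)\<bar> \<le> ?e * (\<integral>x. ground x \<partial>\<mu>)"
      if bg: "bdd_meas unit_ball g" and g1: "\<And>x. \<bar>g x\<bar> \<le> 1" for g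
    proof -
      have ig: "integrable \<mu> (killed0 r g)" by (rule prob_on_interval_integrable[OF mu bdd_meas_killed0[OF r bg]])
      have "\<bar>\<integral>x. exp r * killed0 r g x - ?L g * ground x \<partial>\<mu>\<bar> \<le> (\<integral>x. ?e * ground x \<partial>\<mu>)"
      proof (rule int_bound)
        show "integrable \<mu> (\<lambda>x. exp r * killed0 r g x - ?L g * ground x)" "integrable \<mu> (\<lambda>x. ?e * ground x)"
          using ig ih by auto
        show "\<bar>exp r * killed0 r g x - ?L g * ground x\<bar> \<le> ?e * ground x" if "x \<in> unit_ball" for x
          using killed_converges[OF True bg g1 that] r0 by (simp add: killed0_def)
      qed
      then show ?thesis using ig ih by simp
    qed
    have h: "(\<integral>x. ground x \<partial>\<mu>) > 0" by (rule ground_mean_pos[OF mu])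
    let ?h = "\<integral>x. ground x \<partial>\<mu>"
    have eD: "?h \<le> exp r * ?D"
    proof -
      have "exp r * (exp (- r) * ?h) \<le> exp r * ?D" using killed0_one_integral_ge by (intro mult_left_mono) auto
      moreover have "exp r * (exp (- r) * ?h) = ?h" by (simp add: exp_minus)
      ultimately show ?thesis by simp
    qed
    have est1: "\<bar>exp r * ?D - ?L (\<lambda>_. 1) * ?h\<bar> \<le> ?e * ?h"
      by (rule est[OF bdd_meas_const]) simp
    have estf: "\<bar>exp r * ?N - ?L f * ?h\<bar> \<le> ?e * ?h"
      by (rule est[OF bf f1])
    have "\<bar>?a * (exp r * ?D - ?L (\<lambda>_. 1) * ?h)\<bar> \<le> 1 * (?e * ?h)"
      unfolding abs_mult by (rule mult_mono[OF a est1 zero_le_one abs_ge_zero])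
    then have est2: "\<bar>?a * (exp r * ?D - ?L (\<lambda>_. 1) * ?h)\<bar> \<le> ?e * ?h"
      by (simp only: mult_1_left)
    \<comment> \<open>The limit of the numerator is \<open>?a\<close> times that of the denominator,
      so in \<open>?N - ?a * ?D\<close> the main terms cancel and the two errors are left.\<close>
    have La: "?L f = ?a * ?L (\<lambda>_. 1)" using ground_int_one_pos by simp
    have bnd: "\<bar>exp r * ?N - ?a * (exp r * ?D)\<bar> \<le> ?e * ?h + ?e * ?h"
    proof -
      have eq: "exp r * ?N - ?a * (exp r * ?D) = (exp r * ?N - ?L f * ?h) - ?a * (exp r * ?D - ?L (\<lambda>_. 1) * ?h)"
        unfolding La by (simp only: algebra_simps)
      have "\<bar>exp r * ?N - ?a * (exp r * ?D)\<bar> \<le> \<bar>exp r * ?N - ?L f * ?h\<bar> + \<bar>?a * (exp r * ?D - ?L (\<lambda>_. 1) * ?h)\<bar>"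
        unfolding eq by (rule abs_triangle_ineq4)
      also have "\<dots> \<le> ?e * ?h + ?e * ?h"
        by (rule add_mono[OF estf est2])
      finally show ?thesis .
    qed
    have alg: "(n / d - a) * (e * d) = e * n - a * (e * d)" if "d \<noteq> 0" for n d a e :: real
      using that by (simp add: field_simps)
    have "?D \<noteq> 0" using D by simp
    from alg[OF this] have "\<bar>(?N / ?D - ?a) * (exp r * ?D)\<bar> = \<bar>exp r * ?N - ?a * (exp r * ?D)\<bar>" by (simp only:)
    also have "\<dots> \<le> ?e * ?h + ?e * ?h" by (rule bnd)
    also have "\<dots> = 64 * exp (- decay_rate * r) * ?h" by simp
    also have "\<dots> \<le> 64 * exp (- decay_rate * r) * (exp r * ?D)" using eD by (intro mult_left_mono) auto
    finally have "\<bar>?N / ?D - ?a\<bar> * (exp r * ?D) \<le> 64 * exp (- decay_rate * r) * (exp r * ?D)"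
      using D by (simp add: abs_mult)
    then have "\<bar>?N / ?D - ?a\<bar> \<le> 64 * exp (- decay_rate * r)"
      by (rule mult_right_le_imp_le) (use D in simp)
    then show ?thesis unfolding cond_law_integral[OF f f1] alpha_OU_integral[OF f] .
  next
    case False
    have "\<bar>?N\<bar> \<le> ?D" by (rule int_bound[OF iN iD]) (rule killed0_abs_le[OF r _ bf f1])
    then have "\<bar>?N / ?D\<bar> \<le> 1" using D by simp
    then have "\<bar>?N / ?D - ?a\<bar> \<le> 2" using a by linarith
    \<comment> \<open>Below \<open>ln 2\<close> the contraction gives nothing, but there the
      exponential is still at least 1/2, so the trivial bound 2 suffices.\<close>
    also have "2 \<le> 64 * exp (- decay_rate * r)"
    proof -
      have "decay_rate * r \<le> decay_rate * (2 * ln 2)" using False decay_rate_pos r by (intro mult_left_mono) auto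
      also have "\<dots> = doeblin_const" by (simp add: decay_rate_def)
      also have "\<dots> \<le> 1/2" by (rule doeblin_const_bounds)
      finally have "1/2 \<le> 1 + - decay_rate * r" by simp
      also have "\<dots> \<le> exp (- decay_rate * r)" by (rule exp_ge_add_one_self)
      finally show ?thesis by simp
    qed
    finally show ?thesis unfolding cond_law_integral[OF f f1] alpha_OU_integral[OF f] .
  qed
qed

end

section \<open>Back to the original time: rate, quasi-stationarity, uniqueness, weak
  convergence\<close>

lemma cond_law_rate_powr:
  assumes mu: "prob_on_interval \<mu>" and s: "0 \<le> s" "s \<le> t"
    and f: "f \<in> borel_measurable borel" and f1: "\<And>x. \<bar>f x\<bar> \<le> 1"
  shows "\<bar>integral\<^sup>L (cond_law M W \<mu> s t) f - integral\<^sup>L alpha_OU f\<bar> \<le> 64 * ((s + 1) / (t + 1)) powr decay_rate"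
proof -
  define r where "r = ln ((t + 1) / (s + 1))"
  have t: "log_time s r = t" unfolding r_def using s by (rule log_time_inverse)
  have r: "r \<ge> 0" using s by (simp add: r_def)
  have "((s + 1) / (t + 1)) powr decay_rate = exp (- decay_rate * r)"
    using s by (simp add: powr_def r_def ln_div algebra_simps)
  then show ?thesis using cond_law_rate[OF mu s(1) r f f1] unfolding t by simp
qed

text \<open>By \<open>ground_int_killed\<close> the numerator and the denominator both acquire the
  factor \<open>exp (- r)\<close>, which cancels.\<close>

lemma cond_law_alpha:
  assumes s: "0 \<le> s" "s \<le> t" shows "cond_law M W alpha_OU s t = alpha_OU"
proof -
  define r where "r = ln ((t + 1) / (s + 1))"
  have t: "log_time s r = t" unfolding r_def using s by (rule log_time_inverse)
  have r: "r \<ge> 0" using s by (simp add: r_def)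
  have KPi: "(\<integral>x. killed0 r g x \<partial>alpha_OU) = exp (- r) * (ground_int g / ground_int (\<lambda>_. 1))" if bg: "bdd_meas unit_ball g" for g
    using alpha_OU_integral[OF bdd_meas_measurable[OF bdd_meas_killed0[OF r bg]]] ground_int_killed[OF _ bg, of r] r
    by (cases "r = 0") (auto simp: killed0_def[abs_def])
  show ?thesis
  proof (rule measure_eqI_bounded)
    show "prob_space (cond_law M W alpha_OU s t)" using cond_law_prob[OF alpha_OU_prob s(1) r] unfolding t .
    show "prob_space alpha_OU" using alpha_OU_prob by (simp add: prob_on_interval_def)
    show "sets (cond_law M W alpha_OU s t) = sets borel" by (simp add: cond_law_def)
    show "sets alpha_OU = sets borel" by (rule sets_alpha_OU)
    fix A :: "real set" assume A: "A \<in> sets borel"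
    let ?g = "indicator A :: real \<Rightarrow> real"
    have g: "?g \<in> borel_measurable borel" and g1: "\<bar>?g x\<bar> \<le> 1" for x using A by (auto simp: indicator_def)
    show "integral\<^sup>L (cond_law M W alpha_OU s t) ?g = integral\<^sup>L alpha_OU ?g"
      using cond_law_integral[OF alpha_OU_prob s(1) r g g1] ground_int_one_pos
      unfolding t alpha_OU_integral[OF g] KPi[OF bdd_meas_bounded[OF g g1]] KPi[OF bdd_meas_const] by simp
  qed
qed

lemma rate_tendsto_0:
  assumes "s \<ge> 0" shows "((\<lambda>t. c * ((s + 1) / (t + 1)) powr decay_rate) \<longlongrightarrow> 0) at_top"
proof -
  have "filterlim (\<lambda>t::real. 1 + t) at_top at_top"
    by (rule filterlim_tendsto_add_at_top[OF tendsto_const filterlim_ident])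
  then have "filterlim (\<lambda>t::real. t + 1) at_infinity at_top"
    by (intro filterlim_at_top_imp_at_infinity) (simp add: add.commute)
  then have "((\<lambda>t. (s + 1) / (t + 1)) \<longlongrightarrow> 0) at_top"
    by (rule tendsto_divide_0[OF tendsto_const])
  moreover have "\<forall>\<^sub>F t in at_top. 0 \<le> (s + 1) / (t + 1)"
    using eventually_ge_at_top[of 0] by eventually_elim (use assms in auto)
  ultimately have "((\<lambda>t. ((s + 1) / (t + 1)) powr decay_rate) \<longlongrightarrow> 0 powr decay_rate) at_top"
    using decay_rate_pos by (intro tendsto_powr' tendsto_const) auto
  then have "((\<lambda>t. c * ((s + 1) / (t + 1)) powr decay_rate) \<longlongrightarrow> c * 0) at_top"
    using decay_rate_pos by (intro tendsto_mult tendsto_const) simp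
  then show ?thesis by simp
qed

lemma cond_law_tendsto:
  fixes f :: "real \<Rightarrow> real"
  assumes mu: "prob_on_interval \<mu>" and s: "0 \<le> s" and f: "f \<in> borel_measurable borel" and f1: "\<And>x. \<bar>f x\<bar> \<le> 1"
  shows "((\<lambda>t. integral\<^sup>L (cond_law M W \<mu> s t) f) \<longlongrightarrow> integral\<^sup>L alpha_OU f) at_top"
proof -
  have "((\<lambda>t. integral\<^sup>L (cond_law M W \<mu> s t) f - integral\<^sup>L alpha_OU f) \<longlongrightarrow> 0) at_top"
  proof (rule Lim_null_comparison[OF _ rate_tendsto_0[OF s, of 64]])
    show "\<forall>\<^sub>F t in at_top. norm (integral\<^sup>L (cond_law M W \<mu> s t) f - integral\<^sup>L alpha_OU f) \<le> 64 * ((s + 1) / (t + 1)) powr decay_rate"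
      using eventually_ge_at_top[of s]
    proof eventually_elim
      case (elim t)
      from cond_law_rate_powr[OF mu s elim f f1] show ?case by simp
    qed
  qed
  then show ?thesis by (simp only: LIM_zero_iff)
qed

text \<open>Conditioning leaves a quasi-stationary law fixed, while it drives every law to
  \<open>alpha_OU\<close>; a constant family equals its limit.\<close>

lemma alpha_OU_unique:
  assumes "is_qsd_X M W \<alpha>" shows "\<alpha> = alpha_OU"
proof (rule measure_eqI_bounded)
  have pr: "prob_on_interval \<alpha>" and q: "\<And>t. 0 \<le> t \<Longrightarrow> cond_law M W \<alpha> 0 t = \<alpha>"
    using assms by (auto simp: is_qsd_X_def)
  show "prob_space \<alpha>" "sets \<alpha> = sets borel" using pr by (auto simp: prob_on_interval_def)
  show "prob_space alpha_OU" using alpha_OU_prob by (simp add: prob_on_interval_def)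
  show "sets alpha_OU = sets borel" by (rule sets_alpha_OU)
  fix A :: "real set" assume A: "A \<in> sets borel"
  let ?g = "indicator A :: real \<Rightarrow> real"
  have g: "?g \<in> borel_measurable borel" and g1: "\<bar>?g x\<bar> \<le> 1" for x using A by (auto simp: indicator_def)
  have "((\<lambda>t. integral\<^sup>L (cond_law M W \<alpha> 0 t) ?g) \<longlongrightarrow> integral\<^sup>L alpha_OU ?g) at_top"
    by (rule cond_law_tendsto[OF pr order_refl g g1])
  moreover have "\<forall>\<^sub>F t in at_top. integral\<^sup>L (cond_law M W \<alpha> 0 t) ?g = integral\<^sup>L \<alpha> ?g"
    using eventually_ge_at_top[of 0] by eventually_elim (simp only: q)
  ultimately have "((\<lambda>t::real. integral\<^sup>L \<alpha> ?g) \<longlongrightarrow> integral\<^sup>L alpha_OU ?g) at_top"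
    by (rule Lim_transform_eventually)
  then show "integral\<^sup>L \<alpha> ?g = integral\<^sup>L alpha_OU ?g"
    by (simp add: tendsto_const_iff)
qed

lemma cond_law_tv:
  assumes mu: "prob_on_interval \<mu>" and s: "0 \<le> s" "s \<le> t"
  shows "tv_dist (cond_law M W \<mu> s t) alpha_OU \<le> 64 * ((s + 1) / (t + 1)) powr decay_rate"
  unfolding tv_dist_def
proof (rule cSup_least)
  show "{\<bar>integral\<^sup>L (cond_law M W \<mu> s t) f - integral\<^sup>L alpha_OU f\<bar> |f :: real \<Rightarrow> real. f \<in> borel_measurable borel \<and> (\<forall>x. \<bar>f x\<bar> \<le> 1)} \<noteq> {}"
    by (rule ex_in_conv[THEN iffD1], rule exI, rule CollectI, rule exI[of _ "\<lambda>_. 0::real"],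
        rule conjI[OF refl]) simp
  show "y \<le> 64 * ((s + 1) / (t + 1)) powr decay_rate"
    if "y \<in> {\<bar>integral\<^sup>L (cond_law M W \<mu> s t) f - integral\<^sup>L alpha_OU f\<bar> |f :: real \<Rightarrow> real. f \<in> borel_measurable borel \<and> (\<forall>x. \<bar>f x\<bar> \<le> 1)}" for y
    using that cond_law_rate_powr[OF mu s] by auto
qed

lemma cond_law_weak:
  assumes mu: "prob_on_interval \<mu>" and s: "0 \<le> s"
  shows "weak_conv_at_top (\<lambda>t. cond_law M W \<mu> s t) alpha_OU"
  unfolding weak_conv_at_top_def
proof (intro allI impI, elim conjE)
  fix f :: "real \<Rightarrow> real" assume c: "continuous_on UNIV f" and b: "bounded (range f)"
  obtain B where B: "B > 0" "\<And>x. \<bar>f x\<bar> \<le> B" using b unfolding bounded_pos by auto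
  have "((\<lambda>t. integral\<^sup>L (cond_law M W \<mu> s t) (\<lambda>x. f x / B)) \<longlongrightarrow> integral\<^sup>L alpha_OU (\<lambda>x. f x / B)) at_top"
    using B borel_measurable_continuous_onI[OF c] by (intro cond_law_tendsto[OF mu s]) auto
  then have "((\<lambda>t. B * (integral\<^sup>L (cond_law M W \<mu> s t) f / B)) \<longlongrightarrow> B * (integral\<^sup>L alpha_OU f / B)) at_top"
    unfolding integral_divide_zero by (intro tendsto_mult tendsto_const)
  then show "((\<lambda>t. integral\<^sup>L (cond_law M W \<mu> s t) f) \<longlongrightarrow> integral\<^sup>L alpha_OU f) at_top" using B by simp
qed

end

theorem theorem2:
  fixes M :: "'a measure" and W :: "real \<Rightarrow> 'a \<Rightarrow> real"
  assumes "std_BM M W"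
  shows "is_qsd_X M W alpha_OU
    \<and> (\<forall>\<alpha>. is_qsd_X M W \<alpha> \<longrightarrow> \<alpha> = alpha_OU)
    \<and> (\<exists>C \<gamma>::real. C > 0 \<and> \<gamma> > 0 \<and>
         (\<forall>\<mu> s t. prob_on_interval \<mu> \<and> 0 \<le> s \<and> s \<le> t \<longrightarrow>
            tv_dist (cond_law M W \<mu> s t) alpha_OU \<le> C * ((s + 1) / (t + 1)) powr \<gamma>))
    \<and> (\<forall>\<mu> s. prob_on_interval \<mu> \<and> 0 \<le> s \<longrightarrow>
         weak_conv_at_top (\<lambda>t. cond_law M W \<mu> s t) alpha_OU)"
proof -
  interpret brownian M W by unfold_locales (rule assms)
  have "is_qsd_X M W alpha_OU"
    unfolding is_qsd_X_def using alpha_OU_prob cond_law_alpha by blast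
  moreover have "\<exists>C \<gamma>::real. C > 0 \<and> \<gamma> > 0 \<and>
         (\<forall>\<mu> s t. prob_on_interval \<mu> \<and> 0 \<le> s \<and> s \<le> t \<longrightarrow>
            tv_dist (cond_law M W \<mu> s t) alpha_OU \<le> C * ((s + 1) / (t + 1)) powr \<gamma>)"
    using cond_law_tv decay_rate_pos by (intro exI[of _ 64] exI[of _ decay_rate]) auto
  ultimately show ?thesis using alpha_OU_unique cond_law_weak by blast
qed

end
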